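(* Let $0<r_0<r_1$, $\tau>0$, $\mathcal{J}>0$, let $n\in\{2,3\}$, and let $B(r)=r^{n-1}\tilde b(r)$ with $\tilde b\in L^\infty(r_0,r_1)$, $\tilde b>0$. Consider the boundary value problem $$\left[r^{n-1}\left(\frac{1}{m}-\frac{\mathcal{J}^2}{m^3}\right)m_r+\frac{r^{n-1}\mathcal{J}}{\tau m}\right]_r=m-B(r)+r^{n-3}(n-1)(n-2)\ \text{ on } (r_0,r_1),\qquad m(r_0)=m(r_1)=\mathcal{J}. \quad (\ast)$$ 1. Case $n=2$. Put $\underline{B}=\operatorname{ess\,inf}_{[r_0,r_1]}B$ and $\overline{B}=\operatorname{ess\,sup}_{[r_0,r_1]}B$. If $\overline{B}+\frac1\tau>\mathcal{J}$ and $\underline{B}+\dfrac{\mathcal{J}}{\tau(\overline{B}+1/\tau)}>\mathcal{J}$, then $(\ast)$ has a unique interior subsonic solution $m$ on $[r_0,r_1]$. Moreover $m\in C^{1/2}[r_0,r_1]$, and there is a constant $\lambda>0$ such that $$m(r)\ge \mathcal{J}+\lambda\sin\left(\pi\cdot\frac{r-r_0}{r_1-r_0}\right),\qquad r\in[r_0,r_1].$$ 2. Case $n=3$. Put $\overline{\mathcal{B}}=\operatorname{ess\,sup}_{r\in[r_0,r_1]}\left\{B(r)+\frac{2r}{\tau}-2\right\}$. If $\overline{\mathcal{B}}>\mathcal{J}$ and $\operatorname{ess\,inf}_{r\in[r_0,r_1]}\left\{B(r)+\dfrac{2r\mathcal{J}}{\tau\overline{\mathcal{B}}}-2\right\}>\mathcal{J}$,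 then $(\ast)$ has a unique interior subsonic solution $m$. Moreover $m\in C^{1/2}[r_0,r_1]$, and there is a constant $\bar\lambda>0$ such that $$m(r)\ge \mathcal{J}+\bar\lambda\sin\left(\pi\cdot\frac{r-r_0}{r_1-r_0}\right),\qquad r\in[r_0,r_1].$$
   Context: The subscript $r$ denotes the derivative with respect to $r$. An interior subsonic solution of $(\ast)$ is a function $m:[r_0,r_1]\to\mathbb{R}$ such that $m(r_0)=m(r_1)=\mathcal{J}$, $m(r)>\mathcal{J}$ for all $r\in(r_0,r_1)$, $(m-\mathcal{J})^2\in H_0^1(r_0,r_1)$, and for every $\varphi\in H_0^1(r_0,r_1)$, $$\int_{r_0}^{r_1}\left[r^{n-1}\frac{m+\mathcal{J}}{2m^3}\big((m-\mathcal{J})^2\big)_r+\frac{r^{n-1}\mathcal{J}}{\tau m}\right]\varphi_r\,dr+\int_{r_0}^{r_1}\big(m-B(r)+r^{n-3}(n-1)(n-2)\big)\varphi\,dr=0.$$ (This is the weak form of $(\ast)$, since formally $\left(\frac1m-\frac{\mathcal{J}^2}{m^3}\right)m_r=\frac{m+\mathcal{J}}{2m^3}((m-\mathcal{J})^2)_r$.) Here $m=r^{n-1}\tilde\rho$, where $\tilde\rho$ is the radial density of a steady isothermal Euler–Poisson flow in the annulus $r_0<|x|<r_1$ in $\mathbb{R}^n$ with doping profile $\tilde b$, relaxation time $\tau$, and sonic boundary data. *)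

theory Defs
  imports "HOL-Probability.Essential_Supremum"
begin

abbreviation leb_ivl :: "real \<Rightarrow> real \<Rightarrow> real measure" where
  "leb_ivl a b \<equiv> lebesgue_on {a<..<b}"

subsection \<open>Essential bounds\<close>

definition essinf :: "'a measure \<Rightarrow> ('a \<Rightarrow> ereal) \<Rightarrow> ereal" where
  "essinf M f = - esssup M (\<lambda>x. - f x)"

text \<open>The library's essential supremum lives in a complete linear order.  The real-valued versions
  below are only meaningful for essentially bounded functions on a space of positive measure.\<close>

definition ess_sup_real :: "'a measure \<Rightarrow> ('a \<Rightarrow> real) \<Rightarrow> real" where
  "ess_sup_real M f = real_of_ereal (esssup M (\<lambda>x. ereal (f x)))"

definition ess_inf_real :: "'a measure \<Rightarrow> ('a \<Rightarrow> real) \<Rightarrow> real" where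
  "ess_inf_real M f = real_of_ereal (essinf M (\<lambda>x. ereal (f x)))"

definition Linf :: "'a measure \<Rightarrow> ('a \<Rightarrow> real) set" where
  "Linf M = {f \<in> borel_measurable M. esssup M (\<lambda>x. ereal \<bar>f x\<bar>) < \<infinity>}"

subsection \<open>Sobolev spaces on a bounded open interval\<close>

text \<open>Membership in \<open>L2\<close>, \<open>H1\<close> and \<open>H10\<close> depends only on the almost-everywhere class of a
  function on the open interval \<open>(a, b)\<close>.\<close>

definition L2 :: "real \<Rightarrow> real \<Rightarrow> (real \<Rightarrow> real) set" where
  "L2 a b = {f \<in> borel_measurable (leb_ivl a b). integrable (leb_ivl a b) (\<lambda>x. (f x)\<^sup>2)}"

definition test_functions :: "real \<Rightarrow> real \<Rightarrow> (real \<Rightarrow> real) set" where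
  "test_functions a b =
     {\<phi>. (\<forall>k. (deriv ^^ k) \<phi> differentiable_on UNIV) \<and>
         (\<exists>K. compact K \<and> K \<subseteq> {a<..<b} \<and> (\<forall>x. x \<notin> K \<longrightarrow> \<phi> x = 0))}"

text \<open>The distributional derivative of \<open>u\<close> is the square-integrable function \<open>g\<close>.\<close>

definition has_weak_deriv :: "real \<Rightarrow> real \<Rightarrow> (real \<Rightarrow> real) \<Rightarrow> (real \<Rightarrow> real) \<Rightarrow> bool" where
  "has_weak_deriv a b u g \<longleftrightarrow> u \<in> L2 a b \<and> g \<in> L2 a b \<and>
     (\<forall>\<phi>\<in>test_functions a b.
        (LINT x|leb_ivl a b. u x * deriv \<phi> x) = - (LINT x|leb_ivl a b. g x * \<phi> x))"

definition H1 :: "real \<Rightarrow> real \<Rightarrow> (real \<Rightarrow> real) set" where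
  "H1 a b = {u. \<exists>g. has_weak_deriv a b u g}"

text \<open>\<open>H10\<close> is the closure of the test functions in the \<open>H1\<close> norm.\<close>

definition H10 :: "real \<Rightarrow> real \<Rightarrow> (real \<Rightarrow> real) set" where
  "H10 a b = {u \<in> H1 a b. \<exists>g. has_weak_deriv a b u g \<and>
     (\<exists>\<phi>. (\<forall>k. \<phi> k \<in> test_functions a b) \<and>
          (\<lambda>k::nat. (LINT x|leb_ivl a b. (\<phi> k x - u x)\<^sup>2) +
                    (LINT x|leb_ivl a b. (deriv (\<phi> k) x - g x)\<^sup>2)) \<longlonglongrightarrow> 0)}"

text \<open>On a compact interval a finite seminorm already bounds the function, so for \<open>0 < \<alpha> \<le> 1\<close> this
  is membership in \<open>C\<^sup>\<alpha>\<close>.\<close>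

definition holder_on :: "real \<Rightarrow> real \<Rightarrow> real \<Rightarrow> (real \<Rightarrow> real) \<Rightarrow> bool" where
  "holder_on \<alpha> a b f \<longleftrightarrow>
     (\<exists>C. \<forall>x\<in>{a..b}. \<forall>y\<in>{a..b}. \<bar>f x - f y\<bar> \<le> C * \<bar>x - y\<bar> powr \<alpha>)"

subsection \<open>Interior subsonic solutions\<close>

text \<open>Since \<open>m\<close> is constrained pointwise, the function \<open>(m - J)\<^sup>2\<close> has to be the continuous
  representative on \<open>[r0, r1]\<close> of its class in \<open>H10\<close>, as usual in dimension one; otherwise \<open>m\<close>
  could be altered on null sets.  The function \<open>g\<close> is the weak derivative of \<open>(m - J)\<^sup>2\<close>, and
  \<open>\<psi>\<close> that of \<open>\<phi>\<close>; weak derivatives are unique up to null sets.  Both integrands are integrable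
  for essentially bounded \<open>B\<close>, \<open>J > 0\<close> and \<open>r0 > 0\<close>, because \<open>m\<close> is then bounded and at least
  \<open>J\<close>.\<close>

definition interior_subsonic_solution ::
  "nat \<Rightarrow> real \<Rightarrow> real \<Rightarrow> real \<Rightarrow> real \<Rightarrow> (real \<Rightarrow> real) \<Rightarrow> (real \<Rightarrow> real) \<Rightarrow> bool" where
  "interior_subsonic_solution n r0 r1 \<tau> J B m \<longleftrightarrow>
     m r0 = J \<and> m r1 = J \<and>
     (\<forall>r\<in>{r0<..<r1}. m r > J) \<and>
     continuous_on {r0..r1} (\<lambda>r. (m r - J)\<^sup>2) \<and>
     (\<lambda>r. (m r - J)\<^sup>2) \<in> H10 r0 r1 \<and>
     (\<exists>g. has_weak_deriv r0 r1 (\<lambda>r. (m r - J)\<^sup>2) g \<and>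
       (\<forall>\<phi>\<in>H10 r0 r1. \<forall>\<psi>. has_weak_deriv r0 r1 \<phi> \<psi> \<longrightarrow>
         (LINT r|leb_ivl r0 r1.
            (r ^ (n - 1) * ((m r + J) / (2 * (m r) ^ 3)) * g r
              + r ^ (n - 1) * J / (\<tau> * m r)) * \<psi> r)
         + (LINT r|leb_ivl r0 r1.
            (m r - B r + r powi (int n - 3) * (real n - 1) * (real n - 2)) * \<phi> r) = 0))"

end

theory Submission
  imports Defs "HOL-Complex_Analysis.Great_Picard"
begin

text \<open>Put \<open>w = (m - J)\<^sup>2\<close>, \<open>p = r\<^bsup>n-1\<^esup>\<close> and let \<open>q\<close> be \<open>B - r\<^bsup>n-3\<^esup>(n-1)(n-2)\<close>. With
  \<open>\<Phi>' = (m + J) / (2 m\<^sup>3)\<close> the equation is the first-order system \<open>\<Phi>(w)' = E / p - J / (\<tau> m)\<close>,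
  \<open>E' = m - q\<close>. Its right-hand sides are nondecreasing in both unknowns, so a comparison principle
  holds although \<open>m\<close> is only Hoelder continuous in \<open>w\<close>: if \<open>\<Phi>(w\<^sub>1) - \<Phi>(w\<^sub>2)\<close> is positive exactly between
  two zeros, then \<open>E\<^sub>1 - E\<^sub>2\<close> is nondecreasing there; it cannot become nonnegative, as the difference
  would then never return to zero, but if it is negative at the left zero the difference decreases.
  This yields uniqueness at once. For existence, the system with \<open>w\<close> truncated to \<open>[0, (M - J)\<^sup>2]\<close> is
  solved by shooting in \<open>E(r\<^sub>0)\<close> for Tonelli's retarded approximations and the Arzela-Ascoli theorem.
  The truncation is removed by comparison with the supersolution \<open>m = M\<close> and, for small \<open>l\<close>, the
  subsolution \<open>m = J + l sin(\<pi> (r - r\<^sub>0) / (r\<^sub>1 - r\<^sub>0))\<close>; here \<open>M\<close> is \<open>ess sup B + 1 / \<tau>\<close> for \<open>n = 2\<close> and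
  \<open>ess sup (B + 2 r / \<tau> - 2)\<close> for \<open>n = 3\<close>. As \<open>w\<close> is continuously differentiable, \<open>m = J + sqrt w\<close> is
  Hoelder continuous with exponent \<open>1 / 2\<close>.\<close>

section \<open>Smooth functions\<close>

text \<open>The sonic value \<open>m = J\<close> is attained at both ends, where the coefficient of
  \<open>m_r\<close> vanishes and \<open>m = J + sqrt w\<close> is not Lipschitz in
  \<open>w\<close>. Passing to \<open>w\<close> trades the degenerate coefficient for a positive
  one, but initial value problems may then lose uniqueness, so the exact equation need not have a
  shooting map. The retarded equations do have one, continuous in the initial value; hence the
  shooting precedes the limit. As \<open>B\<close> is only bounded and measurable, \<open>E\<close>
  is merely Lipschitz; adding the primitive of \<open>q\<close> to it leaves a system with
  continuous right-hand side. The constant \<open>M\<close> is chosen so that the essential supremum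
  gives \<open>M - q >= p' / \<tau>\<close>, and \<open>J < M\<close> turns this into
  \<open>M - q >= p' J / (\<tau> M)\<close>, the condition for a constant supersolution. The other
  hypothesis bounds \<open>q + p' J / (\<tau> M) - J\<close> below by some
  \<open>\<delta> > 0\<close>; so \<open>m = J\<close> with flux \<open>p / \<tau>\<close> is a
  strict subsolution, and the slack \<open>\<delta>\<close> pays for lifting it by a small sine.
  Since \<open>H10\<close> is a closure of test functions, smooth bumps and their density come
  first.\<close>

definition smooth :: "(real \<Rightarrow> real) \<Rightarrow> bool" where
  "smooth f \<longleftrightarrow> (\<forall>k. (deriv ^^ k) f differentiable_on UNIV)"

lemma smooth_deriv:
  assumes "smooth f" shows "smooth (deriv f)"
proof -
  have "(deriv ^^ k) (deriv f) = (deriv ^^ Suc k) f" for k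
    by (simp only: funpow_swap1 funpow.simps comp_apply)
  then show ?thesis using assms unfolding smooth_def by metis
qed

lemma smooth_has_deriv: "smooth f \<Longrightarrow> (f has_real_derivative deriv f x) (at x)"
  by (metis DERIV_deriv_iff_real_differentiable UNIV_I differentiable_on_def funpow_0 smooth_def)

text \<open>A class of functions that contains a derivative of each of its members consists of
  smooth functions. Choosing the class well replaces every formula for a \<open>k\<close>-th
  derivative.\<close>

lemma smooth_coinduct:
  assumes "P f"
    and step: "\<And>h. P h \<Longrightarrow> \<exists>h'. P h' \<and> (\<forall>x. (h has_real_derivative h' x) (at x))"
  shows "smooth f"
proof -
  have "P ((deriv ^^ k) f)" for k
  proof (induction k)
    case 0
    then show ?case using assms by simp
  next
    case (Suc k)
    from step[OF Suc] obtain h' where h': "P h'" "\<forall>x. ((deriv ^^ k) f has_real_derivative h' x) (at x)"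
      by blast
    then have "deriv ((deriv ^^ k) f) = h'"
      by (intro ext DERIV_imp_deriv) simp
    with h' show ?case by simp
  qed
  then have "(deriv ^^ k) f differentiable (at x)" for k x
    using step real_differentiable_def by blast
  then show ?thesis
    by (auto simp: smooth_def differentiable_on_def)
qed

lemma smooth_antiderivative:
  assumes "\<And>x. (F has_real_derivative f x) (at x)" and "smooth f"
  shows "smooth F"
  by (rule smooth_coinduct[of "\<lambda>h. h = F \<or> smooth h"])
     (use assms smooth_has_deriv smooth_deriv in blast)+

lemma smooth_const: "smooth (\<lambda>x. c)"
  by (rule smooth_coinduct[of "\<lambda>h. \<exists>c. h = (\<lambda>x. c)"]) (auto intro!: derivative_eq_intros exI[of _ "\<lambda>x. 0"])

lemma smooth_id: "smooth (\<lambda>x. x)"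
  by (rule smooth_antiderivative[OF _ smooth_const[of 1]]) (auto intro!: derivative_eq_intros)

text \<open>The derivative of a product is a sum of products, so the products alone are not an
  invariant class; the algebra generated by the smooth functions is one.\<close>

inductive smooth_alg :: "(real \<Rightarrow> real) \<Rightarrow> bool" where
  base: "smooth f \<Longrightarrow> smooth_alg f"
| add: "smooth_alg f \<Longrightarrow> smooth_alg g \<Longrightarrow> smooth_alg (\<lambda>x. f x + g x)"
| mult: "smooth_alg f \<Longrightarrow> smooth_alg g \<Longrightarrow> smooth_alg (\<lambda>x. f x * g x)"

lemma smooth_alg_smooth:
  assumes "smooth_alg f" shows "smooth f"
  using assms
proof (rule smooth_coinduct[of smooth_alg])
  fix h assume "smooth_alg h"
  then show "\<exists>h'. smooth_alg h' \<and> (\<forall>x. (h has_real_derivative h' x) (at x))"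
  proof induction
    case (base f)
    then show ?case using smooth_has_deriv smooth_deriv smooth_alg.base by blast
  next
    case (add f g)
    then obtain f' g' where "smooth_alg f'" "smooth_alg g'"
      "\<forall>x. (f has_real_derivative f' x) (at x)" "\<forall>x. (g has_real_derivative g' x) (at x)" by blast
    then show ?case
      by (intro exI[of _ "\<lambda>x. f' x + g' x"]) (auto intro: smooth_alg.add derivative_intros)
  next
    case (mult f g)
    then obtain f' g' where "smooth_alg f'" "smooth_alg g'"
      "\<forall>x. (f has_real_derivative f' x) (at x)" "\<forall>x. (g has_real_derivative g' x) (at x)" by blast
    then show ?case using mult
      by (intro exI[of _ "\<lambda>x. f' x * g x + g' x * f x"])
         (auto intro: smooth_alg.intros derivative_intros)
  qed
qed

lemma smooth_add: "smooth f \<Longrightarrow> smooth g \<Longrightarrow> smooth (\<lambda>x. f x + g x)"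
  by (rule smooth_alg_smooth[OF smooth_alg.add[OF smooth_alg.base smooth_alg.base]])

lemma smooth_mult: "smooth f \<Longrightarrow> smooth g \<Longrightarrow> smooth (\<lambda>x. f x * g x)"
  by (rule smooth_alg_smooth[OF smooth_alg.mult[OF smooth_alg.base smooth_alg.base]])

lemma smooth_diff: "smooth f \<Longrightarrow> smooth g \<Longrightarrow> smooth (\<lambda>x. f x - g x)"
  using smooth_add[OF _ smooth_mult[OF smooth_const[of "-1"]], of f g] by simp

lemma smooth_power: "smooth f \<Longrightarrow> smooth (\<lambda>x. f x ^ k)"
  by (induction k) (auto intro: smooth_const smooth_mult)

lemma smooth_affine:
  assumes "smooth f" shows "smooth (\<lambda>x. f (c * x + d))"
\<comment> \<open>The factor \<open>k\<close> absorbs the power of \<open>c\<close> that each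
  differentiation produces.\<close>
proof (rule smooth_coinduct[of "\<lambda>h. \<exists>f k. smooth f \<and> h = (\<lambda>x. k * f (c * x + d))"])
  show "\<exists>g k. smooth g \<and> (\<lambda>x. f (c * x + d)) = (\<lambda>x. k * g (c * x + d))"
    using assms by (intro exI[of _ f] exI[of _ 1]) simp
  fix h assume "\<exists>f k. smooth f \<and> h = (\<lambda>x. k * f (c * x + d))"
  then obtain f k where f: "smooth f" "h = (\<lambda>x. k * f (c * x + d))" by blast
  have "(h has_real_derivative (k * c) * deriv f (c * x + d)) (at x)" for x
    unfolding f(2) by (auto intro!: derivative_eq_intros DERIV_chain2[OF smooth_has_deriv[OF f(1)]])
  then show "\<exists>h'. (\<exists>f k. smooth f \<and> h' = (\<lambda>x. k * f (c * x + d))) \<and> (\<forall>x. (h has_real_derivative h' x) (at x))"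
    using smooth_deriv[OF f(1)] by blast
qed

lemma smooth_real_polynomial_function:
  "real_polynomial_function p \<Longrightarrow> smooth p" for p :: "real \<Rightarrow> real"
proof (induction rule: real_polynomial_function.induct)
  case (linear f)
  then have "f = (\<lambda>x. x * f 1)"
    by (metis linear_simps(5) mult.right_neutral real_scaleR_def)
  then show ?case using smooth_mult[OF smooth_id smooth_const] by metis
qed (auto intro: smooth_const smooth_add smooth_mult)

section \<open>A smooth function vanishing exactly on a half-line\<close>

lemma poly_exp_at_right_0:
  "((\<lambda>x. poly p (1 / x) * exp (- 1 / x)) \<longlongrightarrow> 0) (at_right 0)" for p :: "real poly"
proof -
  have "((\<lambda>y. poly p y / exp y) \<longlongrightarrow> 0) at_top"
  proof (induction p)
    case 0
    then show ?case by simp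
  next
    case (pCons c p)
    have *: "((\<lambda>y. \<Sum>i\<le>degree q. coeff q i * (y ^ i / exp y)) \<longlongrightarrow> (\<Sum>i\<le>degree q. coeff q i * 0)) at_top" for q :: "real poly"
      by (intro tendsto_intros tendsto_power_div_exp_0)
    then show ?case
      using *[of "pCons c p"]  by (simp add: poly_altdef sum_divide_distrib)
  qed
  then have "((\<lambda>x. poly p (inverse x) / exp (inverse x)) \<longlongrightarrow> 0) (at_right 0)"
    by (rule filterlim_compose) (rule filterlim_inverse_at_top_right)
  then show ?thesis
    by (simp add: exp_minus field_simps)
qed

text \<open>The functions \<open>P (1 / x) * exp (- 1 / x)\<close>, extended by zero, are closed under differentiation.\<close>
definition exp_bump :: "real poly \<Rightarrow> real \<Rightarrow> real" where
  "exp_bump p x = (if x > 0 then poly p (1 / x) * exp (- 1 / x) else 0)"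

text \<open>In the variable \<open>y = 1 / x\<close>, differentiation sends the polynomial
  \<open>p\<close> to \<open>y^2 (p - p')\<close>. Only \<open>x = 0\<close> needs a limit of
  difference quotients.\<close>

lemma exp_bump_has_deriv:
  "(exp_bump p has_real_derivative exp_bump ([:0, 0, 1:] * (p - pderiv p)) x) (at x)"
proof -
  consider "x < 0" | "x = 0" | "x > 0" by linarith
  then show ?thesis
  proof cases
    case 1
    have "((\<lambda>x. 0) has_real_derivative 0) (at x)" by simp
    then have "(exp_bump p has_real_derivative 0) (at x)"
      by (rule has_field_derivative_transform_within_open[where S = "{..<0}"])
         (use 1 in \<open>auto simp: exp_bump_def\<close>)
    then show ?thesis using 1 by (simp add: exp_bump_def)
  next
    case 2
    have "((\<lambda>h. exp_bump p h / h) \<longlongrightarrow> 0) (at 0)"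
    proof (rule filterlim_split_at)
      show "((\<lambda>h. exp_bump p h / h) \<longlongrightarrow> 0) (at_left 0)"
        by (rule tendsto_eventually) (auto simp: eventually_at_filter exp_bump_def)
      \<comment> \<open>Dividing by \<open>h\<close> multiplies the polynomial in
        \<open>1 / h\<close> by its variable, hence \<open>pCons 0 p\<close>.\<close>
      show "((\<lambda>h. exp_bump p h / h) \<longlongrightarrow> 0) (at_right 0)"
        by (rule Lim_transform_eventually[OF poly_exp_at_right_0[of "pCons 0 p"]])
           (auto simp: eventually_at_filter exp_bump_def)
    qed
    then show ?thesis using 2
      by (simp add: DERIV_def exp_bump_def)
  next
    case 3
    have "((\<lambda>x. poly p (1 / x) * exp (- 1 / x)) has_real_derivative
        poly ([:0, 0, 1:] * (p - pderiv p)) (1 / x) * exp (- 1 / x)) (at x)"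
      using 3 by (auto intro!: derivative_eq_intros DERIV_chain2[OF poly_DERIV] simp: field_simps power2_eq_square)
    then have "(exp_bump p has_real_derivative
        poly ([:0, 0, 1:] * (p - pderiv p)) (1 / x) * exp (- 1 / x)) (at x)"
      by (rule has_field_derivative_transform_within_open[where S = "{0<..}"])
         (use 3 in \<open>auto simp: exp_bump_def\<close>)
    then show ?thesis using 3 by (simp add: exp_bump_def)
  qed
qed

lemma smooth_exp_bump: "smooth (exp_bump p)"
  by (rule smooth_coinduct[of "\<lambda>h. \<exists>p. h = exp_bump p"]) (use exp_bump_has_deriv in blast)+

lemma exp_bump_1: "exp_bump 1 x = (if x > 0 then exp (- 1 / x) else 0)"
  by (simp add: exp_bump_def)

lemma exp_bump_1_mono: "x \<le> y \<Longrightarrow> exp_bump 1 x \<le> exp_bump 1 y"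
  by (auto simp: exp_bump_1 frac_le)

lemma exp_bump_1_bounds: "0 \<le> exp_bump 1 x" "exp_bump 1 x < 1"
  by (auto simp: exp_bump_1)

section \<open>Test functions and the fundamental lemma\<close>

lemma AE_leb_ivlI:
  assumes "negligible N" "\<And>x. a < x \<Longrightarrow> x < b \<Longrightarrow> x \<notin> N \<Longrightarrow> P x"
  shows "AE x in leb_ivl a b. P x"
proof -
  have "N \<in> null_sets lebesgue" using assms(1) by (simp add: negligible_iff_null_sets)
  then have "AE x in lebesgue. x \<notin> N" by (rule AE_not_in)
  then have "AE x in lebesgue. x \<in> {a<..<b} \<longrightarrow> P x"
    by eventually_elim (use assms(2) in auto)
  then show ?thesis by (simp add: AE_restrict_space_iff)
qed

lemma AE_leb_ivl_interior: "AE x in leb_ivl a b. a < x \<and> x < b"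
  by (rule AE_leb_ivlI[of "{}"]) auto

lemma AE_leb_ivl_False:
  assumes "a < b" "AE x in leb_ivl a b. False" shows False
proof -
  have "emeasure (leb_ivl a b) (space (leb_ivl a b)) = 0"
    using assms(2) by (simp add: eventually_False ae_filter_eq_bot_iff)
  then show False using assms(1) by (simp add: emeasure_restrict_space)
qed

lemma finite_measure_leb_ivl: "finite_measure (leb_ivl a b)"
  by (rule finite_measure_lebesgue_on) simp

lemma continuous_on_measurable_leb_ivl:
  fixes f :: "real \<Rightarrow> real"
  shows "continuous_on {a<..<b} f \<Longrightarrow> f \<in> borel_measurable (leb_ivl a b)"
  by (rule continuous_imp_measurable_on_sets_lebesgue) auto

lemma bounded_integrable_leb_ivl:
  fixes f :: "real \<Rightarrow> real"
  assumes "f \<in> borel_measurable (leb_ivl a b)" "AE x in leb_ivl a b. \<bar>f x\<bar> \<le> C"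
  shows "integrable (leb_ivl a b) f"
  by (rule finite_measure.integrable_const_bound[OF finite_measure_leb_ivl, where B = C]) (use assms in auto)

lemma integrable_mult_bounded:
  fixes g f :: "'a \<Rightarrow> real"
  assumes "integrable M g" "f \<in> borel_measurable M" "AE x in M. \<bar>f x\<bar> \<le> C"
  shows "integrable M (\<lambda>x. g x * f x)"
proof (rule Bochner_Integration.integrable_bound[of M "\<lambda>x. C * g x"])
  show "AE x in M. norm (g x * f x) \<le> norm (C * g x)"
    using assms(3)
  proof eventually_elim
    case (elim x)
    then have "\<bar>g x\<bar> * \<bar>f x\<bar> \<le> \<bar>g x\<bar> * \<bar>C\<bar>" by (intro mult_left_mono) auto
    then show ?case by (simp add: abs_mult mult.commute)
  qed
qed (use assms in auto)

text \<open>Dominated convergence with majorant \<open>C * \<bar>g x\<bar>\<close>. On a finite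
  measure the choice \<open>g = 1\<close> gives bounded convergence.\<close>

lemma tendsto_integral_mult_bounded:
  fixes g :: "'a \<Rightarrow> real"
  assumes g: "integrable M g"
    and f: "\<And>n. f n \<in> borel_measurable M" "\<And>n. AE x in M. \<bar>f n x\<bar> \<le> C"
    and h: "h \<in> borel_measurable M" and lim: "AE x in M. (\<lambda>n. f n x) \<longlonglongrightarrow> h x"
  shows "(\<lambda>n. LINT x|M. g x * f n x) \<longlonglongrightarrow> (LINT x|M. g x * h x)"
proof (rule integral_dominated_convergence[where w = "\<lambda>x. C * \<bar>g x\<bar>"])
  show "AE x in M. norm (g x * f n x) \<le> C * \<bar>g x\<bar>" for n
    using f(2)[of n] by eventually_elim (simp add: abs_mult mult.commute[of C] mult_left_mono)
  show "AE x in M. (\<lambda>n. g x * f n x) \<longlonglongrightarrow> g x * h x"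
    using lim by eventually_elim (intro tendsto_intros)
qed (use assms in auto)

section \<open>Compactly supported smooth functions and their density\<close>

lemma test_functionI:
  assumes "smooth \<phi>" "a < c" "d < b" "\<And>x. x < c \<or> d < x \<Longrightarrow> \<phi> x = 0"
  shows "\<phi> \<in> test_functions a b"
proof -
  have "compact {c..d}" "{c..d} \<subseteq> {a<..<b}" "\<forall>x. x \<notin> {c..d} \<longrightarrow> \<phi> x = 0"
    using assms by (auto simp: not_le)
  then show ?thesis using assms(1) unfolding test_functions_def smooth_def by blast
qed

lemma test_functionE:
  assumes "\<phi> \<in> test_functions a b" "a < b"
  obtains c d where "smooth \<phi>" "a < c" "c < d" "d < b" "\<And>x. x \<le> c \<or> d \<le> x \<Longrightarrow> \<phi> x = 0"
proof -
  from assms obtain K where K: "compact K" "K \<subseteq> {a<..<b}" "\<And>x. x \<notin> K \<Longrightarrow> \<phi> x = 0" and "smooth \<phi>"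
    by (auto simp: test_functions_def smooth_def)
  \<comment> \<open>Adding the midpoint makes the compact set nonempty even if \<open>K\<close> is
    empty, so that extreme points exist.\<close>
  define m where "m = (a + b) / 2"
  have "compact (insert m K)" "insert m K \<noteq> {}" "insert m K \<subseteq> {a<..<b}"
    using K assms(2) by (auto simp: m_def)
  then obtain l u where lu: "l \<in> insert m K" "u \<in> insert m K" "\<forall>x\<in>insert m K. l \<le> x \<and> x \<le> u"
    by (meson compact_attains_inf compact_attains_sup)
  \<comment> \<open>Points strictly between the support and the ends: the function then vanishes at
    \<open>c\<close> and \<open>d\<close> as well, and \<open>c < d\<close> holds even if
    \<open>l = u\<close>.\<close>
  define c d where "c = (a + l) / 2" and "d = (u + b) / 2"
  have "a < l" "u < b" "l \<le> u" using lu \<open>insert m K \<subseteq> _\<close> by auto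
  then have cd: "a < c" "c < l" "u < d" "d < b" "c < d" by (auto simp: c_def d_def)
  have "x \<notin> K" if "x \<le> c \<or> d \<le> x" for x
    using lu(3) that cd by force
  with cd K(3) \<open>smooth \<phi>\<close> show thesis by (intro that[of c d]) auto
qed

lemma smooth_continuous_on: "smooth f \<Longrightarrow> continuous_on S f"
  by (meson DERIV_isCont continuous_at_imp_continuous_on smooth_has_deriv)

lemma test_function_smooth: "\<phi> \<in> test_functions a b \<Longrightarrow> smooth \<phi>"
  by (simp add: test_functions_def smooth_def)

lemma test_function_continuous_on: "\<phi> \<in> test_functions a b \<Longrightarrow> continuous_on S \<phi>"
  by (simp add: test_function_smooth smooth_continuous_on)

lemma smooth_measurable [measurable]: "smooth f \<Longrightarrow> f \<in> borel_measurable (leb_ivl a b)"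
  by (intro continuous_on_measurable_leb_ivl smooth_continuous_on)

lemma test_function_scale: "\<phi> \<in> test_functions a b \<Longrightarrow> (\<lambda>x. k * \<phi> x) \<in> test_functions a b"
  unfolding test_functions_def
  using smooth_mult[OF smooth_const[of k], of \<phi>] by (auto simp: smooth_def)

lemma test_function_diff:
  assumes "\<phi> \<in> test_functions a b" "\<psi> \<in> test_functions a b" "a < b"
  shows "(\<lambda>x. \<phi> x - \<psi> x) \<in> test_functions a b"
proof -
  obtain c d where 1: "smooth \<phi>" "a < c" "c < d" "d < b" "\<And>x. x \<le> c \<or> d \<le> x \<Longrightarrow> \<phi> x = 0"
    using test_functionE[OF assms(1,3)] by metis
  obtain c' d' where 2: "smooth \<psi>" "a < c'" "c' < d'" "d' < b" "\<And>x. x \<le> c' \<or> d' \<le> x \<Longrightarrow> \<psi> x = 0"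
    using test_functionE[OF assms(2,3)] by metis
  show ?thesis
    by (rule test_functionI[of _ _ "min c c'" "max d d'"])
       (use 1 2 in \<open>auto intro: smooth_diff\<close>)
qed

text \<open>As \<open>0 \<le> u < 1\<close> for the product \<open>u\<close> of the two bumps, \<open>1 - (1 - u) ^ n\<close> tends to 1 where \<open>u > 0\<close>.\<close>

definition cutoff :: "real \<Rightarrow> real \<Rightarrow> nat \<Rightarrow> real \<Rightarrow> real" where
  "cutoff a b n x = 1 - (1 - exp_bump 1 (x - (a + 1 / (n + 1))) * exp_bump 1 (b - 1 / (n + 1) - x)) ^ n"

lemma smooth_cutoff: "smooth (cutoff a b n)"
proof -
  have 1: "smooth (\<lambda>x. exp_bump 1 (x - c))" for c
    using smooth_affine[OF smooth_exp_bump, of 1 1 "-c"] by simp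
  have 2: "smooth (\<lambda>x. exp_bump 1 (c - x))" for c
    using smooth_affine[OF smooth_exp_bump, of 1 "-1" c] by simp
  show ?thesis unfolding cutoff_def
    by (intro smooth_diff smooth_const smooth_power smooth_mult 1 2)
qed

lemma cutoff_eq_0: "x \<le> a + 1 / (n + 1) \<or> b - 1 / (n + 1) \<le> x \<Longrightarrow> cutoff a b n x = 0"
  by (auto simp: cutoff_def exp_bump_1 algebra_simps)

lemma cutoff_bounds: "0 \<le> cutoff a b n x" "cutoff a b n x \<le> 1"
proof -
  have "0 \<le> exp_bump 1 s * exp_bump 1 t" "exp_bump 1 s * exp_bump 1 t \<le> 1" for s t
    using exp_bump_1_bounds[of s] exp_bump_1_bounds[of t] by (auto intro: mult_le_one)
  then show "0 \<le> cutoff a b n x" "cutoff a b n x \<le> 1"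
    by (auto simp: cutoff_def power_le_one)
qed

text \<open>The bumps themselves move with \<open>n\<close>. Once \<open>1 / (n + 1)\<close> is
  below half the distance of \<open>x\<close> to either end, their product is at least the fixed
  number \<open>u\<close>, so the defect from 1 is at most \<open>(1 - u) ^ n\<close>.\<close>

lemma cutoff_tendsto_1:
  assumes "a < x" "x < b" shows "(\<lambda>n. cutoff a b n x) \<longlonglongrightarrow> 1"
proof -
  define c d where "c = (x - a) / 2" and "d = (b - x) / 2"
  define u where "u = exp_bump 1 c * exp_bump 1 d"
  have u: "0 < u" "u < 1"
    using assms mult_strict_mono[of "exp_bump 1 c" 1 "exp_bump 1 d" 1] exp_bump_1_bounds[of c] exp_bump_1_bounds[of d]
    by (auto simp: u_def c_def d_def exp_bump_1 intro!: mult_pos_pos)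
  have "eventually (\<lambda>n. \<bar>inverse (real (Suc n)) - 0\<bar> < min c d) sequentially"
    using assms LIMSEQ_inverse_real_of_nat[THEN tendstoD, of "min c d"]
    by (auto simp: c_def d_def dist_real_def)
  then have "eventually (\<lambda>n. norm (cutoff a b n x - 1) \<le> (1 - u) ^ n) sequentially"
  proof eventually_elim
    case (elim n)
    define v where "v = exp_bump 1 (x - (a + 1 / (n + 1))) * exp_bump 1 (b - 1 / (n + 1) - x)"
    have "1 / real (n + 1) < c" "1 / real (n + 1) < d"
      using elim by (auto simp: field_simps)
    then have "u \<le> v" unfolding u_def v_def
      by (intro mult_mono exp_bump_1_mono exp_bump_1_bounds) (auto simp: c_def d_def field_simps)
    moreover have "v \<le> 1"
      unfolding v_def using exp_bump_1_bounds by (intro mult_le_one) (auto intro: less_imp_le)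
    ultimately have "(1 - v) ^ n \<le> (1 - u) ^ n" "0 \<le> (1 - v) ^ n"
      by (auto intro!: power_mono)
    moreover have "cutoff a b n x - 1 = - ((1 - v) ^ n)"
      by (simp add: cutoff_def v_def add.commute)
    ultimately show ?case by simp
  qed
  moreover have "(\<lambda>n. (1 - u) ^ n) \<longlonglongrightarrow> 0"
    using u by (intro LIMSEQ_power_zero) auto
  ultimately have "(\<lambda>n. cutoff a b n x - 1) \<longlonglongrightarrow> 0"
    by (rule Lim_null_comparison)
  then show ?thesis by (simp add: LIM_zero_iff)
qed

text \<open>Takes the place of mollification. A measurable \<open>h\<close> is an almost-everywhere
  limit of continuous functions; these are clamped to \<open>[-C, C]\<close>, replaced by
  polynomials within \<open>1 / (n + 1)\<close>, and cut off near the ends. The extra 1 in the bound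
  is the largest polynomial error.\<close>

lemma test_functions_dense_bounded:
  assumes ab: "a < b" and h: "h \<in> borel_measurable (leb_ivl a b)" "AE x in leb_ivl a b. \<bar>h x\<bar> \<le> C"
  obtains \<eta> :: "nat \<Rightarrow> real \<Rightarrow> real" where "\<And>n. \<eta> n \<in> test_functions a b" "\<And>n x. \<bar>\<eta> n x\<bar> \<le> C + 1"
    "AE x in leb_ivl a b. (\<lambda>n. \<eta> n x) \<longlonglongrightarrow> h x"
proof -
  have "C \<ge> 0"
  proof (rule ccontr)
    assume "\<not> C \<ge> 0"
    have "AE x in leb_ivl a b. False"
      using h(2) by (rule AE_mp) (use \<open>\<not> C \<ge> 0\<close> in auto)
    then show False using AE_leb_ivl_False[OF ab] by blast
  qed
  have "h measurable_on {a<..<b}"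
    using h(1) by (simp add: measurable_on_iff_borel_measurable)
  then obtain N g where N: "negligible N" and g: "\<And>n. continuous_on UNIV (g n)"
    "\<And>x. x \<notin> N \<Longrightarrow> (\<lambda>n. g n x) \<longlonglongrightarrow> (if x \<in> {a<..<b} then h x else 0)"
    unfolding measurable_on_def by blast
  define k where "k n x = max (- C) (min C (g n x))" for n :: nat and x
  have "\<exists>q. real_polynomial_function q \<and> (\<forall>x\<in>{a..b}. \<bar>k n x - q x\<bar> < 1 / (real n + 1))" for n
  proof -
    have "continuous_on {a..b} (k n)" unfolding k_def
      by (intro continuous_intros continuous_on_subset[OF g(1)]) auto
    moreover have "0 < 1 / (real n + 1)" by simp
    ultimately show ?thesis
      using Stone_Weierstrass_real_polynomial_function[OF compact_Icc] by metis
  qed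
  then obtain q where q: "\<And>n. real_polynomial_function (q n)"
    "\<And>n x. x \<in> {a..b} \<Longrightarrow> \<bar>k n x - q n x\<bar> < 1 / (real n + 1)" by metis
  define \<eta> where "\<eta> n x = q n x * cutoff a b n x" for n x
  show thesis
  proof
    show "\<eta> n \<in> test_functions a b" for n
    proof (rule test_functionI)
      show "smooth (\<eta> n)" unfolding \<eta>_def
        by (intro smooth_mult smooth_cutoff smooth_real_polynomial_function q)
      show "\<eta> n x = 0" if "x < a + 1 / (n + 1) \<or> b - 1 / (n + 1) < x" for x
        using that cutoff_eq_0[of x a n b] by (auto simp: \<eta>_def)
    qed auto
    show "\<bar>\<eta> n x\<bar> \<le> C + 1" for n x
    proof (cases "a < x \<and> x < b")
      case True
      have "\<bar>k n x\<bar> \<le> C" using \<open>C \<ge> 0\<close> by (auto simp: k_def)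
      moreover have "\<bar>k n x - q n x\<bar> < 1 / (real n + 1)" "1 / (real n + 1) \<le> 1"
        using q(2)[of x n] True by auto
      ultimately have "\<bar>q n x\<bar> \<le> C + 1" by linarith
      then have "\<bar>q n x\<bar> * \<bar>cutoff a b n x\<bar> \<le> (C + 1) * 1"
        using cutoff_bounds[of a b n x] by (intro mult_mono) auto
      then show ?thesis by (simp add: \<eta>_def abs_mult)
    next
      case False
      then have "x \<le> a + 1 / (n + 1) \<or> b - 1 / (n + 1) \<le> x" by (smt (verit) divide_nonneg_nonneg of_nat_0_le_iff)
      then show ?thesis using cutoff_eq_0[of x a n b] \<open>C \<ge> 0\<close> by (simp add: \<eta>_def)
    qed
    have "AE x in leb_ivl a b. x \<notin> N"
      by (rule AE_leb_ivlI[OF N]) auto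
    with h(2) AE_leb_ivl_interior show "AE x in leb_ivl a b. (\<lambda>n. \<eta> n x) \<longlonglongrightarrow> h x"
    proof eventually_elim
      case (elim x)
      have "(\<lambda>n. k n x) \<longlonglongrightarrow> max (- C) (min C (h x))"
        unfolding k_def using g(2)[of x] elim by (intro tendsto_intros) auto
      moreover have "max (- C) (min C (h x)) = h x" using elim by auto
      ultimately have "(\<lambda>n. k n x) \<longlonglongrightarrow> h x" by simp
      moreover have "(\<lambda>n. k n x - q n x) \<longlonglongrightarrow> 0"
      proof (rule Lim_null_comparison)
        show "eventually (\<lambda>n. norm (k n x - q n x) \<le> inverse (real (Suc n))) sequentially"
          using q(2)[of x] elim by (auto simp: field_simps intro!: always_eventually less_imp_le)
      qed (rule LIMSEQ_inverse_real_of_nat)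
      ultimately have "(\<lambda>n. k n x - (k n x - q n x)) \<longlonglongrightarrow> h x - 0" by (rule tendsto_diff)
      then have "(\<lambda>n. q n x * cutoff a b n x) \<longlonglongrightarrow> h x * 1"
        using elim by (intro tendsto_mult cutoff_tendsto_1) auto
      then show ?case by (simp add: \<eta>_def)
    qed
  qed
qed

text \<open>The sign of \<open>g\<close> is a bounded limit of test functions, so testing with it is
  allowed and yields that the integral of \<open>\<bar>g\<bar>\<close> vanishes.\<close>

lemma fundamental_lemma:
  assumes ab: "a < b" and g: "integrable (leb_ivl a b) g"
    and 0: "\<And>\<phi>. \<phi> \<in> test_functions a b \<Longrightarrow> (LINT x|leb_ivl a b. g x * \<phi> x) = 0"
  shows "AE x in leb_ivl a b. g x = 0"
proof -
  have [measurable]: "(\<lambda>x. sgn (g x)) \<in> borel_measurable (leb_ivl a b)" using g by measurable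
  have "AE x in leb_ivl a b. \<bar>sgn (g x)\<bar> \<le> 1" by (auto simp: sgn_if)
  from test_functions_dense_bounded[OF ab _ this] obtain \<eta> where
    \<eta>: "\<And>n. \<eta> n \<in> test_functions a b" "\<And>n x. \<bar>\<eta> n x\<bar> \<le> 1 + 1"
    "AE x in leb_ivl a b. (\<lambda>n. \<eta> n x) \<longlonglongrightarrow> sgn (g x)" by auto
  have "(\<lambda>n. LINT x|leb_ivl a b. g x * \<eta> n x) \<longlonglongrightarrow> (LINT x|leb_ivl a b. g x * sgn (g x))"
    by (rule tendsto_integral_mult_bounded[OF g, where C = 2])
       (use \<eta> test_function_smooth smooth_measurable in \<open>auto\<close>)
  then have "(LINT x|leb_ivl a b. g x * sgn (g x)) = 0"
    unfolding 0[OF \<eta>(1)] by (simp add: LIMSEQ_const_iff)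
  then have "(LINT x|leb_ivl a b. \<bar>g x\<bar>) = 0"
    by (simp only: abs_sgn)
  then show ?thesis
    using integral_nonneg_eq_0_iff_AE[of "leb_ivl a b" "\<lambda>x. \<bar>g x\<bar>"] g by auto
qed

text \<open>If every test function had integral zero, the fundamental lemma applied to the constant
  1 would give \<open>1 = 0\<close>; a test function with nonzero integral is then
  normalised.\<close>

lemma test_function_integral_1:
  assumes "a < b" obtains \<rho> where "\<rho> \<in> test_functions a b" "(LINT x|leb_ivl a b. \<rho> x) = 1"
proof -
  have "\<exists>\<phi>\<in>test_functions a b. (LINT x|leb_ivl a b. \<phi> x) \<noteq> 0"
  proof (rule ccontr)
    assume "\<not> ?thesis"
    then have "AE x in leb_ivl a b. (1::real) = 0"
      by (intro fundamental_lemma[OF assms]) (auto intro: bounded_integrable_leb_ivl[of _ _ _ 1])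
    then show False using AE_leb_ivl_False[OF assms] by simp
  qed
  then obtain \<phi> where \<phi>: "\<phi> \<in> test_functions a b" "(LINT x|leb_ivl a b. \<phi> x) \<noteq> 0" by blast
  show thesis
    by (rule that[OF test_function_scale[OF \<phi>(1), of "1 / (LINT x|leb_ivl a b. \<phi> x)"]]) (use \<phi>(2) in simp)
qed

lemma continuous_on_integrable_leb_ivl:
  fixes f :: "real \<Rightarrow> real"
  assumes "continuous_on {a..b} f"
  shows "integrable (leb_ivl a b) f"
proof -
  have "compact (f ` {a..b})" using assms by (intro compact_continuous_image) auto
  then obtain C where "\<forall>y\<in>f ` {a..b}. \<bar>y\<bar> \<le> C" using compact_imp_bounded bounded_real by metis
  then show ?thesis
    using assms
    by (intro bounded_integrable_leb_ivl[of _ _ _ C] continuous_on_measurable_leb_ivl AE_leb_ivlI[of "{}"])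
       (auto intro: continuous_on_subset)
qed

lemma smooth_integrable: "smooth f \<Longrightarrow> integrable (leb_ivl a b) f"
  by (intro continuous_on_integrable_leb_ivl smooth_continuous_on)

text \<open>Bridge between the Lebesgue integral, in which weak derivatives are formulated, and the
  gauge integral, in which the fundamental theorem of calculus is available.\<close>

lemma integral_leb_ivl_eq:
  fixes f :: "real \<Rightarrow> real"
  assumes "integrable (leb_ivl a b) f"
  shows "f integrable_on {a..b}" "(LINT x|leb_ivl a b. f x) = integral {a..b} f"
proof -
  have "(f has_integral (LINT x|leb_ivl a b. f x)) {a<..<b}"
    by (rule has_integral_integral_lebesgue_on[OF assms]) simp
  then have *: "(f has_integral (LINT x|leb_ivl a b. f x)) {a..b}"
    by (simp add: has_integral_Icc_iff_Ioo)
  then show "f integrable_on {a..b}" by blast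
  from * show "(LINT x|leb_ivl a b. f x) = integral {a..b} f" by (simp add: integral_unique)
qed

lemma integral_leb_ivl_deriv:
  assumes "a \<le> b" "\<And>x. x \<in> {a..b} \<Longrightarrow> (F has_real_derivative f x) (at x within {a..b})"
    and "continuous_on {a..b} f"
  shows "(LINT x|leb_ivl a b. f x) = F b - F a"
proof -
  have "(f has_integral (F b - F a)) {a..b}"
    using assms by (intro fundamental_theorem_of_calculus) (auto simp: has_real_derivative_iff_has_vector_derivative)
  then show ?thesis
    using integral_leb_ivl_eq[OF continuous_on_integrable_leb_ivl[OF assms(3)]] by (simp add: integral_unique)
qed

lemma smooth_has_antiderivative:
  assumes "smooth f" obtains F where "smooth F" "\<And>x. (F has_real_derivative f x) (at x)"
proof -
  have "\<exists>F. \<forall>x :: real. (-\<infinity>::ereal) < x \<longrightarrow> x < (\<infinity>::ereal) \<longrightarrow> (F has_vector_derivative f x) (at x)"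
    by (rule einterval_antiderivative) (auto intro: DERIV_isCont smooth_has_deriv assms)
  then obtain F where "\<And>x. (F has_real_derivative f x) (at x)"
    by (auto simp: has_real_derivative_iff_has_vector_derivative)
  then show thesis using smooth_antiderivative assms that by blast
qed

text \<open>An antiderivative is constant on either side of the support; the vanishing integral
  makes the two constants equal, and subtracting them restores compact support.\<close>

lemma test_function_antiderivative:
  assumes ab: "a < b" and \<psi>: "\<psi> \<in> test_functions a b" "(LINT x|leb_ivl a b. \<psi> x) = 0"
  obtains \<phi> where "\<phi> \<in> test_functions a b" "deriv \<phi> = \<psi>"
proof -
  obtain c d where cd: "smooth \<psi>" "a < c" "c < d" "d < b" "\<And>x. x \<le> c \<or> d \<le> x \<Longrightarrow> \<psi> x = 0"
    using test_functionE[OF \<psi>(1) ab] by metis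
  obtain F where F: "smooth F" "\<And>x. (F has_real_derivative \<psi> x) (at x)"
    using smooth_has_antiderivative[OF cd(1)] by metis
  have left: "F x = F c" if "x \<le> c" for x
  proof (cases "x = c")
    case False
    have "\<exists>z>x. z < c \<and> F c - F x = (c - x) * \<psi> z"
      using False that F(2) by (intro MVT2) auto
    then show ?thesis using cd(5) by auto
  qed simp
  have right: "F x = F d" if "d \<le> x" for x
  proof (cases "x = d")
    case False
    have "\<exists>z>d. z < x \<and> F x - F d = (x - d) * \<psi> z"
      using False that F(2) by (intro MVT2) auto
    then show ?thesis using cd(5) by auto
  qed simp
  have "F b - F a = 0"
    using integral_leb_ivl_deriv[of a b F \<psi>] ab F(2) smooth_continuous_on[OF cd(1)] \<psi>(2)
    by (auto intro: has_field_derivative_at_within)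
  then have *: "F d = F c" using left[of a] right[of b] cd by simp
  show thesis
  proof
    show "(\<lambda>x. F x - F c) \<in> test_functions a b"
    proof (rule test_functionI[of _ _ c d])
      show "F x - F c = 0" if "x < c \<or> d < x" for x
        using that left[of x] right[of x] * by auto
    qed (use cd F(1) in \<open>auto intro: smooth_diff smooth_const\<close>)
    show "deriv (\<lambda>x. F x - F c) = \<psi>"
      by (intro ext DERIV_imp_deriv) (auto intro!: derivative_eq_intros F(2))
  qed
qed

section \<open>Weak derivatives in one dimension\<close>

lemma integrable_of_square_integrable:
  fixes f :: "'a \<Rightarrow> real"
  assumes "finite_measure M" "f \<in> borel_measurable M" "integrable M (\<lambda>x. (f x)\<^sup>2)"
  shows "integrable M f"
proof (rule Bochner_Integration.integrable_bound)
  show "integrable M (\<lambda>x. 1 + (f x)\<^sup>2)"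
    using assms by (simp add: finite_measure.integrable_const)
  show "AE x in M. norm (f x) \<le> norm (1 + (f x)\<^sup>2)"
  proof (rule AE_I2)
    fix x
    have "\<bar>f x\<bar> \<le> 1 + (f x)\<^sup>2"
      using sum_squares_bound[of 1 "\<bar>f x\<bar>"] by (simp add: power2_eq_square)
    then show "norm (f x) \<le> norm (1 + (f x)\<^sup>2)" by simp
  qed
qed (rule assms)

lemma L2_integrable: "f \<in> L2 a b \<Longrightarrow> integrable (leb_ivl a b) f"
  by (auto simp: L2_def intro: integrable_of_square_integrable finite_measure_leb_ivl)

lemma L2_measurable: "f \<in> L2 a b \<Longrightarrow> f \<in> borel_measurable (leb_ivl a b)"
  by (simp add: L2_def)

lemma bounded_L2:
  assumes "f \<in> borel_measurable (leb_ivl a b)" "AE x in leb_ivl a b. \<bar>f x\<bar> \<le> C"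
  shows "f \<in> L2 a b"
proof -
  have "AE x in leb_ivl a b. \<bar>(f x)\<^sup>2\<bar> \<le> C\<^sup>2"
    using assms(2) by eventually_elim (auto intro: power2_le_iff_abs_le[THEN iffD2] simp: abs_le_square_iff[symmetric])
  then show ?thesis using assms(1)
    by (auto simp: L2_def intro!: bounded_integrable_leb_ivl[where C = "C\<^sup>2"])
qed

lemma continuous_on_bounded_ivl:
  fixes f :: "real \<Rightarrow> real"
  assumes "continuous_on {a..b} f"
  obtains C where "\<And>x. x \<in> {a..b} \<Longrightarrow> \<bar>f x\<bar> \<le> C" "C \<ge> 0"
proof -
  have "compact (f ` {a..b})" using assms by (intro compact_continuous_image) auto
  then obtain C where C: "\<forall>y\<in>f ` {a..b}. \<bar>y\<bar> \<le> C" using compact_imp_bounded bounded_real by metis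
  show thesis
  proof
    show "\<bar>f x\<bar> \<le> max C 0" if "x \<in> {a..b}" for x using C that by (auto simp: le_max_iff_disj)
  qed simp
qed

lemma continuous_on_Icc_measurable:
  "continuous_on {a..b} f \<Longrightarrow> f \<in> borel_measurable (leb_ivl a b)" for f :: "real \<Rightarrow> real"
  by (rule continuous_on_measurable_leb_ivl) (auto intro: continuous_on_subset)

lemma continuous_on_AE_bounded:
  fixes f :: "real \<Rightarrow> real"
  assumes "continuous_on {a..b} f"
  obtains C where "AE x in leb_ivl a b. \<bar>f x\<bar> \<le> C" "C \<ge> 0"
proof -
  obtain C where "\<And>x. x \<in> {a..b} \<Longrightarrow> \<bar>f x\<bar> \<le> C" "C \<ge> 0"
    using continuous_on_bounded_ivl[OF assms] by metis
  then show thesis by (intro that[of C] AE_leb_ivlI[of "{}"]) auto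
qed

lemma continuous_on_L2:
  "continuous_on {a..b} f \<Longrightarrow> f \<in> L2 a b" for f :: "real \<Rightarrow> real"
  by (meson bounded_L2 continuous_on_AE_bounded continuous_on_Icc_measurable)

lemma integrable_mult_continuous:
  fixes f g :: "real \<Rightarrow> real"
  assumes "integrable (leb_ivl a b) f" "continuous_on {a..b} g"
  shows "integrable (leb_ivl a b) (\<lambda>x. f x * g x)"
  using continuous_on_AE_bounded[OF assms(2)] continuous_on_Icc_measurable[OF assms(2)] assms(1)
  by (metis integrable_mult_bounded)

lemma deriv_test_function_continuous: "\<phi> \<in> test_functions a b \<Longrightarrow> continuous_on S (deriv \<phi>)"
  by (simp add: smooth_continuous_on smooth_deriv test_function_smooth)

lemma weak_deriv_unique:
  assumes "a < b" "has_weak_deriv a b u g" "has_weak_deriv a b u h"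
  shows "AE x in leb_ivl a b. g x = h x"
proof -
  have g: "integrable (leb_ivl a b) g" and h: "integrable (leb_ivl a b) h"
    using assms by (auto simp: has_weak_deriv_def L2_integrable)
  have "AE x in leb_ivl a b. g x - h x = 0"
  proof (rule fundamental_lemma[OF assms(1)])
    fix \<phi> assume \<phi>: "\<phi> \<in> test_functions a b"
    have "(LINT x|leb_ivl a b. g x * \<phi> x) = (LINT x|leb_ivl a b. h x * \<phi> x)"
      using assms(2,3) \<phi> by (force simp: has_weak_deriv_def)
    then show "(LINT x|leb_ivl a b. (g x - h x) * \<phi> x) = 0"
      using integrable_mult_continuous[OF g test_function_continuous_on[OF \<phi>]]
        integrable_mult_continuous[OF h test_function_continuous_on[OF \<phi>]]
      by (simp add: left_diff_distrib)
  qed (use g h in simp)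
  then show ?thesis by simp
qed

text \<open>Subtracting from a test function \<open>\<eta>\<close> its integral times a fixed
  \<open>\<rho>\<close> of integral one leaves the derivative of a test function. Testing with it
  shows that \<open>g - C\<close> is orthogonal to \<open>\<eta>\<close>, with \<open>C\<close> the
  pairing of \<open>g\<close> and \<open>\<rho>\<close>.\<close>

lemma du_Bois_Reymond:
  assumes ab: "a < b" and g: "integrable (leb_ivl a b) g"
    and 0: "\<And>\<phi>. \<phi> \<in> test_functions a b \<Longrightarrow> (LINT x|leb_ivl a b. g x * deriv \<phi> x) = 0"
  obtains C where "AE x in leb_ivl a b. g x = C"
proof -
  obtain \<rho> where \<rho>: "\<rho> \<in> test_functions a b" "(LINT x|leb_ivl a b. \<rho> x) = 1"
    using test_function_integral_1[OF ab] by metis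
  define C where "C = (LINT x|leb_ivl a b. g x * \<rho> x)"
  have gI: "integrable (leb_ivl a b) (\<lambda>x. g x * \<eta> x)" "integrable (leb_ivl a b) \<eta>"
    if "\<eta> \<in> test_functions a b" for \<eta>
    using integrable_mult_continuous[OF g test_function_continuous_on[OF that]]
      smooth_integrable[OF test_function_smooth[OF that]] by auto
  have "AE x in leb_ivl a b. g x - C = 0"
  proof (rule fundamental_lemma[OF ab])
    show "integrable (leb_ivl a b) (\<lambda>x. g x - C)"
      using g by (simp add: finite_measure.integrable_const[OF finite_measure_leb_ivl])
    fix \<eta> assume \<eta>: "\<eta> \<in> test_functions a b"
    define c where "c = (LINT x|leb_ivl a b. \<eta> x)"
    have "(\<lambda>x. \<eta> x - c * \<rho> x) \<in> test_functions a b"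
      by (intro test_function_diff test_function_scale \<eta> \<rho> ab)
    moreover have "(LINT x|leb_ivl a b. \<eta> x - c * \<rho> x) = 0"
      using gI(2)[OF \<eta>] gI(2)[OF \<rho>(1)] \<rho>(2) by (simp add: c_def)
    ultimately obtain \<phi> where "\<phi> \<in> test_functions a b" "deriv \<phi> = (\<lambda>x. \<eta> x - c * \<rho> x)"
      using test_function_antiderivative[OF ab] by metis
    then have "0 = (LINT x|leb_ivl a b. g x * (\<eta> x - c * \<rho> x))" using 0[of \<phi>] by simp
    also have "\<dots> = (LINT x|leb_ivl a b. g x * \<eta> x - c * (g x * \<rho> x))"
      by (simp add: algebra_simps)
    also have "\<dots> = (LINT x|leb_ivl a b. g x * \<eta> x) - c * C"
      using gI(1)[OF \<eta>] gI(1)[OF \<rho>(1)] by (simp add: C_def)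
    also have "\<dots> = (LINT x|leb_ivl a b. (g x - C) * \<eta> x)"
      using gI[OF \<eta>] by (simp add: left_diff_distrib c_def)
    finally show "(LINT x|leb_ivl a b. (g x - C) * \<eta> x) = 0" by simp
  qed
  then show thesis by (intro that[of C]) simp
qed

lemma indicator_atMost_measurable: "(indicator {..x} :: real \<Rightarrow> real) \<in> borel_measurable (leb_ivl a b)"
  by (intro measurable_restrict_space1 borel_measurable_indicator) (auto intro: lborelD)

text \<open>Rewrites a running integral as an integral over the whole interval with a fixed bounded
  factor, so that dominated convergence applies to it.\<close>

lemma integral_leb_ivl_initial:
  fixes Q :: "real \<Rightarrow> real"
  assumes Q: "integrable (leb_ivl a b) Q" and x: "a \<le> x" "x \<le> b"
  shows "integral {a..x} Q = (LINT r|leb_ivl a b. indicator {..x} r * Q r)"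
proof -
  have "integrable (leb_ivl a b) (\<lambda>r. Q r * indicator {..x} r)"
    by (rule integrable_mult_bounded[OF Q indicator_atMost_measurable, where C = 1]) (auto simp: indicator_def)
  then have "(LINT r|leb_ivl a b. indicator {..x} r * Q r) = integral {a..b} (\<lambda>r. if r \<in> {..x} then Q r else 0)"
    by (subst integral_leb_ivl_eq) (auto simp: mult.commute indicator_def intro!: integral_cong)
  also have "\<dots> = integral ({a..b} \<inter> {..x}) Q"
    by (subst Int_commute) (rule integral_restrict_Int)
  also have "{a..b} \<inter> {..x} = {a..x}" using x by auto
  finally show ?thesis by simp
qed

text \<open>For merely bounded measurable \<open>Q\<close> the running integral need not be
  differentiable at every point. The product rule is therefore used for test functions approximating
  \<open>Q\<close>, whose running integrals converge pointwise and stay below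
  \<open>(C + 1) * (b - a)\<close>.\<close>

lemma integral_by_parts_test_function:
  assumes ab: "a < b" and Q: "Q \<in> borel_measurable (leb_ivl a b)" "AE x in leb_ivl a b. \<bar>Q x\<bar> \<le> C"
    and \<phi>: "\<phi> \<in> test_functions a b"
  shows "(LINT x|leb_ivl a b. Q x * \<phi> x) = - (LINT x|leb_ivl a b. integral {a..x} Q * deriv \<phi> x)"
proof -
  let ?M = "leb_ivl a b"
  obtain \<eta> where \<eta>: "\<And>n. \<eta> n \<in> test_functions a b" "\<And>n x. \<bar>\<eta> n x\<bar> \<le> C + 1"
    "AE x in ?M. (\<lambda>n. \<eta> n x) \<longlonglongrightarrow> Q x"
    using test_functions_dense_bounded[OF ab Q] by blast
  have \<eta>I: "integrable ?M (\<eta> n)" for n by (rule smooth_integrable[OF test_function_smooth[OF \<eta>(1)]])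
  have \<eta>M: "\<eta> n \<in> borel_measurable ?M" for n using \<eta>I by blast
  have QI: "integrable ?M Q" using bounded_integrable_leb_ivl[OF Q] .
  have cd: "continuous_on S \<phi>" "continuous_on S (deriv \<phi>)" for S
    using \<phi> test_function_continuous_on deriv_test_function_continuous by auto
  have Nc: "continuous_on {a..b} (\<lambda>x. integral {a..x} f)" if "integrable ?M f" for f :: "real \<Rightarrow> real"
    by (rule indefinite_integral_continuous_1[OF integral_leb_ivl_eq(1)[OF that]])
  have eq: "(LINT x|?M. \<phi> x * \<eta> n x) = - (LINT x|?M. deriv \<phi> x * integral {a..x} (\<eta> n))" for n
  proof -
    let ?N = "\<lambda>x. integral {a..x} (\<eta> n)"
    have "(LINT x|?M. \<phi> x * \<eta> n x + deriv \<phi> x * ?N x) = \<phi> b * ?N b - \<phi> a * ?N a"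
    proof (rule integral_leb_ivl_deriv)
      show "((\<lambda>x. \<phi> x * ?N x) has_real_derivative \<phi> x * \<eta> n x + deriv \<phi> x * ?N x) (at x within {a..b})"
        if "x \<in> {a..b}" for x
        using that by (auto intro!: derivative_eq_intros integral_has_real_derivative
              test_function_continuous_on[OF \<eta>(1)] has_field_derivative_at_within[OF smooth_has_deriv[OF test_function_smooth[OF \<phi>]]])
      show "continuous_on {a..b} (\<lambda>x. \<phi> x * \<eta> n x + deriv \<phi> x * ?N x)"
        by (intro continuous_intros cd Nc \<eta>I test_function_continuous_on[OF \<eta>(1)])
    qed (use ab in auto)
    moreover have "\<phi> a = 0" "\<phi> b = 0" using test_functionE[OF \<phi> ab] by (metis less_imp_le)+
    moreover have "integrable ?M (\<lambda>x. \<phi> x * \<eta> n x)" "integrable ?M (\<lambda>x. deriv \<phi> x * ?N x)"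
      by (intro continuous_on_integrable_leb_ivl continuous_intros cd Nc \<eta>I test_function_continuous_on[OF \<eta>(1)])+
    ultimately show ?thesis by simp
  qed
  have 1: "(\<lambda>n. LINT x|?M. \<phi> x * \<eta> n x) \<longlonglongrightarrow> (LINT x|?M. \<phi> x * Q x)"
    by (rule tendsto_integral_mult_bounded[where C = "C + 1"])
       (use \<eta> \<eta>M Q cd(1) in \<open>auto intro: continuous_on_integrable_leb_ivl\<close>)
  have 2: "(\<lambda>n. LINT x|?M. deriv \<phi> x * integral {a..x} (\<eta> n)) \<longlonglongrightarrow> (LINT x|?M. deriv \<phi> x * integral {a..x} Q)"
  proof (rule tendsto_integral_mult_bounded[where C = "(C + 1) * (b - a)"])
    show "(\<lambda>x. integral {a..x} (\<eta> n)) \<in> borel_measurable ?M" for n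
      by (intro continuous_on_Icc_measurable Nc \<eta>I)
    show "(\<lambda>x. integral {a..x} Q) \<in> borel_measurable ?M"
      by (intro continuous_on_Icc_measurable Nc QI)
    show "integrable ?M (deriv \<phi>)" by (intro continuous_on_integrable_leb_ivl cd)
    have C: "C + 1 \<ge> 0" using \<eta>(2)[of 0 0] by linarith
    show "AE x in ?M. \<bar>integral {a..x} (\<eta> n)\<bar> \<le> (C + 1) * (b - a)" for n
    proof (rule AE_leb_ivlI[of "{}"])
      fix x assume x: "a < x" "x < b"
      have "norm (integral {a..x} (\<eta> n)) \<le> (C + 1) * (x - a)"
        using x \<eta>(2) by (intro integral_bound test_function_continuous_on[OF \<eta>(1)]) auto
      also have "\<dots> \<le> (C + 1) * (b - a)" using x C by (intro mult_left_mono) auto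
      finally show "\<bar>integral {a..x} (\<eta> n)\<bar> \<le> (C + 1) * (b - a)" by simp
    qed simp
    show "AE x in ?M. (\<lambda>n. integral {a..x} (\<eta> n)) \<longlonglongrightarrow> integral {a..x} Q"
    proof (rule AE_leb_ivlI[of "{}"])
      fix x assume x: "a < x" "x < b"
      have "(\<lambda>n. LINT r|?M. indicator {..x} r * \<eta> n r) \<longlonglongrightarrow> (LINT r|?M. indicator {..x} r * Q r)"
      proof (rule tendsto_integral_mult_bounded[where C = "C + 1"])
        show "integrable ?M (indicator {..x} :: real \<Rightarrow> real)"
          by (rule bounded_integrable_leb_ivl[OF indicator_atMost_measurable, where C = 1]) (auto simp: indicator_def)
      qed (use \<eta> \<eta>M Q in auto)
      then show "(\<lambda>n. integral {a..x} (\<eta> n)) \<longlonglongrightarrow> integral {a..x} Q"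
        using x by (simp add: integral_leb_ivl_initial[OF QI] integral_leb_ivl_initial[OF \<eta>I])
    qed simp
  qed
  have "(LINT x|?M. \<phi> x * Q x) = - (LINT x|?M. deriv \<phi> x * integral {a..x} Q)"
    by (rule LIMSEQ_unique[OF 1]) (use tendsto_minus[OF 2] in \<open>simp add: eq\<close>)
  then show ?thesis by (simp add: mult.commute)
qed

lemma continuous_AE_eq:
  fixes f :: "real \<Rightarrow> real"
  assumes ab: "a < b" and f: "continuous_on {a..b} f" and ae: "AE x in leb_ivl a b. f x = C" and x: "x \<in> {a..b}"
  shows "f x = C"
proof -
  have c: "continuous_on {a..b} (\<lambda>x. \<bar>f x - C\<bar>)" using f by (intro continuous_intros)
  have "(LINT x|leb_ivl a b. \<bar>f x - C\<bar>) = (LINT x|leb_ivl a b. 0)"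
    using continuous_on_Icc_measurable[OF c] by (rule integral_cong_AE) (use ae in auto)
  then have "integral {a..b} (\<lambda>x. \<bar>f x - C\<bar>) = 0"
    using integral_leb_ivl_eq(2)[OF continuous_on_integrable_leb_ivl[OF c]] by simp
  then show ?thesis using integral_eq_0_iff[OF c ab] x by auto
qed

text \<open>Subtracting the primitive of \<open>G\<close> from \<open>u\<close> leaves a function
  with weak derivative zero. By du Bois-Reymond it is constant almost everywhere, and by continuity
  everywhere, so \<open>u\<close> is classically differentiable, one-sidedly at the ends.\<close>

lemma weak_deriv_continuous:
  assumes ab: "a < b" and u: "continuous_on {a..b} u" "has_weak_deriv a b u g"
    and G: "continuous_on {a..b} G" "AE x in leb_ivl a b. g x = G x" and x: "x \<in> {a..b}"
  shows "(u has_real_derivative G x) (at x within {a..b})"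
proof -
  let ?M = "leb_ivl a b" and ?N = "\<lambda>x. integral {a..x} G"
  have GI: "integrable ?M G" by (rule continuous_on_integrable_leb_ivl[OF G(1)])
  have Nc: "continuous_on {a..b} ?N"
    by (rule indefinite_integral_continuous_1[OF integral_leb_ivl_eq(1)[OF GI]])
  have I: "integrable ?M (\<lambda>x. u x - ?N x)"
    by (intro continuous_on_integrable_leb_ivl continuous_intros u Nc)
  obtain C where C: "AE x in ?M. u x - ?N x = C"
  proof (rule du_Bois_Reymond[OF ab I])
    fix \<phi> assume \<phi>: "\<phi> \<in> test_functions a b"
    have gM: "g \<in> borel_measurable ?M" using u(2) by (simp add: has_weak_deriv_def L2_def)
    obtain B where B: "AE x in ?M. \<bar>G x\<bar> \<le> B" using continuous_on_AE_bounded[OF G(1)] by metis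
    have "(LINT x|?M. u x * deriv \<phi> x) = - (LINT x|?M. g x * \<phi> x)"
      using u(2) \<phi> by (simp add: has_weak_deriv_def)
    also have "(LINT x|?M. g x * \<phi> x) = (LINT x|?M. G x * \<phi> x)"
      using gM continuous_on_Icc_measurable[OF G(1)] smooth_measurable[OF test_function_smooth[OF \<phi>], of a b]
      by (intro integral_cong_AE) (use G(2) in auto)
    also have "\<dots> = - (LINT x|?M. ?N x * deriv \<phi> x)"
      by (rule integral_by_parts_test_function[OF ab continuous_on_Icc_measurable[OF G(1)] B \<phi>])
    finally show "(LINT x|?M. (u x - ?N x) * deriv \<phi> x) = 0"
      using integrable_mult_continuous[OF continuous_on_integrable_leb_ivl[OF u(1)] deriv_test_function_continuous[OF \<phi>]]
        integrable_mult_continuous[OF continuous_on_integrable_leb_ivl[OF Nc] deriv_test_function_continuous[OF \<phi>]]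
      by (simp add: left_diff_distrib)
  qed
  have eq: "u y = ?N y + C" if "y \<in> {a..b}" for y
    using continuous_AE_eq[OF ab continuous_on_diff[OF u(1) Nc] C that] by simp
  have "((\<lambda>y. ?N y + C) has_real_derivative G x) (at x within {a..b})"
    using x by (auto intro!: derivative_eq_intros integral_has_real_derivative G)
  then show ?thesis
    by (rule has_field_derivative_transform_within[where d = 1]) (use x eq in auto)
qed

lemma C1_has_weak_deriv:
  assumes ab: "a < b" and u: "\<And>x. x \<in> {a..b} \<Longrightarrow> (u has_real_derivative g x) (at x within {a..b})"
    and g: "continuous_on {a..b} g"
  shows "has_weak_deriv a b u g"
proof -
  let ?M = "leb_ivl a b"
  have uc: "continuous_on {a..b} u" by (rule DERIV_continuous_on[OF u])
  have "(LINT x|?M. u x * deriv \<phi> x) = - (LINT x|?M. g x * \<phi> x)" if \<phi>: "\<phi> \<in> test_functions a b" for \<phi>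
  proof -
    note c = test_function_continuous_on[OF \<phi>] deriv_test_function_continuous[OF \<phi>]
    have "(LINT x|?M. u x * deriv \<phi> x + g x * \<phi> x) = u b * \<phi> b - u a * \<phi> a"
    proof (rule integral_leb_ivl_deriv)
      show "((\<lambda>x. u x * \<phi> x) has_real_derivative u x * deriv \<phi> x + g x * \<phi> x) (at x within {a..b})"
        if "x \<in> {a..b}" for x
        using that by (auto intro!: derivative_eq_intros u
            has_field_derivative_at_within[OF smooth_has_deriv[OF test_function_smooth[OF \<phi>]]])
    qed (use ab in \<open>auto intro!: continuous_intros uc g c\<close>)
    moreover have "\<phi> a = 0" "\<phi> b = 0" using test_functionE[OF \<phi> ab] by (metis less_imp_le)+
    moreover have "integrable ?M (\<lambda>x. u x * deriv \<phi> x)" "integrable ?M (\<lambda>x. g x * \<phi> x)"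
      by (intro continuous_on_integrable_leb_ivl continuous_intros uc g c)+
    ultimately show ?thesis by simp
  qed
  then show ?thesis using continuous_on_L2[OF uc] continuous_on_L2[OF g] by (simp add: has_weak_deriv_def)
qed

text \<open>The derivative is approximated rather than the function: bounded approximations of
  \<open>g\<close> by test functions are corrected to have integral zero, and their antiderivatives
  are the required test functions.\<close>

lemma C1_zero_H10:
  assumes ab: "a < b" and u: "\<And>x. x \<in> {a..b} \<Longrightarrow> (u has_real_derivative g x) (at x within {a..b})"
    and g: "continuous_on {a..b} g" and u0: "u a = 0" "u b = 0"
  shows "u \<in> H10 a b"
proof -
  let ?M = "leb_ivl a b"
  have uc: "continuous_on {a..b} u" by (rule DERIV_continuous_on[OF u])
  have gM: "g \<in> borel_measurable ?M" by (rule continuous_on_Icc_measurable[OF g])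
  obtain C where C: "AE x in ?M. \<bar>g x\<bar> \<le> C" "C \<ge> 0" using continuous_on_AE_bounded[OF g] by metis
  obtain \<eta> where \<eta>: "\<And>n. \<eta> n \<in> test_functions a b" "\<And>n x. \<bar>\<eta> n x\<bar> \<le> C + 1"
    "AE x in ?M. (\<lambda>n. \<eta> n x) \<longlonglongrightarrow> g x"
    using test_functions_dense_bounded[OF ab gM C(1)] by blast
  have \<eta>M: "\<eta> n \<in> borel_measurable ?M" for n by (rule smooth_measurable[OF test_function_smooth[OF \<eta>(1)]])
  have \<eta>I: "integrable ?M (\<eta> n)" for n by (rule smooth_integrable[OF test_function_smooth[OF \<eta>(1)]])
  obtain \<rho> where \<rho>: "\<rho> \<in> test_functions a b" "(LINT x|?M. \<rho> x) = 1"
    using test_function_integral_1[OF ab] by metis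
  obtain R where R: "\<And>x. x \<in> {a..b} \<Longrightarrow> \<bar>\<rho> x\<bar> \<le> R" "R \<ge> 0"
    using continuous_on_bounded_ivl[OF test_function_continuous_on[OF \<rho>(1)]] by metis
  have one: "integrable ?M (\<lambda>x. 1)" by (rule finite_measure.integrable_const[OF finite_measure_leb_ivl])
  define c where "c n = (LINT x|?M. \<eta> n x)" for n
  have "(\<lambda>n. LINT x|?M. 1 * \<eta> n x) \<longlonglongrightarrow> (LINT x|?M. 1 * g x)"
    by (rule tendsto_integral_mult_bounded[OF one \<eta>M _ gM \<eta>(3), where C = "C + 1"]) (simp add: \<eta>(2))
  moreover have "(LINT x|?M. g x) = 0"
    using integral_leb_ivl_deriv[OF _ u g] ab u0 by simp
  ultimately have c0: "c \<longlonglongrightarrow> 0" by (simp add: c_def[abs_def])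
  then obtain K where K: "\<And>n. \<bar>c n\<bar> \<le> K"
    using convergent_imp_Bseq[OF convergentI[OF c0]] by (auto simp: Bseq_def)
  have "K \<ge> 0" using K[of 0] by linarith
  define \<psi> where "\<psi> n x = \<eta> n x - c n * \<rho> x" for n x
  have \<psi>: "\<psi> n \<in> test_functions a b" for n
    unfolding \<psi>_def by (intro test_function_diff test_function_scale \<eta> \<rho> ab)
  have "(LINT x|?M. \<psi> n x) = 0" for n
    unfolding \<psi>_def using \<eta>I smooth_integrable[OF test_function_smooth[OF \<rho>(1)], of a b] \<rho>(2) by (simp add: c_def)
  then have "\<exists>\<phi>. \<phi> \<in> test_functions a b \<and> deriv \<phi> = \<psi> n" for n
    using test_function_antiderivative[OF ab \<psi>] by metis
  then obtain \<phi> where \<phi>: "\<And>n. \<phi> n \<in> test_functions a b" "\<And>n. deriv (\<phi> n) = \<psi> n" by metis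
  define B where "B = (C + 1) + K * R + C"
  have ebd: "AE x in ?M. \<bar>\<psi> n x - g x\<bar> \<le> B" for n
    using C(1) AE_leb_ivl_interior
  proof eventually_elim
    case (elim x)
    have "\<bar>c n * \<rho> x\<bar> \<le> K * R" unfolding abs_mult using K R elim \<open>K \<ge> 0\<close> by (intro mult_mono) auto
    then show ?case using elim \<eta>(2)[of n x] unfolding B_def \<psi>_def by linarith
  qed
  have elim0: "AE x in ?M. (\<lambda>n. \<bar>\<psi> n x - g x\<bar>) \<longlonglongrightarrow> 0"
    using \<eta>(3)
  proof eventually_elim
    case (elim x)
    have "(\<lambda>n. \<bar>\<eta> n x - c n * \<rho> x - g x\<bar>) \<longlonglongrightarrow> \<bar>g x - 0 * \<rho> x - g x\<bar>"
      by (intro tendsto_intros elim c0)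
    then show ?case by (simp add: \<psi>_def)
  qed
  have \<psi>M: "\<psi> n \<in> borel_measurable ?M" for n by (rule smooth_measurable[OF test_function_smooth[OF \<psi>]])
  have \<psi>c: "continuous_on {a..b} (\<psi> n)" for n by (rule test_function_continuous_on[OF \<psi>])
  define e where "e n = (LINT x|?M. \<bar>\<psi> n x - g x\<bar>)" for n
  have "(\<lambda>n. LINT x|?M. 1 * \<bar>\<psi> n x - g x\<bar>) \<longlonglongrightarrow> (LINT x|?M. 1 * 0)"
    by (rule tendsto_integral_mult_bounded[OF one, where C = B]) (use ebd elim0 \<psi>M gM in auto)
  then have e0: "e \<longlonglongrightarrow> 0" by (simp add: e_def[abs_def])
  then obtain E where E: "\<And>n. \<bar>e n\<bar> \<le> E"
    using convergent_imp_Bseq[OF convergentI[OF e0]] by (auto simp: Bseq_def)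
  \<comment> \<open>Both functions vanish at \<open>a\<close>, so their distance is bounded
    uniformly by the integral of the distance of the derivatives.\<close>
  have \<phi>u: "\<bar>\<phi> n x - u x\<bar> \<le> e n" if x: "x \<in> {a..b}" for n x
  proof -
    have dc: "continuous_on {a..b} (\<lambda>x. \<psi> n x - g x)" by (intro continuous_intros \<psi>c g)
    have ac: "continuous_on {a..b} (\<lambda>x. \<bar>\<psi> n x - g x\<bar>)" by (intro continuous_intros \<psi>c g)
    have xI: "(\<lambda>x. \<psi> n x - g x) integrable_on {a..x}" "(\<lambda>x. \<bar>\<psi> n x - g x\<bar>) integrable_on {a..x}"
      using x by (auto intro!: integrable_continuous_real continuous_on_subset[OF dc] continuous_on_subset[OF ac])
    have "((\<lambda>x. \<psi> n x - g x) has_integral (\<phi> n x - u x) - (\<phi> n a - u a)) {a..x}"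
    proof (rule fundamental_theorem_of_calculus)
      fix y assume y: "y \<in> {a..x}"
      have "(\<phi> n has_real_derivative \<psi> n y) (at y within {a..b})"
        using has_field_derivative_at_within[OF smooth_has_deriv[OF test_function_smooth[OF \<phi>(1)]]] \<phi>(2) by metis
      then have "((\<lambda>y. \<phi> n y - u y) has_real_derivative \<psi> n y - g y) (at y within {a..b})"
        using u[of y] y x by (auto intro: derivative_intros)
      then show "((\<lambda>y. \<phi> n y - u y) has_vector_derivative \<psi> n y - g y) (at y within {a..x})"
        using x by (auto simp: has_real_derivative_iff_has_vector_derivative intro: has_vector_derivative_within_subset)
    qed (use x in auto)
    moreover have "\<phi> n a = 0" using test_functionE[OF \<phi>(1) ab] by (metis less_imp_le)
    ultimately have "\<phi> n x - u x = integral {a..x} (\<lambda>x. \<psi> n x - g x)"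
      using u0 by (simp add: integral_unique)
    also have "\<bar>\<dots>\<bar> \<le> integral {a..x} (\<lambda>x. \<bar>\<psi> n x - g x\<bar>)"
      using integral_norm_bound_integral[OF xI] by auto
    also have "\<dots> \<le> integral {a..b} (\<lambda>x. \<bar>\<psi> n x - g x\<bar>)"
      using x xI by (intro integral_subset_le) (auto intro: integrable_continuous_real[OF ac])
    also have "\<dots> = e n"
      using integral_leb_ivl_eq(2)[OF continuous_on_integrable_leb_ivl[OF ac]] by (simp add: e_def)
    finally show ?thesis .
  qed
  have "(\<lambda>n. LINT x|?M. 1 * (\<psi> n x - g x)\<^sup>2) \<longlonglongrightarrow> (LINT x|?M. 1 * 0)"
  proof (rule tendsto_integral_mult_bounded[OF one, where C = "B\<^sup>2"])
    show "AE x in ?M. \<bar>(\<psi> n x - g x)\<^sup>2\<bar> \<le> B\<^sup>2" for n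
      using ebd[of n] by eventually_elim (simp add: abs_le_square_iff[symmetric])
    show "AE x in ?M. (\<lambda>n. (\<psi> n x - g x)\<^sup>2) \<longlonglongrightarrow> 0"
      using elim0 by eventually_elim (drule tendsto_power[where n = 2], simp)
  qed (use \<psi>M gM in auto)
  then have 1: "(\<lambda>n. LINT x|?M. (deriv (\<phi> n) x - g x)\<^sup>2) \<longlonglongrightarrow> 0" by (simp add: \<phi>(2))
  have "(\<lambda>n. LINT x|?M. 1 * (\<phi> n x - u x)\<^sup>2) \<longlonglongrightarrow> (LINT x|?M. 1 * 0)"
  proof (rule tendsto_integral_mult_bounded[OF one, where C = "E\<^sup>2"])
    have *: "\<bar>\<phi> n x - u x\<bar> \<le> \<bar>E\<bar>" if "x \<in> {a..b}" for n x using \<phi>u[OF that, of n] E[of n] by linarith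
    show "AE x in ?M. \<bar>(\<phi> n x - u x)\<^sup>2\<bar> \<le> E\<^sup>2" for n
      by (rule AE_leb_ivlI[of "{}"]) (use * in \<open>auto simp: abs_le_square_iff[symmetric]\<close>)
    show "AE x in ?M. (\<lambda>n. (\<phi> n x - u x)\<^sup>2) \<longlonglongrightarrow> 0"
    proof (rule AE_leb_ivlI[of "{}"])
      fix x assume "a < x" "x < b"
      then have "(\<lambda>n. \<phi> n x - u x) \<longlonglongrightarrow> 0"
        using \<phi>u[of x] by (intro Lim_null_comparison[OF _ e0]) auto
      then show "(\<lambda>n. (\<phi> n x - u x)\<^sup>2) \<longlonglongrightarrow> 0" by (drule_tac tendsto_power[where n = 2]) simp
    qed simp
    show "(\<lambda>x. (\<phi> n x - u x)\<^sup>2) \<in> borel_measurable ?M" for n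
      using smooth_measurable[OF test_function_smooth[OF \<phi>(1)], of n a b] continuous_on_Icc_measurable[OF uc] by simp
  qed simp
  then have 2: "(\<lambda>n. LINT x|?M. (\<phi> n x - u x)\<^sup>2) \<longlonglongrightarrow> 0" by simp
  have w: "has_weak_deriv a b u g" by (rule C1_has_weak_deriv[OF ab u g])
  have "(\<lambda>n. (LINT x|?M. (\<phi> n x - u x)\<^sup>2) + (LINT x|?M. (deriv (\<phi> n) x - g x)\<^sup>2)) \<longlonglongrightarrow> 0"
    using tendsto_add[OF 2 1] by simp
  then show ?thesis unfolding H10_def H1_def using w \<phi>(1) by blast
qed

text \<open>The inequality \<open>\<bar>y\<bar> \<le> t + y^2 / t\<close>, with \<open>t\<close>
  near the root of the integral of the square, does the work of Cauchy-Schwarz.\<close>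

lemma integral_mult_tendsto_0_of_L2:
  fixes f :: "'a \<Rightarrow> real" and h :: "nat \<Rightarrow> 'a \<Rightarrow> real"
  assumes M: "finite_measure M" and f: "f \<in> borel_measurable M" "AE x in M. \<bar>f x\<bar> \<le> C" "C \<ge> 0"
    and h: "\<And>k. h k \<in> borel_measurable M" "\<And>k. integrable M (\<lambda>x. (h k x)\<^sup>2)"
    and lim: "(\<lambda>k. LINT x|M. (h k x)\<^sup>2) \<longlonglongrightarrow> 0"
  shows "(\<lambda>k. LINT x|M. f x * h k x) \<longlonglongrightarrow> 0"
proof (rule Lim_null_comparison)
  define I where "I k = (LINT x|M. (h k x)\<^sup>2)" for k
  \<comment> \<open>The added \<open>1 / (k + 1)\<close> keeps \<open>t k\<close> positive when
    \<open>I k = 0\<close>.\<close>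
  define t where "t k = sqrt (I k) + inverse (real (Suc k))" for k
  have I0: "I k \<ge> 0" for k by (simp add: I_def)
  have t0: "t k > 0" for k using I0[of k] by (simp add: t_def add_nonneg_pos)
  have hI: "integrable M (h k)" for k by (rule integrable_of_square_integrable[OF M h(1) h(2)])
  have "norm (LINT x|M. f x * h k x) \<le> C * (t k * measure M (space M) + sqrt (I k))" for k
  proof -
    have pt: "\<bar>y\<bar> \<le> t k + y\<^sup>2 / t k" for y
    proof -
      have "2 * (\<bar>y\<bar> * t k) \<le> y\<^sup>2 + (t k)\<^sup>2"
        using sum_squares_bound[of "\<bar>y\<bar>" "t k"] by (simp add: mult.assoc)
      moreover have "0 \<le> \<bar>y\<bar> * t k" using t0[of k] by simp
      ultimately have "\<bar>y\<bar> * t k \<le> (t k)\<^sup>2 + y\<^sup>2" by linarith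
      then have "\<bar>y\<bar> \<le> ((t k)\<^sup>2 + y\<^sup>2) / t k" using t0[of k] by (simp add: pos_le_divide_eq)
      also have "\<dots> = t k + y\<^sup>2 / t k" using t0[of k] by (simp add: add_divide_distrib power2_eq_square)
      finally show ?thesis .
    qed
    have fh: "integrable M (\<lambda>x. h k x * f x)" by (rule integrable_mult_bounded[OF hI f(1,2)])
    then have "norm (LINT x|M. f x * h k x) \<le> (LINT x|M. \<bar>f x * h k x\<bar>)"
      using integral_norm_bound[of M "\<lambda>x. f x * h k x"] by simp
    also have "\<dots> \<le> (LINT x|M. C * (t k + (h k x)\<^sup>2 / t k))"
    proof (rule integral_mono_AE)
      show "AE x in M. \<bar>f x * h k x\<bar> \<le> C * (t k + (h k x)\<^sup>2 / t k)"
        using f(2)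
      proof eventually_elim
        case (elim x)
        then show ?case unfolding abs_mult using pt[of "h k x"] f(3) by (intro mult_mono) auto
      qed
      show "integrable M (\<lambda>x. \<bar>f x * h k x\<bar>)" using fh by (simp add: mult.commute)
      show "integrable M (\<lambda>x. C * (t k + (h k x)\<^sup>2 / t k))"
        by (intro integrable_mult_right Bochner_Integration.integrable_add integrable_divide h(2) finite_measure.integrable_const[OF M])
    qed
    also have "\<dots> = C * (t k * measure M (space M) + I k / t k)"
      using Bochner_Integration.integral_add[OF finite_measure.integrable_const[OF M] integrable_divide[OF h(2)], of "t k" k "t k"]
      by (simp add: I_def)
    also have "I k / t k \<le> sqrt (I k)"
    proof -
      have "I k = sqrt (I k) * sqrt (I k)" using I0 by simp
      also have "\<dots> \<le> sqrt (I k) * t k" using I0[of k] by (intro mult_left_mono) (auto simp: t_def)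
      finally show ?thesis using t0[of k] by (simp add: field_simps)
    qed
    finally show ?thesis using f(3) by (simp add: mult_left_mono)
  qed
  then show "eventually (\<lambda>k. norm (LINT x|M. f x * h k x) \<le> C * (t k * measure M (space M) + sqrt (I k))) sequentially"
    by simp
  have "I \<longlonglongrightarrow> 0" using lim by (simp add: I_def[abs_def])
  then have "(\<lambda>k. C * ((sqrt (I k) + inverse (real (Suc k))) * measure M (space M) + sqrt (I k)))
    \<longlonglongrightarrow> C * ((sqrt 0 + 0) * measure M (space M) + sqrt 0)"
    by (intro tendsto_intros LIMSEQ_inverse_real_of_nat)
  then show "(\<lambda>k. C * (t k * measure M (space M) + sqrt (I k))) \<longlonglongrightarrow> 0"
    by (simp add: t_def)
qed

text \<open>Both coefficients are bounded, so each pairing is continuous in the \<open>H1\<close>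
  norm and the identity passes from test functions to their closure. The weak derivative supplied by
  membership in \<open>H10\<close> agrees almost everywhere with the given
  \<open>\<psi>\<close>.\<close>

lemma weak_form_H10:
  assumes ab: "a < b" and E: "continuous_on {a..b} E"
    and Q: "Q \<in> borel_measurable (leb_ivl a b)" "AE x in leb_ivl a b. \<bar>Q x\<bar> \<le> C"
    and test: "\<And>\<phi>. \<phi> \<in> test_functions a b \<Longrightarrow>
      (LINT x|leb_ivl a b. E x * deriv \<phi> x) + (LINT x|leb_ivl a b. Q x * \<phi> x) = 0"
    and \<phi>: "\<phi> \<in> H10 a b" "has_weak_deriv a b \<phi> \<psi>"
  shows "(LINT x|leb_ivl a b. E x * \<psi> x) + (LINT x|leb_ivl a b. Q x * \<phi> x) = 0"
proof -
  let ?M = "leb_ivl a b"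
  obtain g \<theta> where g: "has_weak_deriv a b \<phi> g" and \<theta>: "\<And>k. \<theta> k \<in> test_functions a b"
    and lim: "(\<lambda>k. (LINT x|?M. (\<theta> k x - \<phi> x)\<^sup>2) + (LINT x|?M. (deriv (\<theta> k) x - g x)\<^sup>2)) \<longlonglongrightarrow> 0"
    using \<phi>(1) unfolding H10_def by blast
  have g\<psi>: "AE x in ?M. g x = \<psi> x" by (rule weak_deriv_unique[OF ab g \<phi>(2)])
  have \<phi>2: "\<phi> \<in> L2 a b" "g \<in> L2 a b" "\<psi> \<in> L2 a b" using g \<phi>(2) by (auto simp: has_weak_deriv_def)
  have lims: "(\<lambda>k. LINT x|?M. (\<theta> k x - \<phi> x)\<^sup>2) \<longlonglongrightarrow> 0" "(\<lambda>k. LINT x|?M. (deriv (\<theta> k) x - g x)\<^sup>2) \<longlonglongrightarrow> 0"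
    by (rule Lim_null_comparison[OF _ lim], simp)+
  have sq: "integrable ?M (\<lambda>x. (p x - q x)\<^sup>2)" if "smooth p" "q \<in> L2 a b" for p q
  proof -
    have "integrable ?M (\<lambda>x. (p x)\<^sup>2)"
      by (intro smooth_integrable smooth_power that)
    moreover have "integrable ?M (\<lambda>x. (q x)\<^sup>2)" using that by (simp add: L2_def)
    moreover have "integrable ?M (\<lambda>x. q x * p x)"
      by (intro integrable_mult_continuous L2_integrable smooth_continuous_on that)
    then have "integrable ?M (\<lambda>x. 2 * (q x * p x))" by simp
    ultimately have "integrable ?M (\<lambda>x. (p x)\<^sup>2 + (q x)\<^sup>2 - 2 * (q x * p x))" by simp
    then show ?thesis by (simp add: power2_diff algebra_simps)
  qed
  have sm: "smooth (\<theta> k)" "smooth (deriv (\<theta> k))" for k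
    by (rule test_function_smooth[OF \<theta>], rule smooth_deriv[OF test_function_smooth[OF \<theta>]])
  obtain D where D: "AE x in ?M. \<bar>E x\<bar> \<le> D" "D \<ge> 0" using continuous_on_AE_bounded[OF E] by metis
  have EM: "E \<in> borel_measurable ?M" by (rule continuous_on_Icc_measurable[OF E])
  have Q': "AE x in ?M. \<bar>Q x\<bar> \<le> \<bar>C\<bar>" using Q(2) by eventually_elim simp
  have 1: "(\<lambda>k. LINT x|?M. E x * (deriv (\<theta> k) x - g x)) \<longlonglongrightarrow> 0"
    by (rule integral_mult_tendsto_0_of_L2[OF finite_measure_leb_ivl EM D _ _ lims(2)])
       (intro borel_measurable_diff smooth_measurable L2_measurable sq sm \<phi>2)+
  have 2: "(\<lambda>k. LINT x|?M. Q x * (\<theta> k x - \<phi> x)) \<longlonglongrightarrow> 0"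
    by (rule integral_mult_tendsto_0_of_L2[OF finite_measure_leb_ivl Q(1) Q' abs_ge_zero _ _ lims(1)])
       (intro borel_measurable_diff smooth_measurable L2_measurable sq sm \<phi>2)+
  have I: "integrable ?M (\<lambda>x. E x * f x)" "integrable ?M (\<lambda>x. Q x * f x)" if "integrable ?M f" for f
    using integrable_mult_bounded[OF that EM D(1)] integrable_mult_bounded[OF that Q] by (simp_all add: mult.commute)
  have eq: "(LINT x|?M. E x * (deriv (\<theta> k) x - g x)) + (LINT x|?M. Q x * (\<theta> k x - \<phi> x)) =
     - ((LINT x|?M. E x * g x) + (LINT x|?M. Q x * \<phi> x))" for k
    using test[OF \<theta>, of k] I(1)[OF smooth_integrable[OF sm(2)], of k] I(2)[OF smooth_integrable[OF sm(1)], of k]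
      I(1)[OF L2_integrable[OF \<phi>2(2)]] I(2)[OF L2_integrable[OF \<phi>2(1)]]
    by (simp add: right_diff_distrib)
  have "(LINT x|?M. E x * g x) + (LINT x|?M. Q x * \<phi> x) = 0"
    using tendsto_add[OF 1 2] unfolding eq by (simp add: LIMSEQ_const_iff)
  moreover have "(LINT x|?M. E x * g x) = (LINT x|?M. E x * \<psi> x)"
    using EM L2_measurable[OF \<phi>2(2)] L2_measurable[OF \<phi>2(3)] by (intro integral_cong_AE) (use g\<psi> in auto)
  ultimately show ?thesis by simp
qed

section \<open>Two-point problems without Lipschitz conditions\<close>

lemma continuous_on_section:
  assumes "continuous_on (U \<times> V) (\<lambda>(z, s). F z s)" "z \<in> U" "S \<subseteq> V"
  shows "continuous_on S (F z)"
proof -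
  have "continuous_on S (\<lambda>s. (\<lambda>(z, s). F z s) (z, s))"
    by (rule continuous_on_compose2[OF assms(1)])
       (use assms(2,3) in \<open>auto intro: continuous_on_Pair[OF continuous_on_const continuous_on_id]\<close>)
  then show ?thesis by simp
qed

text \<open>Rescaling \<open>{a..r}\<close> to the unit interval turns the moving limit into a
  parameter of the integrand.\<close>

lemma continuous_on_integral_upper_limit:
  fixes F :: "'c::metric_space \<Rightarrow> real \<Rightarrow> 'a::euclidean_space"
  assumes F: "continuous_on (U \<times> {a..b}) (\<lambda>(z, s). F z s)"
  shows "continuous_on (U \<times> {a..b}) (\<lambda>(z, r). integral {a..r} (F z))"
proof -
  have "continuous_on ((U \<times> {a..b}) \<times> cbox 0 1) (\<lambda>(p, t). F (fst p) (a + t * (snd p - a)))"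
  proof -
    have "a + t * (r - a) \<in> {a..b}" if "r \<in> {a..b}" "t \<in> {0..1}" for r t
    proof -
      have "0 \<le> t * (r - a)" "t * (r - a) \<le> 1 * (r - a)" using that mult_right_mono[of t 1 "r - a"] by auto
      then show ?thesis using that by auto
    qed
    then have "continuous_on ((U \<times> {a..b}) \<times> cbox 0 1) (\<lambda>q. (\<lambda>(z, s). F z s) (fst (fst q), a + snd q * (snd (fst q) - a)))"
      by (intro continuous_on_compose2[OF F] continuous_intros) auto
    then show ?thesis by (simp add: case_prod_unfold)
  qed
  then have "continuous_on (U \<times> {a..b}) (\<lambda>p. integral (cbox 0 1) (\<lambda>t. F (fst p) (a + t * (snd p - a))))"
    by (rule integral_continuous_on_param)
  then have "continuous_on (U \<times> {a..b}) (\<lambda>p. (snd p - a) *\<^sub>R integral (cbox 0 1) (\<lambda>t. F (fst p) (a + t * (snd p - a))))"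
    by (intro continuous_intros)
  moreover have "(snd p - a) *\<^sub>R integral (cbox 0 1) (\<lambda>t. F (fst p) (a + t * (snd p - a))) = (\<lambda>(z, r). integral {a..r} (F z)) p"
    if p: "p \<in> U \<times> {a..b}" for p
  proof -
    obtain z r where zr: "p = (z, r)" "z \<in> U" "a \<le> r" "r \<le> b" using p by auto
    show ?thesis
    proof (cases "r = a")
      case False
      have "continuous_on {a..r} (F z)"
        by (rule continuous_on_section[OF F]) (use zr in auto)
      then have "(F z has_integral integral {a..r} (F z)) (cbox a r)"
        by (simp add: integrable_continuous_real integrable_integral)
      from has_integral_affinity'[OF this, of "r - a" a]
      have "((\<lambda>t. F z (a + t * (r - a))) has_integral (integral {a..r} (F z) /\<^sub>R (r - a))) (cbox 0 1)"
        using False zr by (simp add: mult.commute add.commute)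
      then show ?thesis using False zr by (simp add: integral_unique)
    qed (simp add: zr)
  qed
  ultimately show ?thesis by (simp cong: continuous_on_cong)
qed

text \<open>Iterating the integral operator with retarded argument \<open>s - d\<close> becomes stationary after finitely
  many steps, so no Lipschitz condition is needed.\<close>

primrec tonelli :: "(real \<Rightarrow> 'a \<Rightarrow> 'a::euclidean_space) \<Rightarrow> real \<Rightarrow> real \<Rightarrow> nat \<Rightarrow> 'a \<Rightarrow> real \<Rightarrow> 'a" where
  "tonelli h a d 0 z r = z"
| "tonelli h a d (Suc j) z r = z + integral {a..r} (\<lambda>s. h s (tonelli h a d j z (max a (s - d))))"

lemma tonelli_continuous:
  fixes h :: "real \<Rightarrow> 'a \<Rightarrow> 'a::euclidean_space"
  assumes h: "continuous_on ({a..b} \<times> UNIV) (\<lambda>(s, z). h s z)" and d: "0 \<le> d"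
  shows "continuous_on (UNIV \<times> {a..b}) (\<lambda>(z, r). tonelli h a d j z r)"
proof (induction j)
  case 0
  show ?case by (auto simp: case_prod_unfold intro: continuous_intros)
next
  case (Suc j)
  have "continuous_on (UNIV \<times> {a..b}) (\<lambda>p. (\<lambda>(z, r). tonelli h a d j z r) (fst p, max a (snd p - d)))"
    by (rule continuous_on_compose2[OF Suc]) (use d in \<open>auto intro!: continuous_intros\<close>)
  then have 1: "continuous_on (UNIV \<times> {a..b}) (\<lambda>p. tonelli h a d j (fst p) (max a (snd p - d)))"
    by simp
  have "continuous_on (UNIV \<times> {a..b}) (\<lambda>p. (\<lambda>(s, z). h s z) (snd p, tonelli h a d j (fst p) (max a (snd p - d))))"
    by (rule continuous_on_compose2[OF h]) (auto intro!: continuous_intros 1)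
  then have "continuous_on (UNIV \<times> {a..b}) (\<lambda>(z, s). h s (tonelli h a d j z (max a (s - d))))"
    by (simp add: case_prod_unfold)
  from continuous_on_integral_upper_limit[OF this]
  have "continuous_on (UNIV \<times> {a..b}) (\<lambda>p. fst p + (\<lambda>(z, r). integral {a..r} (\<lambda>s. h s (tonelli h a d j z (max a (s - d))))) p)"
    by (intro continuous_intros)
  then show ?case by (simp add: case_prod_unfold)
qed

text \<open>Step \<open>j\<close> has settled the values up to \<open>a + j d\<close>. The next step
  evaluates its predecessor only at points \<open>s - d\<close>, so it gains one more interval of
  length \<open>d\<close>.\<close>

lemma tonelli_stable:
  assumes d: "0 \<le> d" and r: "a \<le> r" "r \<le> a + real j * d"
  shows "tonelli h a d (Suc j) z r = tonelli h a d j z r"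
  using r
proof (induction j arbitrary: r)
  case 0
  then show ?case by simp
next
  case (Suc j)
  have "tonelli h a d (Suc j) z (max a (s - d)) = tonelli h a d j z (max a (s - d))" if "s \<in> {a..r}" for s
    using that Suc.prems d by (intro Suc.IH) (auto simp: algebra_simps)
  then have "integral {a..r} (\<lambda>s. h s (tonelli h a d (Suc j) z (max a (s - d)))) =
    integral {a..r} (\<lambda>s. h s (tonelli h a d j z (max a (s - d))))"
    by (intro integral_cong) simp
  then show ?case by (subst (1 2) tonelli.simps) simp
qed

text \<open>Once \<open>j d\<close> exceeds the length of the interval, the \<open>j\<close>-th
  iterate is a fixed point. Being built from finitely many integrations, it is jointly continuous in
  the initial value and the time, which is what shooting requires.\<close>

lemma retarded_equation_solution:
  fixes h :: "real \<Rightarrow> 'a \<Rightarrow> 'a::euclidean_space"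
  assumes h: "continuous_on ({a..b} \<times> UNIV) (\<lambda>(s, z). h s z)" and d: "0 < d"
  shows "\<exists>X. continuous_on (UNIV \<times> {a..b}) (\<lambda>(z, r). X z r) \<and>
    (\<forall>z. \<forall>r\<in>{a..b}. X z r = z + integral {a..r} (\<lambda>s. h s (X z (max a (s - d)))))"
proof -
  obtain j :: nat where j: "(b - a) / d \<le> real j" using real_arch_simple by blast
  then have "b - a \<le> real j * d" using d by (simp add: field_simps)
  then have "tonelli h a d j z r = z + integral {a..r} (\<lambda>s. h s (tonelli h a d j z (max a (s - d))))"
    if "r \<in> {a..b}" for z r
    using tonelli_stable[of d a r j h z] that d by simp
  then show ?thesis using tonelli_continuous[OF h] d by (intro exI[of _ "tonelli h a d j"]) auto
qed

text \<open>The sign of \<open>f\<close> is prescribed for \<open>\<bar>y\<bar> \<ge> Y\<close>, so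
  a trajectory whose second component stays there has a monotone first component. Shooting starts
  within \<open>Y + G * (b - a)\<close> and drifts by at most \<open>G * (b - a)\<close>; this is
  the range on which \<open>f\<close> has to be bounded.\<close>

locale shooting =
  fixes a b Y G F :: real and f :: "real \<Rightarrow> real \<Rightarrow> real \<Rightarrow> real" and g :: "real \<Rightarrow> real"
  assumes ab: "a < b"
    and f_cont: "continuous_on ({a..b} \<times> UNIV) (\<lambda>(s, z). f s (fst z) (snd z))"
    and g_cont: "continuous_on UNIV g"
    and g_bound: "\<And>w. \<bar>g w\<bar> \<le> G"
    and f_nonneg: "\<And>s w y. s \<in> {a..b} \<Longrightarrow> y \<ge> Y \<Longrightarrow> f s w y \<ge> 0"
    and f_nonpos: "\<And>s w y. s \<in> {a..b} \<Longrightarrow> y \<le> - Y \<Longrightarrow> f s w y \<le> 0"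
    and f_bound: "\<And>s w y. s \<in> {a..b} \<Longrightarrow> \<bar>y\<bar> \<le> Y + 2 * G * (b - a) \<Longrightarrow> \<bar>f s w y\<bar> \<le> F"
    and Y: "Y \<ge> 0"
begin

definition rhs :: "real \<Rightarrow> real \<times> real \<Rightarrow> real \<times> real" where
  "rhs s z = (f s (fst z) (snd z), g (fst z))"

lemma rhs_cont: "continuous_on ({a..b} \<times> UNIV) (\<lambda>(s, z). rhs s z)"
  using f_cont unfolding rhs_def case_prod_unfold
  by (intro continuous_intros continuous_on_compose2[OF g_cont]) auto

lemma rhs_comp_cont:
  assumes "continuous_on {a..b} y" shows "continuous_on {a..b} (\<lambda>s. rhs s (y s))"
proof -
  have "continuous_on {a..b} (\<lambda>s. (\<lambda>(s, z). rhs s z) (s, y s))"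
    by (rule continuous_on_compose2[OF rhs_cont continuous_on_Pair[OF continuous_on_id assms]]) auto
  then show ?thesis by simp
qed

lemma G_nonneg: "G \<ge> 0" using g_bound[of 0] by linarith

lemma retarded_bvp:
  assumes d: "0 < d"
  obtains X where "continuous_on {a..b} X"
    "\<And>r. r \<in> {a..b} \<Longrightarrow> X r = X a + integral {a..r} (\<lambda>s. rhs s (X (max a (s - d))))"
    "fst (X a) = 0" "fst (X b) = 0" "\<And>r. r \<in> {a..b} \<Longrightarrow> \<bar>snd (X r)\<bar> \<le> Y + 2 * G * (b - a)"
proof -
  obtain X where Xc: "continuous_on (UNIV \<times> {a..b}) (\<lambda>(z, r). X z r)"
    and X: "\<And>z r. r \<in> {a..b} \<Longrightarrow> X z r = z + integral {a..r} (\<lambda>s. rhs s (X z (max a (s - d))))"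
    using retarded_equation_solution[OF rhs_cont d] by blast
  have Xzc: "continuous_on {a..b} (X z)" for z
    by (rule continuous_on_section[OF Xc]) auto
  have Xd: "continuous_on {a..b} (\<lambda>s. X z (max a (s - d)))" for z
    by (rule continuous_on_compose2[OF Xzc]) (use d in \<open>auto intro!: continuous_intros\<close>)
  have rc: "continuous_on {a..b} (\<lambda>s. rhs s (X z (max a (s - d))))" for z
    by (rule rhs_comp_cont[OF Xd])
  have rI: "(\<lambda>s. rhs s (X z (max a (s - d)))) integrable_on {a..r}" if "r \<in> {a..b}" for z r
    by (intro integrable_continuous_real continuous_on_subset[OF rc]) (use that in auto)
  have fstX: "fst (X z r) = fst z + integral {a..r} (\<lambda>s. f s (fst (X z (max a (s - d)))) (snd (X z (max a (s - d)))))"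
    and fI: "(\<lambda>s. f s (fst (X z (max a (s - d)))) (snd (X z (max a (s - d))))) integrable_on {a..r}"
    and sndX: "snd (X z r) = snd z + integral {a..r} (\<lambda>s. g (fst (X z (max a (s - d)))))"
    and gI: "(\<lambda>s. g (fst (X z (max a (s - d))))) integrable_on {a..r}"
    if "r \<in> {a..b}" for z r
    using X[OF that, of z] integral_linear[OF rI[OF that] bounded_linear_fst, of z] integral_linear[OF rI[OF that] bounded_linear_snd, of z]
      integrable_linear[OF rI[OF that] bounded_linear_fst, of z] integrable_linear[OF rI[OF that] bounded_linear_snd, of z]
    by (auto simp: o_def rhs_def)
  have snd_bound: "\<bar>snd (X z r) - snd z\<bar> \<le> G * (b - a)" if r: "r \<in> {a..b}" for z r
  proof -
    have "\<bar>integral {a..r} (\<lambda>s. g (fst (X z (max a (s - d)))))\<bar> \<le> integral {a..r} (\<lambda>s. G)"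
      using integral_norm_bound_integral[OF gI[OF r, of z] integrable_continuous_real[OF continuous_on_const], of G] g_bound by auto
    also have "\<dots> \<le> (b - a) * G" using r G_nonneg by (auto intro!: mult_right_mono)
    finally show ?thesis using sndX[OF r] by (simp add: mult.commute)
  qed
  \<comment> \<open>Starting at \<open>E\<close> or \<open>- E\<close>, the second component cannot
    leave the region where \<open>f\<close> has a fixed sign; so the endpoint values of the first
    component have opposite signs and the intermediate value theorem applies.\<close>
  define E where "E = Y + G * (b - a)"
  have E0: "0 \<le> E" using Y G_nonneg ab by (simp add: E_def)
  have mx: "max a (s - d) \<in> {a..b}" if "s \<in> {a..b}" for s using that d by auto
  have "\<exists>e. - E \<le> e \<and> e \<le> E \<and> fst (X (0, e) b) = 0"
  proof (rule IVT')
    show "fst (X (0, - E) b) \<le> 0"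
    proof -
      have "integral {a..b} (\<lambda>s. f s (fst (X (0, - E) (max a (s - d)))) (snd (X (0, - E) (max a (s - d))))) \<le> integral {a..b} (\<lambda>s. 0)"
      proof (rule integral_le[OF fI])
        show "f s (fst (X (0, - E) (max a (s - d)))) (snd (X (0, - E) (max a (s - d)))) \<le> 0" if "s \<in> {a..b}" for s
          using snd_bound[OF mx[OF that], of "(0, - E)"] by (intro f_nonpos that) (auto simp: E_def)
      qed (use ab in auto)
      then show ?thesis using fstX[of b "(0, - E)"] ab by simp
    qed
    show "0 \<le> fst (X (0, E) b)"
    proof -
      have "0 \<le> integral {a..b} (\<lambda>s. f s (fst (X (0, E) (max a (s - d)))) (snd (X (0, E) (max a (s - d)))))"
      proof (rule integral_nonneg[OF fI])
        show "0 \<le> f s (fst (X (0, E) (max a (s - d)))) (snd (X (0, E) (max a (s - d))))" if "s \<in> {a..b}" for s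
          using snd_bound[OF mx[OF that], of "(0, E)"] by (intro f_nonneg that) (auto simp: E_def)
      qed (use ab in auto)
      then show ?thesis using fstX[of b "(0, E)"] ab by simp
    qed
    show "continuous_on {- E..E} (\<lambda>e. fst (X (0, e) b))"
    proof (intro continuous_on_fst)
      have "continuous_on {- E..E} (\<lambda>e. (\<lambda>(z, r). X z r) ((0, e), b))"
        by (rule continuous_on_compose2[OF Xc])
           (use ab in \<open>auto intro!: continuous_on_Pair continuous_on_const continuous_on_id\<close>)
      then show "continuous_on {- E..E} (\<lambda>e. X (0, e) b)" by simp
    qed
  qed (use E0 in auto)
  then obtain e where e: "- E \<le> e" "e \<le> E" "fst (X (0, e) b) = 0" by blast
  have Xa: "X (0, e) a = (0, e)" using X[of a "(0, e)"] ab by simp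
  show thesis
  proof
    show "continuous_on {a..b} (X (0, e))" by (rule Xzc)
    show "X (0, e) r = X (0, e) a + integral {a..r} (\<lambda>s. rhs s (X (0, e) (max a (s - d))))" if "r \<in> {a..b}" for r
      unfolding Xa by (rule X[OF that])
    show "\<bar>snd (X (0, e) r)\<bar> \<le> Y + 2 * G * (b - a)" if "r \<in> {a..b}" for r
      using snd_bound[OF that, of "(0, e)"] e(1,2) unfolding E_def by (simp add: algebra_simps)
  qed (use e Xa in auto)
qed

lemma bvp_solution:
  obtains w y where "\<And>x. x \<in> {a..b} \<Longrightarrow> (w has_real_derivative f x (w x) (y x)) (at x within {a..b})"
    "\<And>x. x \<in> {a..b} \<Longrightarrow> (y has_real_derivative g (w x)) (at x within {a..b})"
    "w a = 0" "w b = 0"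
proof -
  define d where "d k = inverse (real (Suc k))" for k
  have d0: "d k > 0" for k by (simp add: d_def)
  have dlim: "d \<longlonglongrightarrow> 0" unfolding d_def[abs_def] by (rule LIMSEQ_inverse_real_of_nat)
  have "\<forall>k. \<exists>X. continuous_on {a..b} X \<and>
    (\<forall>r\<in>{a..b}. X r = X a + integral {a..r} (\<lambda>s. rhs s (X (max a (s - d k))))) \<and>
    fst (X a) = 0 \<and> fst (X b) = 0 \<and> (\<forall>r\<in>{a..b}. \<bar>snd (X r)\<bar> \<le> Y + 2 * G * (b - a))"
    by (rule allI, rule retarded_bvp[OF d0]) blast
  from choice[OF this] obtain X where Xc: "\<And>k. continuous_on {a..b} (X k)"
    and X: "\<And>k r. r \<in> {a..b} \<Longrightarrow> X k r = X k a + integral {a..r} (\<lambda>s. rhs s (X k (max a (s - d k))))"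
    and X0: "\<And>k. fst (X k a) = 0" "\<And>k. fst (X k b) = 0"
    and Xsnd: "\<And>k r. r \<in> {a..b} \<Longrightarrow> \<bar>snd (X k r)\<bar> \<le> Y + 2 * G * (b - a)"
    by blast
  define K where "K = F + G"
  have mx: "max a (s - d k) \<in> {a..b}" if "s \<in> {a..b}" for s k using that d0[of k] by auto
  have rb: "norm (rhs s (X k (max a (s - d k)))) \<le> K" if s: "s \<in> {a..b}" for s k
    unfolding rhs_def K_def
    by (rule order_trans[OF norm_Pair_le], rule add_mono)
       (use f_bound[OF s Xsnd[OF mx[OF s]]] g_bound in auto)
  have "0 \<le> norm (rhs a (X 0 (max a (a - d 0))))" by simp
  also have "\<dots> \<le> K" using ab by (intro rb) auto
  finally have K0: "K \<ge> 0" .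
  have rc: "continuous_on {a..b} (\<lambda>s. rhs s (X k (max a (s - d k))))" for k
  proof -
    have "continuous_on {a..b} (\<lambda>s. X k (max a (s - d k)))"
      by (rule continuous_on_compose2[OF Xc]) (use mx in \<open>auto intro!: continuous_intros\<close>)
    then show ?thesis by (rule rhs_comp_cont)
  qed
  have rI: "(\<lambda>s. rhs s (X k (max a (s - d k)))) integrable_on {p..q}" if "a \<le> p" "q \<le> b" for k p q
    by (intro integrable_continuous_real continuous_on_subset[OF rc]) (use that in auto)
  have lip1: "norm (X k q - X k p) \<le> K * (q - p)" if pq: "a \<le> p" "p \<le> q" "q \<le> b" for k p q
  proof -
    have "X k q - X k p = integral {a..q} (\<lambda>s. rhs s (X k (max a (s - d k)))) - integral {a..p} (\<lambda>s. rhs s (X k (max a (s - d k))))"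
      using X[of q k] X[of p k] pq by simp
    also have "\<dots> = integral {p..q} (\<lambda>s. rhs s (X k (max a (s - d k))))"
      using Henstock_Kurzweil_Integration.integral_combine[OF pq(1,2) rI, of k] pq by (simp add: algebra_simps)
    also have "norm \<dots> \<le> K * (q - p)"
      by (rule integral_bound) (use pq rb continuous_on_subset[OF rc] in auto)
    finally show ?thesis .
  qed
  have lip: "norm (X k q - X k p) \<le> K * \<bar>q - p\<bar>" if "p \<in> {a..b}" "q \<in> {a..b}" for k p q
    using lip1[of p q k] lip1[of q p k] that by (cases "p \<le> q") (auto simp: norm_minus_commute)
  have bound: "norm (X k r) \<le> K * (b - a) + (Y + 2 * G * (b - a))" if r: "r \<in> {a..b}" for k r
  proof -
    have "norm (X k r) \<le> norm (X k r - X k a) + norm (X k a)" by (metis diff_add_cancel norm_triangle_ineq)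
    also have "norm (X k r - X k a) \<le> K * \<bar>r - a\<bar>" by (rule lip) (use r ab in auto)
    also have "\<dots> \<le> K * (b - a)" using r K0 by (intro mult_left_mono) auto
    also have "norm (X k a) \<le> norm (fst (X k a)) + norm (snd (X k a))"
      by (metis norm_Pair_le prod.collapse)
    also have "\<dots> \<le> Y + 2 * G * (b - a)" using X0(1)[of k] Xsnd[of a k] ab by simp
    finally show ?thesis by simp
  qed
  \<comment> \<open>The constants \<open>K\<close> and the bound are independent of the delay, so
    the family is equi-Lipschitz and uniformly bounded.\<close>
  obtain x k where xc: "continuous_on {a..b} x" and k: "strict_mono (k :: nat \<Rightarrow> nat)"
    and ux: "\<And>e. 0 < e \<Longrightarrow> \<exists>N. \<forall>n r. n \<ge> N \<and> r \<in> {a..b} \<longrightarrow> norm (X (k n) r - x r) < e"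
  proof (rule Arzela_Ascoli[of "{a..b}" X "K * (b - a) + (Y + 2 * G * (b - a))"])
    fix r e :: real assume r: "r \<in> {a..b}" and e: "0 < e"
    have "norm (X n r - X n y) < e" if "y \<in> {a..b}" "norm (r - y) < e / (K + 1)" for n y
    proof -
      have "norm (X n r - X n y) \<le> K * \<bar>r - y\<bar>" by (rule lip) (use r that in auto)
      also have "\<dots> \<le> (K + 1) * \<bar>r - y\<bar>" by (intro mult_right_mono) auto
      also have "\<dots> < e" using that(2) K0 by (simp add: field_simps)
      finally show ?thesis .
    qed
    then show "\<exists>d>0. \<forall>n y. y \<in> {a..b} \<and> norm (r - y) < d \<longrightarrow> norm (X n r - X n y) < e"
      using e K0 by (intro exI[of _ "e / (K + 1)"]) auto
  qed (use bound in auto)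
  have lim: "(\<lambda>n. X (k n) r) \<longlonglongrightarrow> x r" if "r \<in> {a..b}" for r
    unfolding LIMSEQ_iff using ux that by blast
  have dk: "(\<lambda>n. d (k n)) \<longlonglongrightarrow> 0" using LIMSEQ_subseq_LIMSEQ[OF dlim k] by (simp add: o_def)
  \<comment> \<open>The retardation changes the value by at most \<open>K\<close> times the delay,
    so the retarded arguments have the same limit.\<close>
  have limd: "(\<lambda>n. X (k n) (max a (s - d (k n)))) \<longlonglongrightarrow> x s" if s: "s \<in> {a..b}" for s
  proof -
    have "(\<lambda>n. X (k n) (max a (s - d (k n))) - X (k n) s) \<longlonglongrightarrow> 0"
    proof (rule Lim_null_comparison)
      have "norm (X (k n) (max a (s - d (k n))) - X (k n) s) \<le> K * d (k n)" for n
      proof -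
        have "norm (X (k n) (max a (s - d (k n))) - X (k n) s) \<le> K * \<bar>max a (s - d (k n)) - s\<bar>"
          by (rule lip[OF s mx[OF s]])
        also have "\<dots> \<le> K * d (k n)" using K0 d0[of "k n"] s by (intro mult_left_mono) auto
        finally show ?thesis .
      qed
      then show "eventually (\<lambda>n. norm (X (k n) (max a (s - d (k n))) - X (k n) s) \<le> K * d (k n)) sequentially" by simp
      show "(\<lambda>n. K * d (k n)) \<longlonglongrightarrow> 0" using tendsto_mult_left[OF dk, of K] by simp
    qed
    from tendsto_add[OF this lim[OF s]] show ?thesis by simp
  qed
  have xeq: "x r = x a + integral {a..r} (\<lambda>s. rhs s (x s))" if r: "r \<in> {a..b}" for r
  proof -
    have "(\<lambda>n. integral {a..r} (\<lambda>s. rhs s (X (k n) (max a (s - d (k n)))))) \<longlonglongrightarrow> integral {a..r} (\<lambda>s. rhs s (x s))"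
    proof (rule dominated_convergence(2))
      show "(\<lambda>s. rhs s (X (k n) (max a (s - d (k n))))) integrable_on {a..r}" for n
        using r by (intro rI) auto
      show "(\<lambda>s. K) integrable_on {a..r}" by (intro integrable_continuous_real continuous_intros)
      show "norm (rhs s (X (k n) (max a (s - d (k n))))) \<le> K" if "s \<in> {a..r}" for n s
        using r that by (intro rb) auto
      show "(\<lambda>n. rhs s (X (k n) (max a (s - d (k n))))) \<longlonglongrightarrow> rhs s (x s)" if "s \<in> {a..r}" for s
      proof -
        have "continuous_on UNIV (rhs s)"
          by (rule continuous_on_section[OF rhs_cont]) (use that r in auto)
        then show ?thesis
          by (rule continuous_on_tendsto_compose) (use limd that r in auto)
      qed
    qed
    then have "(\<lambda>n. X (k n) a + integral {a..r} (\<lambda>s. rhs s (X (k n) (max a (s - d (k n)))))) \<longlonglongrightarrow> x a + integral {a..r} (\<lambda>s. rhs s (x s))"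
      using ab by (intro tendsto_add lim) auto
    then have "(\<lambda>n. X (k n) r) \<longlonglongrightarrow> x a + integral {a..r} (\<lambda>s. rhs s (x s))"
      using X[OF r] by simp
    then show ?thesis using LIMSEQ_unique[OF lim[OF r]] by simp
  qed
  have rx: "continuous_on {a..b} (\<lambda>s. rhs s (x s))"
    by (rule rhs_comp_cont[OF xc])
  have deriv: "(x has_vector_derivative rhs r (x r)) (at r within {a..b})" if r: "r \<in> {a..b}" for r
  proof -
    have "((\<lambda>r. x a + integral {a..r} (\<lambda>s. rhs s (x s))) has_vector_derivative 0 + rhs r (x r)) (at r within {a..b})"
      by (intro has_vector_derivative_add has_vector_derivative_const integral_has_vector_derivative rx r)
    then have "((\<lambda>r. x a + integral {a..r} (\<lambda>s. rhs s (x s))) has_vector_derivative rhs r (x r)) (at r within {a..b})"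
      by simp
    then show ?thesis
      by (rule has_vector_derivative_transform[rotated 2]) (fact r, fact xeq)
  qed
  have x0: "fst (x a) = 0" "fst (x b) = 0"
    using LIMSEQ_unique[OF tendsto_fst[OF lim[of a]]] LIMSEQ_unique[OF tendsto_fst[OF lim[of b]]] ab X0 by simp_all
  show thesis
  proof
    show "((\<lambda>r. fst (x r)) has_real_derivative f r (fst (x r)) (snd (x r))) (at r within {a..b})" if "r \<in> {a..b}" for r
      using bounded_linear.has_vector_derivative[OF bounded_linear_fst deriv[OF that]]
      by (simp add: rhs_def has_real_derivative_iff_has_vector_derivative)
    show "((\<lambda>r. snd (x r)) has_real_derivative g (fst (x r))) (at r within {a..b})" if "r \<in> {a..b}" for r
      using bounded_linear.has_vector_derivative[OF bounded_linear_snd deriv[OF that]]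
      by (simp add: rhs_def has_real_derivative_iff_has_vector_derivative)
  qed (use x0 in auto)
qed

end

section \<open>Comparison, sub- and supersolutions\<close>

text \<open>\<open>P\<close> stands for the difference of the transformed unknowns, \<open>D\<close>
  for the difference of fluxes. Monotonicity of \<open>D\<close> is asked only where
  \<open>P\<close> is positive, since only there is the order of the source terms known. Strict
  decrease is asked only at zeros of \<open>P\<close>, where the remaining terms of the two
  equations cancel.\<close>

lemma comparison_principle:
  fixes P P' D :: "real \<Rightarrow> real"
  assumes P: "\<And>x. x \<in> {a..b} \<Longrightarrow> (P has_real_derivative P' x) (at x within {a..b})"
    and bd: "P a \<le> 0" "P b \<le> 0"
    and D: "\<And>x y. a \<le> x \<Longrightarrow> x \<le> y \<Longrightarrow> y \<le> b \<Longrightarrow> (\<And>s. s \<in> {x<..<y} \<Longrightarrow> P s > 0) \<Longrightarrow> D x \<le> D y"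
    and pos: "\<And>x. x \<in> {a..b} \<Longrightarrow> P x > 0 \<Longrightarrow> D x \<ge> 0 \<Longrightarrow> P' x \<ge> 0"
    and neg: "\<And>x. x \<in> {a..b} \<Longrightarrow> P x = 0 \<Longrightarrow> D x < 0 \<Longrightarrow> P' x < 0"
    and x: "x \<in> {a..b}"
  shows "P x \<le> 0"
proof (rule ccontr)
  assume "\<not> P x \<le> 0"
  then have Px: "P x > 0" by simp
  have Pc: "continuous_on {a..b} P" by (rule DERIV_continuous_on[OF P])
  have cl: "closed {t \<in> {c..d}. P t \<le> 0}" if "{c..d} \<subseteq> {a..b}" for c d
    using continuous_closed_preimage[OF continuous_on_subset[OF Pc that], of "{..0}"]
    by (simp add: vimage_def Int_def)
  have "compact {t \<in> {a..x}. P t \<le> 0}"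
    using cl[of a x] x by (intro compact_eq_bounded_closed[THEN iffD2] conjI)
      (auto intro: bounded_subset[OF bounded_closed_interval])
  moreover have "a \<in> {t \<in> {a..x}. P t \<le> 0}" using bd x by auto
  ultimately obtain \<alpha> where \<alpha>: "\<alpha> \<in> {a..x}" "P \<alpha> \<le> 0" "\<And>t. t \<in> {a..x} \<Longrightarrow> P t \<le> 0 \<Longrightarrow> t \<le> \<alpha>"
    using compact_attains_sup[of "{t \<in> {a..x}. P t \<le> 0}"] by blast
  have "compact {t \<in> {x..b}. P t \<le> 0}"
    using cl[of x b] x by (intro compact_eq_bounded_closed[THEN iffD2] conjI)
      (auto intro: bounded_subset[OF bounded_closed_interval])
  moreover have "b \<in> {t \<in> {x..b}. P t \<le> 0}" using bd x by auto
  ultimately obtain \<beta> where \<beta>: "\<beta> \<in> {x..b}" "P \<beta> \<le> 0" "\<And>t. t \<in> {x..b} \<Longrightarrow> P t \<le> 0 \<Longrightarrow> \<beta> \<le> t"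
    using compact_attains_inf[of "{t \<in> {x..b}. P t \<le> 0}"] by blast
  have "\<alpha> \<noteq> x" "\<beta> \<noteq> x" using \<alpha>(2) \<beta>(2) Px by auto
  then have ord: "a \<le> \<alpha>" "\<alpha> < x" "x < \<beta>" "\<beta> \<le> b" using \<alpha>(1) \<beta>(1) by auto
  have Ppos: "P t > 0" if "t \<in> {\<alpha><..<\<beta>}" for t
    using \<alpha>(3)[of t] \<beta>(3)[of t] that ord by (cases "t \<le> x") force+
  have "\<exists>t. \<alpha> \<le> t \<and> t \<le> x \<and> P t = 0"
    using \<alpha>(2) Px ord x by (intro IVT' continuous_on_subset[OF Pc]) auto
  then obtain t where "\<alpha> \<le> t" "t \<le> x" "P t = 0" by blast
  moreover from this have "t \<le> \<alpha>" using \<alpha>(3)[of t] ord by auto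
  ultimately have P\<alpha>: "P \<alpha> = 0" by simp
  \<comment> \<open>A nonnegative \<open>D y\<close> would persist up to \<open>\<beta>\<close>, and
    by the mean value theorem \<open>P \<beta>\<close> would be at least
    \<open>P y > 0\<close>.\<close>
  have Dneg: "D y < 0" if y: "y \<in> {\<alpha><..<\<beta>}" for y
  proof (rule ccontr)
    assume "\<not> D y < 0"
    have "\<exists>z\<in>{y<..<\<beta>}. P \<beta> - P y = P' z * (\<beta> - y)"
    proof -
      have yb: "y < \<beta>" using y by auto
      have "continuous_on {y..\<beta>} P" by (rule continuous_on_subset[OF Pc]) (use y ord in auto)
      moreover have "(P has_derivative (\<lambda>h. P' z * h)) (at z)" if "y < z" "z < \<beta>" for z
      proof -
        have "z \<in> interior {a..b}" "z \<in> {a..b}" using that y ord by auto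
        then show ?thesis using P[of z] at_within_interior[of z "{a..b}"]
          by (simp add: has_field_derivative_def)
      qed
      ultimately obtain z where "y < z" "z < \<beta>" "P \<beta> - P y = P' z * (\<beta> - y)"
        using mvt[OF yb, of P "\<lambda>z h. P' z * h"] by blast
      then show ?thesis by auto
    qed
    then obtain z where z: "z \<in> {y<..<\<beta>}" "P \<beta> - P y = P' z * (\<beta> - y)" by blast
    have "D y \<le> D z" by (rule D) (use z y ord Ppos in auto)
    then have "P' z \<ge> 0" using \<open>\<not> D y < 0\<close> z y ord by (intro pos Ppos) auto
    then have "P \<beta> \<ge> P y" using z y by (smt (verit) greaterThanLessThan_iff mult_nonneg_nonneg)
    then show False using Ppos[OF y] \<beta>(2) by simp
  qed
  have "D \<alpha> \<le> D x" by (rule D) (use ord Ppos in auto)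
  also have "D x < 0" using ord by (intro Dneg) auto
  finally have "P' \<alpha> < 0" using P\<alpha> ord by (intro neg) auto
  moreover have "(P has_real_derivative P' \<alpha>) (at \<alpha> within {a..b})" using ord by (intro P) auto
  ultimately obtain d where d: "d > 0" "\<And>h. h > 0 \<Longrightarrow> \<alpha> + h \<in> {a..b} \<Longrightarrow> h < d \<Longrightarrow> P \<alpha> > P (\<alpha> + h)"
    using has_real_derivative_neg_dec_right by metis
  \<comment> \<open>A point close enough to \<open>\<alpha>\<close> for the strict decrease and
    still before \<open>x\<close>, where \<open>P\<close> is positive.\<close>
  define h where "h = min (d / 2) ((x - \<alpha>) / 2)"
  have "P (\<alpha> + h) < 0" using d(2)[of h] P\<alpha> d(1) ord by (auto simp: h_def min_def field_simps)
  moreover have "P (\<alpha> + h) > 0" using d(1) ord by (intro Ppos) (auto simp: h_def min_def field_simps)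
  ultimately show False by simp
qed

lemma integral_nonneg_AE_subinterval:
  fixes f :: "real \<Rightarrow> real"
  assumes f: "integrable (leb_ivl a b) f" and cd: "a \<le> c" "c \<le> d" "d \<le> b"
    and nn: "AE x in leb_ivl a b. x \<in> {c<..<d} \<longrightarrow> 0 \<le> f x"
  shows "0 \<le> integral {c..d} f"
proof -
  have ind: "(indicator {c<..<d} :: real \<Rightarrow> real) \<in> borel_measurable (leb_ivl a b)"
    by (intro measurable_restrict_space1 borel_measurable_indicator) (auto intro: lborelD)
  have I: "integrable (leb_ivl a b) (\<lambda>x. f x * indicator {c<..<d} x)"
    by (rule integrable_mult_bounded[OF f ind, where C = 1]) (auto simp: indicator_def)
  have "0 \<le> (LINT x|leb_ivl a b. f x * indicator {c<..<d} x)"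
    by (rule integral_nonneg_AE) (use nn in \<open>eventually_elim, auto simp: indicator_def\<close>)
  also have "\<dots> = integral {a..b} (\<lambda>x. if x \<in> {c<..<d} then f x else 0)"
    unfolding integral_leb_ivl_eq(2)[OF I] by (rule integral_cong) (auto simp: indicator_def)
  also have "\<dots> = integral ({c<..<d} \<inter> {a..b}) f"
    by (rule integral_restrict_Int)
  also have "{c<..<d} \<inter> {a..b} = {c<..<d}" using cd by auto
  also have "integral {c<..<d} f = integral {c..d} f" by (simp add: integral_open_interval_real)
  finally show ?thesis .
qed

text \<open>The variable \<open>m\<close> as a function of \<open>w = (m - J)\<^sup>2\<close>; truncating \<open>w\<close> to \<open>[0, W]\<close> makes all
  coefficients of the system bounded.\<close>

definition momentum :: "real \<Rightarrow> real \<Rightarrow> real \<Rightarrow> real" where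
  "momentum J W w = J + sqrt (max 0 (min W w))"

definition flux_coeff :: "real \<Rightarrow> real \<Rightarrow> real \<Rightarrow> real" where
  "flux_coeff J W w = (momentum J W w + J) / (2 * momentum J W w ^ 3)"

lemma momentum_mono: "v \<le> w \<Longrightarrow> momentum J W v \<le> momentum J W w"
  unfolding momentum_def by (intro add_left_mono real_sqrt_le_mono) (auto simp: max_def min_def)

lemma momentum_ge: "J \<le> momentum J W w" by (simp add: momentum_def)

lemma momentum_le: "0 \<le> W \<Longrightarrow> momentum J W w \<le> J + sqrt W"
  unfolding momentum_def by (intro add_left_mono real_sqrt_le_mono) auto

lemma momentum_eq: "0 \<le> w \<Longrightarrow> w \<le> W \<Longrightarrow> momentum J W w = J + sqrt w"
  by (simp add: momentum_def)

lemma continuous_momentum: "continuous_on S (momentum J W)"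
  unfolding momentum_def by (intro continuous_intros)

lemma flux_coeff_pos: "J > 0 \<Longrightarrow> flux_coeff J W w > 0"
  using momentum_ge[of J W w] by (simp add: flux_coeff_def)

lemma continuous_flux_coeff: "J > 0 \<Longrightarrow> continuous_on S (flux_coeff J W)"
  unfolding flux_coeff_def using momentum_ge[of J W]
  by (intro continuous_intros continuous_momentum) (smt (verit) mult_eq_0_iff power_eq_0_iff)

text \<open>Here \<open>p = r\<^bsup>n-1\<^esup>\<close> and \<open>q = B - r\<^bsup>n-3\<^esup>(n-1)(n-2)\<close>.\<close>

locale flow =
  fixes a b \<tau> J :: real and p q :: "real \<Rightarrow> real" and C :: real
  assumes ab: "a < b" and \<tau>: "\<tau> > 0" and J: "J > 0"
    and p_cont: "continuous_on {a..b} p" and p_pos: "\<And>x. x \<in> {a..b} \<Longrightarrow> p x > 0"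
    and q_meas: "q \<in> borel_measurable (leb_ivl a b)" and q_bound: "AE x in leb_ivl a b. \<bar>q x\<bar> \<le> C"
begin

text \<open>The relation \<open>E = p * (flux_coeff * w' + J / (\<tau> * m))\<close>, with
  \<open>E\<close> the bracket under the outer derivative of the equation, solved for
  \<open>w'\<close>.\<close>

definition slope :: "real \<Rightarrow> (real \<Rightarrow> real) \<Rightarrow> (real \<Rightarrow> real) \<Rightarrow> real \<Rightarrow> real" where
  "slope W w E x = (E x / p x - J / (\<tau> * momentum J W (w x))) / flux_coeff J W (w x)"

text \<open>Only the first equation of the system: the barriers satisfy it exactly, but the equation
  for \<open>E\<close> only as an inequality.\<close>

definition solves :: "real \<Rightarrow> (real \<Rightarrow> real) \<Rightarrow> (real \<Rightarrow> real) \<Rightarrow> bool" where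
  "solves W w E \<longleftrightarrow> (\<forall>x\<in>{a..b}. (w has_real_derivative slope W w E x) (at x within {a..b}))"

text \<open>Composing with a primitive \<open>\<Phi>\<close> of \<open>flux_coeff\<close> removes
  the denominator of \<open>slope\<close>. The difference then has derivative \<open>P'\<close>, a
  sum of one term with the sign of \<open>E1 - E2\<close> and one with the sign of the difference of
  momenta.\<close>

lemma solves_compare:
  assumes s: "solves W w1 E1" "solves W w2 E2" and bd: "w1 a \<le> w2 a" "w1 b \<le> w2 b"
    and D: "\<And>x y. a \<le> x \<Longrightarrow> x \<le> y \<Longrightarrow> y \<le> b \<Longrightarrow> (\<And>s. s \<in> {x<..<y} \<Longrightarrow> w2 s < w1 s) \<Longrightarrow>
      E1 x - E2 x \<le> E1 y - E2 y"
    and x: "x \<in> {a..b}"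
  shows "w1 x \<le> w2 x"
proof -
  have "\<exists>\<Phi>. \<forall>x :: real. (-\<infinity>::ereal) < x \<longrightarrow> x < (\<infinity>::ereal) \<longrightarrow> (\<Phi> has_vector_derivative flux_coeff J W x) (at x)"
    using continuous_flux_coeff[OF J, of UNIV W]
    by (intro einterval_antiderivative) (auto simp: continuous_on_eq_continuous_at)
  then obtain \<Phi> where \<Phi>: "\<And>x. (\<Phi> has_real_derivative flux_coeff J W x) (at x)"
    by (auto simp: has_real_derivative_iff_has_vector_derivative)
  have \<Phi>less: "\<Phi> u < \<Phi> v" if "u < v" for u v
    using that by (rule DERIV_pos_imp_increasing) (use \<Phi> flux_coeff_pos[OF J] in blast)
  have \<Phi>iff: "\<Phi> u \<le> \<Phi> v \<longleftrightarrow> u \<le> v" for u v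
    using \<Phi>less[of u v] \<Phi>less[of v u] by (cases u v rule: linorder_cases) auto
  have fc: "flux_coeff J W u \<noteq> 0" for u using flux_coeff_pos[OF J, of W u] by simp
  define P' where "P' x = (E1 x - E2 x) / p x + (J / \<tau>) * (1 / momentum J W (w2 x) - 1 / momentum J W (w1 x))" for x
  have "\<Phi> (w1 x) - \<Phi> (w2 x) \<le> 0"
  proof (rule comparison_principle[where P = "\<lambda>x. \<Phi> (w1 x) - \<Phi> (w2 x)" and x = x and P' = P' and D = "\<lambda>x. E1 x - E2 x"])
    fix x assume x: "x \<in> {a..b}"
    have "((\<lambda>x. \<Phi> (w1 x)) has_real_derivative flux_coeff J W (w1 x) * slope W w1 E1 x) (at x within {a..b})"
      "((\<lambda>x. \<Phi> (w2 x)) has_real_derivative flux_coeff J W (w2 x) * slope W w2 E2 x) (at x within {a..b})"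
      using s x by (auto simp: solves_def intro!: DERIV_chain2[OF \<Phi>])
    then have "((\<lambda>x. \<Phi> (w1 x) - \<Phi> (w2 x)) has_real_derivative
        flux_coeff J W (w1 x) * slope W w1 E1 x - flux_coeff J W (w2 x) * slope W w2 E2 x) (at x within {a..b})"
      by (rule DERIV_diff)
    moreover have "flux_coeff J W (w1 x) * slope W w1 E1 x - flux_coeff J W (w2 x) * slope W w2 E2 x = P' x"
      using fc by (simp add: slope_def P'_def algebra_simps diff_divide_distrib)
    ultimately show "((\<lambda>x. \<Phi> (w1 x) - \<Phi> (w2 x)) has_real_derivative P' x) (at x within {a..b})" by simp
  next
    show "\<Phi> (w1 a) - \<Phi> (w2 a) \<le> 0" "\<Phi> (w1 b) - \<Phi> (w2 b) \<le> 0" using bd by (simp_all add: \<Phi>iff)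
  next
    fix x y assume "a \<le> x" "x \<le> y" "y \<le> b" "\<And>s. s \<in> {x<..<y} \<Longrightarrow> 0 < \<Phi> (w1 s) - \<Phi> (w2 s)"
    then show "E1 x - E2 x \<le> E1 y - E2 y"
      by (intro D) (auto simp: not_le[symmetric] \<Phi>iff)
  next
    fix x assume x: "x \<in> {a..b}" and "0 < \<Phi> (w1 x) - \<Phi> (w2 x)" "0 \<le> E1 x - E2 x"
    then have "w2 x < w1 x" by (simp add: not_le[symmetric] \<Phi>iff)
    then have "momentum J W (w2 x) \<le> momentum J W (w1 x)" by (intro momentum_mono) simp
    moreover have "0 < momentum J W (w2 x)" using momentum_ge[of J W "w2 x"] J by linarith
    ultimately have "1 / momentum J W (w1 x) \<le> 1 / momentum J W (w2 x)" by (intro divide_left_mono) auto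
    then show "0 \<le> P' x" using \<open>0 \<le> E1 x - E2 x\<close> p_pos[OF x] \<tau> J unfolding P'_def
      by (intro add_nonneg_nonneg mult_nonneg_nonneg divide_nonneg_pos) auto
  next
    fix x assume x: "x \<in> {a..b}" and "\<Phi> (w1 x) - \<Phi> (w2 x) = 0" and neg: "E1 x - E2 x < 0"
    then have "w1 x = w2 x" using \<Phi>iff[of "w1 x" "w2 x"] \<Phi>iff[of "w2 x" "w1 x"] by simp
    then show "P' x < 0" using neg p_pos[OF x] by (simp add: P'_def divide_neg_pos)
  qed (rule x)
  then show ?thesis by (simp add: \<Phi>iff)
qed

lemma q_integrable: "integrable (leb_ivl a b) q"
  by (rule bounded_integrable_leb_ivl[OF q_meas q_bound])

lemma source_integrable:
  assumes "continuous_on {a..b} w"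
  shows "integrable (leb_ivl a b) (\<lambda>x. momentum J W (w x) - q x)"
  by (intro Bochner_Integration.integrable_diff q_integrable continuous_on_integrable_leb_ivl
      continuous_on_compose2[OF continuous_momentum assms]) auto

lemma integral_increment:
  fixes f :: "real \<Rightarrow> real"
  assumes "integrable (leb_ivl a b) f" "a \<le> x" "x \<le> y" "y \<le> b"
  shows "integral {a..y} f - integral {a..x} f = integral {x..y} f"
proof -
  have "f integrable_on {a..y}"
    using integral_leb_ivl_eq(1)[OF assms(1)] by (rule integrable_on_subinterval) (use assms in auto)
  then show ?thesis
    using Henstock_Kurzweil_Integration.integral_combine[OF assms(2,3), of f] by simp
qed

text \<open>Where \<open>w1\<close> is larger, so is its source term, hence \<open>E1 - E2\<close>
  is nondecreasing there. The constants \<open>c1\<close> and \<open>c2\<close> are unrelated: the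
  boundary values of \<open>w\<close> alone decide.\<close>

lemma solves_unique:
  assumes w: "solves W w1 E1" "solves W w2 E2"
    and E: "\<And>x. x \<in> {a..b} \<Longrightarrow> E1 x = c1 + integral {a..x} (\<lambda>x. momentum J W (w1 x) - q x)"
      "\<And>x. x \<in> {a..b} \<Longrightarrow> E2 x = c2 + integral {a..x} (\<lambda>x. momentum J W (w2 x) - q x)"
    and bd: "w1 a \<le> w2 a" "w1 b \<le> w2 b" and x: "x \<in> {a..b}"
  shows "w1 x \<le> w2 x"
proof (rule solves_compare[OF w bd _ x])
  fix x y assume xy: "a \<le> x" "x \<le> y" "y \<le> b" and less: "\<And>s. s \<in> {x<..<y} \<Longrightarrow> w2 s < w1 s"
  have c: "continuous_on {a..b} w1" "continuous_on {a..b} w2"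
    using w by (auto simp: solves_def intro: DERIV_continuous_on)
  note I = source_integrable[OF c(1), of W] source_integrable[OF c(2), of W]
  have i: "(\<lambda>x. momentum J W (w1 x) - q x) integrable_on {x..y}" "(\<lambda>x. momentum J W (w2 x) - q x) integrable_on {x..y}"
    by (rule integrable_on_subinterval[OF integral_leb_ivl_eq(1)[OF I(1)]], use xy in auto)
       (rule integrable_on_subinterval[OF integral_leb_ivl_eq(1)[OF I(2)]], use xy in auto)
  have "0 \<le> integral {x..y} (\<lambda>x. (momentum J W (w1 x) - q x) - (momentum J W (w2 x) - q x))"
    by (rule integral_nonneg_AE_subinterval[OF Bochner_Integration.integrable_diff[OF I] xy], rule AE_I2)
       (simp add: momentum_mono less less_imp_le)
  also have "\<dots> = integral {x..y} (\<lambda>x. momentum J W (w1 x) - q x) - integral {x..y} (\<lambda>x. momentum J W (w2 x) - q x)"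
    by (rule Henstock_Kurzweil_Integration.integral_diff[OF i])
  also have "\<dots> = (E1 y - E1 x) - (E2 y - E2 x)"
    using integral_increment[OF I(1) xy] integral_increment[OF I(2) xy] E(1)[of x] E(1)[of y] E(2)[of x] E(2)[of y] xy
    by simp
  finally show "E1 x - E2 x \<le> E1 y - E2 y" by simp
qed

lemma solution_exists:
  assumes W: "W \<ge> 0"
  obtains w E c where "solves W w E" "w a = 0" "w b = 0"
    "\<And>x. x \<in> {a..b} \<Longrightarrow> E x = c + integral {a..x} (\<lambda>x. momentum J W (w x) - q x)"
proof -
  let ?m = "momentum J W" and ?k = "flux_coeff J W"
  \<comment> \<open>The unknown \<open>y = E + \<beta>\<close> has the continuous derivative
    \<open>momentum J W (w x)\<close>, whereas the derivative of \<open>E\<close> contains the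
    possibly discontinuous \<open>q\<close>.\<close>
  define \<beta> where "\<beta> x = integral {a..x} q" for x
  have \<beta>c: "continuous_on {a..b} \<beta>" unfolding \<beta>_def
    by (rule indefinite_integral_continuous_1[OF integral_leb_ivl_eq(1)[OF q_integrable]])
  obtain B where B: "\<And>x. x \<in> {a..b} \<Longrightarrow> \<bar>\<beta> x\<bar> \<le> B" "B \<ge> 0" using continuous_on_bounded_ivl[OF \<beta>c] by metis
  obtain R where R: "\<And>x. x \<in> {a..b} \<Longrightarrow> \<bar>p x\<bar> \<le> R" "R \<ge> 0" using continuous_on_bounded_ivl[OF p_cont] by metis
  have "continuous_on {a..b} (\<lambda>x. 1 / p x)" using p_pos p_cont by (intro continuous_intros) force+
  then obtain S where S: "\<And>x. x \<in> {a..b} \<Longrightarrow> \<bar>1 / p x\<bar> \<le> S" "S \<ge> 0" using continuous_on_bounded_ivl by metis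
  define M where "M = J + sqrt W"
  have m: "J \<le> ?m w" "?m w \<le> M" "0 < ?m w" for w
    using momentum_ge[of J W w] momentum_le[OF W, of J w] J by (auto simp: M_def)
  have M0: "M > 0" using m(2,3)[of 0] by linarith
  have k: "?k w > 0" for w by (rule flux_coeff_pos[OF J])
  have kinv: "1 / ?k w \<le> 2 * M ^ 3 / J" for w
  proof -
    have "1 / ?k w = 2 * ?m w ^ 3 / (?m w + J)" by (simp add: flux_coeff_def)
    also have "\<dots> \<le> 2 * M ^ 3 / J"
      using m[of w] J by (intro frac_le mult_left_mono power_mono) auto
    finally show ?thesis .
  qed
  have Jm: "0 \<le> J / (\<tau> * ?m w)" "J / (\<tau> * ?m w) \<le> 1 / \<tau>" for w
    using m[of w] J \<tau> by (auto simp: field_simps)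
  define f where "f s w y = ((y - \<beta> s) / p s - J / (\<tau> * ?m w)) / ?k w" for s w y
  \<comment> \<open>For \<open>y \<ge> Y\<close> this gives
    \<open>(y - \<beta>) / p \<ge> 1 / \<tau>\<close>, which dominates the relaxation term because
    the momentum is at least \<open>J\<close>; for \<open>y \<le> - Y\<close> both terms are
    nonpositive.\<close>
  define Y where "Y = B + R / \<tau>"
  define F where "F = ((Y + 2 * M * (b - a) + B) * S + 1 / \<tau>) * (2 * M ^ 3 / J)"
  interpret shooting a b Y M F f ?m
  proof
    show "continuous_on ({a..b} \<times> UNIV) (\<lambda>(s, z). f s (fst z) (snd z))"
      unfolding f_def case_prod_unfold
      by (intro continuous_intros continuous_on_compose2[OF continuous_momentum[of UNIV]]
          continuous_on_compose2[OF continuous_flux_coeff[OF J, of UNIV]] continuous_on_compose2[OF \<beta>c] continuous_on_compose2[OF p_cont])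
         (use p_pos m(3) k \<tau> in \<open>force simp: less_le\<close>)+
    show "\<bar>?m w\<bar> \<le> M" for w using m[of w] by simp
    show "0 \<le> f s w y" if s: "s \<in> {a..b}" and y: "Y \<le> y" for s w y
    proof -
      have "p s / \<tau> \<le> R / \<tau>" using R(1)[OF s] \<tau> by (intro divide_right_mono) auto
      then have "p s / \<tau> \<le> y - \<beta> s" using B(1)[OF s] y by (simp add: Y_def abs_le_iff)
      then have "1 / \<tau> \<le> (y - \<beta> s) / p s" using p_pos[OF s] \<tau> by (simp add: field_simps)
      then show ?thesis unfolding f_def using Jm(2)[of w] k[of w] by (intro divide_nonneg_pos) auto
    qed
    show "f s w y \<le> 0" if s: "s \<in> {a..b}" and y: "y \<le> - Y" for s w y
    proof -
      have "0 \<le> R / \<tau>" using R(2) \<tau> by simp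
      then have "y - \<beta> s \<le> 0" using B(1)[OF s] y by (simp add: Y_def abs_le_iff)
      then have "(y - \<beta> s) / p s \<le> 0" using p_pos[OF s] by (simp add: divide_nonpos_pos)
      then show ?thesis unfolding f_def using Jm(1)[of w] k[of w] by (intro divide_nonpos_pos) auto
    qed
    show "\<bar>f s w y\<bar> \<le> F" if s: "s \<in> {a..b}" and y: "\<bar>y\<bar> \<le> Y + 2 * M * (b - a)" for s w y
    proof -
      have "\<bar>(y - \<beta> s) / p s\<bar> = \<bar>y - \<beta> s\<bar> * \<bar>1 / p s\<bar>" by (simp add: abs_mult[symmetric])
      also have "\<dots> \<le> (Y + 2 * M * (b - a) + B) * S"
        using B(1)[OF s] y S(1)[OF s] S(2) by (intro mult_mono) auto
      finally have "\<bar>(y - \<beta> s) / p s - J / (\<tau> * ?m w)\<bar> \<le> (Y + 2 * M * (b - a) + B) * S + 1 / \<tau>"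
        using Jm[of w] by linarith
      then have "\<bar>(y - \<beta> s) / p s - J / (\<tau> * ?m w)\<bar> * (1 / ?k w) \<le> F"
        unfolding F_def using kinv[of w] k[of w] by (intro mult_mono) auto
      then show ?thesis using k[of w] by (simp add: f_def)
    qed
    show "0 \<le> Y" using B(2) R(2) \<tau> by (simp add: Y_def)
  qed (use ab continuous_momentum in auto)
  obtain w y where wy: "\<And>x. x \<in> {a..b} \<Longrightarrow> (w has_real_derivative f x (w x) (y x)) (at x within {a..b})"
    "\<And>x. x \<in> {a..b} \<Longrightarrow> (y has_real_derivative ?m (w x)) (at x within {a..b})" "w a = 0" "w b = 0"
    using bvp_solution by blast
  have wc: "continuous_on {a..b} w" by (rule DERIV_continuous_on[OF wy(1)])
  have mc: "continuous_on {a..b} (\<lambda>x. ?m (w x))" by (rule continuous_on_compose2[OF continuous_momentum wc]) auto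
  show thesis
  proof
    show "solves W w (\<lambda>x. y x - \<beta> x)"
      using wy(1) by (simp add: solves_def slope_def f_def)
    show "y x - \<beta> x = y a + integral {a..x} (\<lambda>x. ?m (w x) - q x)" if x: "x \<in> {a..b}" for x
    proof -
      have "((\<lambda>x. ?m (w x)) has_integral y x - y a) {a..x}"
        using x by (intro fundamental_theorem_of_calculus)
          (auto simp: has_real_derivative_iff_has_vector_derivative[symmetric] intro!: DERIV_subset[OF wy(2)])
      moreover have "q integrable_on {a..x}"
        using x by (intro integrable_on_subinterval[OF integral_leb_ivl_eq(1)[OF q_integrable]]) auto
      ultimately have "((\<lambda>x. ?m (w x) - q x) has_integral (y x - y a) - \<beta> x) {a..x}"
        unfolding \<beta>_def by (intro has_integral_diff integrable_integral)
      then show ?thesis by (simp add: integral_unique)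
    qed
  qed (use wy in auto)
qed

end

text \<open>\<open>upper\<close> says that the constant profile \<open>M\<close>, with flux
  \<open>p * J / (\<tau> * M)\<close>, is a supersolution; \<open>lower\<close> says that the sonic
  profile \<open>J\<close>, with flux \<open>p / \<tau>\<close>, is a subsolution with margin
  \<open>\<delta>\<close>.\<close>

locale flow_barriers = flow +
  fixes dp :: "real \<Rightarrow> real" and M \<delta> :: real
  assumes dp: "\<And>x. x \<in> {a..b} \<Longrightarrow> (p has_real_derivative dp x) (at x within {a..b})"
    and dp_cont: "continuous_on {a..b} dp"
    and M: "M > J" and \<delta>: "\<delta> > 0"
    and upper: "AE x in leb_ivl a b. dp x * J / (\<tau> * M) \<le> M - q x"
    and lower: "AE x in leb_ivl a b. J - q x + \<delta> \<le> dp x / \<tau>"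
begin

lemma momentum_M: "momentum J ((M - J)\<^sup>2) ((M - J)\<^sup>2) = M"
  using M by (simp add: momentum_eq)

text \<open>Monotonicity of the difference between the flux of a solution and that of a barrier. The
  sign \<open>k\<close> lets one statement serve the upper and the lower barrier.\<close>

lemma increment_le:
  assumes w: "solves W w E" and E: "\<And>x. x \<in> {a..b} \<Longrightarrow> E x = c + integral {a..x} (\<lambda>x. momentum J W (w x) - q x)"
    and e: "\<And>x. x \<in> {a..b} \<Longrightarrow> (e has_real_derivative e' x) (at x within {a..b})" "continuous_on {a..b} e'"
    and xy: "a \<le> x" "x \<le> y" "y \<le> b"
    and k: "k \<in> {-1, 1}" and nn: "AE s in leb_ivl a b. s \<in> {x<..<y} \<longrightarrow> 0 \<le> k * (momentum J W (w s) - q s - e' s)"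
  shows "k * (E x - e x) \<le> k * (E y - e y)"
proof -
  have "continuous_on {a..b} w"
    using w by (auto simp: solves_def intro: DERIV_continuous_on)
  note I = source_integrable[OF this, of W]
  have "(\<lambda>s. momentum J W (w s) - q s) integrable_on {x..y}"
    by (rule integrable_on_subinterval[OF integral_leb_ivl_eq(1)[OF I]]) (use xy in auto)
  then have "((\<lambda>s. momentum J W (w s) - q s) has_integral E y - E x) {x..y}"
    using integral_increment[OF I xy] E[of x] E[of y] xy by (simp add: has_integral_iff)
  moreover have "(e' has_integral e y - e x) {x..y}"
    using xy by (intro fundamental_theorem_of_calculus)
      (auto simp: has_real_derivative_iff_has_vector_derivative[symmetric] intro!: DERIV_subset[OF e(1)])
  ultimately have hI: "((\<lambda>s. k * (momentum J W (w s) - q s - e' s)) has_integral k * ((E y - E x) - (e y - e x))) {x..y}"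
    by (rule has_integral_mult_right[OF has_integral_diff])
  have "0 \<le> integral {x..y} (\<lambda>s. k * (momentum J W (w s) - q s - e' s))"
    by (rule integral_nonneg_AE_subinterval[OF _ xy nn])
       (intro integrable_mult_right Bochner_Integration.integrable_diff[OF I] continuous_on_integrable_leb_ivl e)
  then have "0 \<le> k * ((E y - E x) - (e y - e x))" unfolding integral_unique[OF hI] .
  then show ?thesis by (simp add: algebra_simps)
qed

text \<open>With flux \<open>p * J / (\<tau> * M)\<close> the constant profile has slope zero. Where
  \<open>w\<close> exceeds the truncation level, the momentum is at least \<open>M\<close>, and
  \<open>upper\<close> makes the flux difference nondecreasing.\<close>

lemma solution_le_upper:
  assumes w: "solves ((M - J)\<^sup>2) w E" "w a = 0" "w b = 0"
    and E: "\<And>x. x \<in> {a..b} \<Longrightarrow> E x = c + integral {a..x} (\<lambda>x. momentum J ((M - J)\<^sup>2) (w x) - q x)"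
    and x: "x \<in> {a..b}"
  shows "w x \<le> (M - J)\<^sup>2"
proof (rule solves_compare[OF w(1), where ?E2.0 = "\<lambda>x. p x * J / (\<tau> * M)" and ?w2.0 = "\<lambda>_. (M - J)\<^sup>2"])
  show "solves ((M - J)\<^sup>2) (\<lambda>_. (M - J)\<^sup>2) (\<lambda>x. p x * J / (\<tau> * M))"
    unfolding solves_def slope_def momentum_M using p_pos by (auto simp: less_le)
  fix x y assume xy: "a \<le> x" "x \<le> y" "y \<le> b" and less: "\<And>s. s \<in> {x<..<y} \<Longrightarrow> (M - J)\<^sup>2 < w s"
  have "1 * (E x - p x * J / (\<tau> * M)) \<le> 1 * (E y - p y * J / (\<tau> * M))"
  proof (rule increment_le[OF w(1) E, where e' = "\<lambda>x. dp x * J / (\<tau> * M)"])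
    show "((\<lambda>x. p x * J / (\<tau> * M)) has_real_derivative dp x * J / (\<tau> * M)) (at x within {a..b})" if "x \<in> {a..b}" for x
      by (intro DERIV_cdivide DERIV_cmult_right dp that)
    show "continuous_on {a..b} (\<lambda>x. dp x * J / (\<tau> * M))"
      using \<tau> M J by (intro continuous_intros dp_cont) auto
    show "AE s in leb_ivl a b. s \<in> {x<..<y} \<longrightarrow> 0 \<le> 1 * (momentum J ((M - J)\<^sup>2) (w s) - q s - dp s * J / (\<tau> * M))"
      using upper
    proof eventually_elim
      case (elim s)
      have "M \<le> momentum J ((M - J)\<^sup>2) (w s)" if "s \<in> {x<..<y}"
        using momentum_mono[of "(M - J)\<^sup>2" "w s" J "(M - J)\<^sup>2"] less[OF that] by (simp add: momentum_M)
      with elim show ?case by auto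
    qed
  qed (use xy in auto)
  then show "E x - p x * J / (\<tau> * M) \<le> E y - p y * J / (\<tau> * M)" by simp
qed (use w x in auto)

definition arch :: "real \<Rightarrow> real" where "arch x = sin (pi * ((x - a) / (b - a)))"
definition arch' :: "real \<Rightarrow> real" where "arch' x = pi / (b - a) * cos (pi * ((x - a) / (b - a)))"

lemma arch_deriv: "(arch has_real_derivative arch' x) (at x within S)"
  "(arch' has_real_derivative - (pi / (b - a))\<^sup>2 * arch x) (at x within S)"
proof -
  define k where "k = pi / (b - a)"
  have "arch = (\<lambda>x. sin (k * (x - a)))" "arch' = (\<lambda>x. k * cos (k * (x - a)))"
    by (auto simp: arch_def arch'_def k_def fun_eq_iff)
  then show "(arch has_real_derivative arch' x) (at x within S)"
    "(arch' has_real_derivative - (pi / (b - a))\<^sup>2 * arch x) (at x within S)"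
    unfolding k_def[symmetric] by (auto intro!: derivative_eq_intros simp: power2_eq_square)
qed

lemma arch_bounds: "x \<in> {a..b} \<Longrightarrow> 0 \<le> arch x" "arch x \<le> 1"
  unfolding arch_def using ab by (auto intro!: sin_ge_zero simp: divide_le_eq)

lemma arch_ends: "arch a = 0" "arch b = 0"
  unfolding arch_def using ab by auto

text \<open>The flux of the profile \<open>m = J + l * arch\<close>, divided by \<open>p\<close>.\<close>

definition flux :: "real \<Rightarrow> real \<Rightarrow> real" where
  "flux l x = l\<^sup>2 * ((2 * J + l * arch x) * (arch x * arch' x)) / (J + l * arch x) ^ 3 + J / (\<tau> * (J + l * arch x))"

definition flux' :: "real \<Rightarrow> real \<Rightarrow> real" where
  "flux' l x = (l\<^sup>2 * ((l * arch' x) * (arch x * arch' x) +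
        (2 * J + l * arch x) * (arch' x * arch' x + arch x * (- (pi / (b - a))\<^sup>2 * arch x)))) / (J + l * arch x) ^ 3
      - 3 * (l\<^sup>2 * ((2 * J + l * arch x) * (arch x * arch' x))) * (l * arch' x) / (J + l * arch x) ^ 4
      - J * (l * arch' x) / (\<tau> * (J + l * arch x)\<^sup>2)"

lemma profile_pos: "x \<in> {a..b} \<Longrightarrow> 0 \<le> l \<Longrightarrow> 0 < J + l * arch x"
  using J arch_bounds(1)[of x] by (simp add: add_pos_nonneg)

lemma flux_deriv:
  assumes x: "x \<in> {a..b}" and l: "0 \<le> l"
  shows "(flux l has_real_derivative flux' l x) (at x within {a..b})"
proof -
  define m where "m = J + l * arch x"
  have "m \<noteq> 0" "\<tau> \<noteq> 0" using profile_pos[OF assms] \<tau> by (auto simp: m_def)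
  have "\<tau> * (J + l * arch x) \<noteq> 0" using profile_pos[OF assms] \<tau> by simp
  then have n: "J * \<tau> + \<tau> * (l * arch x) \<noteq> 0" by (simp add: algebra_simps)
  have "(flux l has_real_derivative
      ((l\<^sup>2 * ((l * arch' x) * (arch x * arch' x) + (2 * J + l * arch x) * (arch' x * arch' x + arch x * (- (pi / (b - a))\<^sup>2 * arch x)))) * m ^ 3
       - (l\<^sup>2 * ((2 * J + l * arch x) * (arch x * arch' x))) * (3 * m ^ 2 * (l * arch' x))) / (m ^ 3 * m ^ 3)
      + (0 * (\<tau> * m) - J * (\<tau> * (l * arch' x))) / ((\<tau> * m) * (\<tau> * m))) (at x within {a..b})"
    unfolding flux_def[abs_def] m_def
    using profile_pos[OF assms] \<tau> n
    by (auto intro!: derivative_eq_intros arch_deriv simp: m_def algebra_simps)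
  also have "((l\<^sup>2 * ((l * arch' x) * (arch x * arch' x) + (2 * J + l * arch x) * (arch' x * arch' x + arch x * (- (pi / (b - a))\<^sup>2 * arch x)))) * m ^ 3
       - (l\<^sup>2 * ((2 * J + l * arch x) * (arch x * arch' x))) * (3 * m ^ 2 * (l * arch' x))) / (m ^ 3 * m ^ 3)
      + (0 * (\<tau> * m) - J * (\<tau> * (l * arch' x))) / ((\<tau> * m) * (\<tau> * m)) = flux' l x"
  proof -
    have "(A * m ^ 3 - D * (3 * m ^ 2 * z)) / (m ^ 3 * m ^ 3) + (0 * (\<tau> * m) - J * (\<tau> * z)) / ((\<tau> * m) * (\<tau> * m))
      = A / m ^ 3 - 3 * D * z / m ^ 4 - J * z / (\<tau> * m\<^sup>2)" for A D z
      using \<open>m \<noteq> 0\<close> \<open>\<tau> \<noteq> 0\<close> by (simp add: field_simps power2_eq_square power3_eq_cube eval_nat_numeral)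
    then show ?thesis unfolding flux'_def m_def[symmetric] .
  qed
  finally show ?thesis .
qed

lemma continuous_flux':
  "continuous_on ({0..1} \<times> {a..b}) (\<lambda>(l, x). flux' l x)" "continuous_on ({0..1} \<times> {a..b}) (\<lambda>(l, x). flux l x)"
proof -
  have c: "continuous_on S (\<lambda>p. arch (snd p))" "continuous_on S (\<lambda>p. arch' (snd p))" for S :: "(real \<times> real) set"
    unfolding arch_def arch'_def using ab by (auto intro!: continuous_intros)
  have "J + fst p * arch (snd p) \<noteq> 0" if "p \<in> {0..1} \<times> {a..b}" for p
    using profile_pos[of "snd p" "fst p"] that by auto
  then show "continuous_on ({0..1} \<times> {a..b}) (\<lambda>(l, x). flux' l x)" "continuous_on ({0..1} \<times> {a..b}) (\<lambda>(l, x). flux l x)"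
    unfolding flux'_def flux_def case_prod_unfold using \<tau> ab
    by (intro continuous_intros c; auto)+
qed

text \<open>For \<open>l = 0\<close> the derivative of \<open>p * flux l\<close> is \<open>dp / \<tau>\<close>, so by uniform continuity in \<open>l\<close> the
  profile remains a subsolution for small \<open>l > 0\<close>.\<close>

lemma small_profile:
  obtains l where "0 < l" "l \<le> M - J" "l \<le> 1"
    "\<And>x. x \<in> {a..b} \<Longrightarrow> dp x / \<tau> - \<delta> \<le> dp x * flux l x + p x * flux' l x - l * arch x"
proof -
  define H where "H l x = dp x * flux l x + p x * flux' l x - l * arch x" for l x
  have "continuous_on ({0..1} \<times> {a..b}) (\<lambda>q. dp (snd q) * (case q of (l, x) \<Rightarrow> flux l x) + p (snd q) * (case q of (l, x) \<Rightarrow> flux' l x) - fst q * arch (snd q))"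
    unfolding arch_def using ab
    by (intro continuous_intros continuous_flux' continuous_on_compose2[OF dp_cont] continuous_on_compose2[OF p_cont]) auto
  then have Hc: "continuous_on ({0..1} \<times> {a..b}) (\<lambda>q. H (fst q) (snd q))"
    by (simp add: H_def case_prod_unfold)
  have "uniformly_continuous_on ({0..1} \<times> {a..b}) (\<lambda>q. H (fst q) (snd q))"
    by (rule compact_uniformly_continuous[OF Hc]) (intro compact_Times compact_Icc)
  then obtain d where d: "d > 0" "\<And>q q'. q \<in> {0..1} \<times> {a..b} \<Longrightarrow> q' \<in> {0..1} \<times> {a..b} \<Longrightarrow> dist q' q < d \<Longrightarrow>
      dist (H (fst q') (snd q')) (H (fst q) (snd q)) < \<delta>"
    using \<delta> unfolding uniformly_continuous_on_def by metis
  \<comment> \<open>Below \<open>d\<close> for uniform continuity, at most 1 to stay in the compact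
    parameter range, and at most \<open>M - J\<close> so that the profile does not exceed
    \<open>M\<close>.\<close>
  define l where "l = min (d / 2) (min 1 (M - J))"
  have l: "0 < l" "l < d" "l \<le> 1" "l \<le> M - J" using d(1) M by (auto simp: l_def)
  show thesis
  proof
    fix x assume x: "x \<in> {a..b}"
    have "dist (H l x) (H 0 x) < \<delta>"
      using d(2)[of "(0, x)" "(l, x)"] x l by (auto simp: dist_Pair_Pair)
    moreover have "H 0 x = dp x / \<tau>" using J by (simp add: H_def flux_def flux'_def)
    ultimately have "dp x / \<tau> - \<delta> \<le> H l x" by (simp add: dist_real_def abs_less_iff)
    then show "dp x / \<tau> - \<delta> \<le> dp x * flux l x + p x * flux' l x - l * arch x" by (simp add: H_def)
  qed (use l in auto)
qed

text \<open>The lifted profile solves the first equation exactly with flux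
  \<open>p * flux l\<close>. Combining \<open>small\<close> with \<open>lower\<close>, the
  derivative of this flux is at least \<open>J + l * arch - q\<close>, which dominates the source of
  the solution wherever \<open>w\<close> lies below the profile.\<close>

lemma solution_ge_arch:
  assumes w: "solves ((M - J)\<^sup>2) w E" "w a = 0" "w b = 0"
    and E: "\<And>x. x \<in> {a..b} \<Longrightarrow> E x = c + integral {a..x} (\<lambda>x. momentum J ((M - J)\<^sup>2) (w x) - q x)"
    and l: "0 < l" "l \<le> M - J" "l \<le> 1"
    and small: "\<And>x. x \<in> {a..b} \<Longrightarrow> dp x / \<tau> - \<delta> \<le> dp x * flux l x + p x * flux' l x - l * arch x"
    and x: "x \<in> {a..b}"
  shows "(l * arch x)\<^sup>2 \<le> w x"
proof (rule solves_compare[OF _ w(1), where ?E1.0 = "\<lambda>x. p x * flux l x" and ?w1.0 = "\<lambda>x. (l * arch x)\<^sup>2"])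
  \<comment> \<open>Since \<open>l \<le> M - J\<close>, the truncation is inactive on the
    profile.\<close>
  have mom: "momentum J ((M - J)\<^sup>2) ((l * arch x)\<^sup>2) = J + l * arch x" if x: "x \<in> {a..b}" for x
  proof -
    have "0 \<le> l * arch x" using l arch_bounds(1)[OF x] by simp
    moreover have "l * arch x \<le> M - J" using mult_mono[OF l(2) arch_bounds(2)[of x]] l M arch_bounds(1)[OF x] by simp
    ultimately show ?thesis by (subst momentum_eq) (auto intro: power_mono)
  qed
  show "solves ((M - J)\<^sup>2) (\<lambda>x. (l * arch x)\<^sup>2) (\<lambda>x. p x * flux l x)"
    unfolding solves_def
  proof
    fix x assume x: "x \<in> {a..b}"
    have "((\<lambda>x. (l * arch x)\<^sup>2) has_real_derivative 2 * (l * arch x) * (l * arch' x)) (at x within {a..b})"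
      by (auto intro!: derivative_eq_intros arch_deriv)
    moreover have "slope ((M - J)\<^sup>2) (\<lambda>x. (l * arch x)\<^sup>2) (\<lambda>x. p x * flux l x) x = 2 * (l * arch x) * (l * arch' x)"
    proof -
      define m where "m = J + l * arch x"
      have m0: "m > 0" "m + J > 0" using profile_pos[OF x, of l] l J by (auto simp: m_def)
      have cancel: "(u * (s * z) / n) / (s / (2 * n)) = 2 * u * z" if "n \<noteq> 0" "s \<noteq> 0" for u s z n :: real
        using that by (simp add: field_simps)
      have "p x * flux l x / p x = flux l x" using p_pos[OF x] by simp
      then have "slope ((M - J)\<^sup>2) (\<lambda>x. (l * arch x)\<^sup>2) (\<lambda>x. p x * flux l x) x =
          (l\<^sup>2 * ((m + J) * (arch x * arch' x)) / m ^ 3) / ((m + J) / (2 * m ^ 3))"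
        unfolding slope_def flux_coeff_def mom[OF x] flux_def by (simp add: m_def algebra_simps)
      also have "\<dots> = 2 * (l * arch x) * (l * arch' x)"
        using cancel[of "m ^ 3" "m + J" "l\<^sup>2" "arch x * arch' x"] m0 by (simp add: power2_eq_square)
      finally show ?thesis .
    qed
    ultimately show "((\<lambda>x. (l * arch x)\<^sup>2) has_real_derivative slope ((M - J)\<^sup>2) (\<lambda>x. (l * arch x)\<^sup>2) (\<lambda>x. p x * flux l x) x) (at x within {a..b})"
      by simp
  qed
  fix x y assume xy: "a \<le> x" "x \<le> y" "y \<le> b" and less: "\<And>s. s \<in> {x<..<y} \<Longrightarrow> w s < (l * arch s)\<^sup>2"
  have "(-1) * (E x - p x * flux l x) \<le> (-1) * (E y - p y * flux l y)"
  proof (rule increment_le[OF w(1) E, where e' = "\<lambda>x. dp x * flux l x + p x * flux' l x"])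
    show "((\<lambda>x. p x * flux l x) has_real_derivative dp x * flux l x + p x * flux' l x) (at x within {a..b})" if "x \<in> {a..b}" for x
      using DERIV_mult[OF dp[OF that] flux_deriv[OF that, of l]] l by (simp add: mult.commute add.commute)
    have "continuous_on {a..b} (flux l)" "continuous_on {a..b} (flux' l)"
      by (rule continuous_on_section[OF continuous_flux'(2)], use l in auto)
         (rule continuous_on_section[OF continuous_flux'(1)], use l in auto)
    then show "continuous_on {a..b} (\<lambda>x. dp x * flux l x + p x * flux' l x)"
      by (intro continuous_intros dp_cont p_cont)
    show "AE s in leb_ivl a b. s \<in> {x<..<y} \<longrightarrow> 0 \<le> (-1) * (momentum J ((M - J)\<^sup>2) (w s) - q s - (dp s * flux l s + p s * flux' l s))"
      using lower
    proof eventually_elim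
      case (elim s)
      show ?case
      proof
        assume s: "s \<in> {x<..<y}"
        then have "s \<in> {a..b}" using xy by auto
        moreover have "momentum J ((M - J)\<^sup>2) (w s) \<le> momentum J ((M - J)\<^sup>2) ((l * arch s)\<^sup>2)"
          using less[OF s] by (intro momentum_mono) simp
        ultimately show "0 \<le> (-1) * (momentum J ((M - J)\<^sup>2) (w s) - q s - (dp s * flux l s + p s * flux' l s))"
          using mom[of s] small[of s] elim by auto
      qed
    qed
  qed (use xy in auto)
  then show "p x * flux l x - E x \<le> p y * flux l y - E y" by simp
qed (use w x arch_ends in auto)

lemma subsonic_solution_exists:
  obtains w E c l where "solves ((M - J)\<^sup>2) w E" "w a = 0" "w b = 0"
    "\<And>x. x \<in> {a..b} \<Longrightarrow> E x = c + integral {a..x} (\<lambda>x. momentum J ((M - J)\<^sup>2) (w x) - q x)"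
    "0 < l" "\<And>x. x \<in> {a..b} \<Longrightarrow> (l * arch x)\<^sup>2 \<le> w x" "\<And>x. x \<in> {a..b} \<Longrightarrow> w x \<le> (M - J)\<^sup>2"
proof (rule solution_exists[OF zero_le_power2, of "M - J"])
  fix w E c
  assume w: "solves ((M - J)\<^sup>2) w E" "w a = 0" "w b = 0"
    and E: "\<And>x. x \<in> {a..b} \<Longrightarrow> E x = c + integral {a..x} (\<lambda>x. momentum J ((M - J)\<^sup>2) (w x) - q x)"
  obtain l where l: "0 < l" "l \<le> M - J" "l \<le> 1"
    "\<And>x. x \<in> {a..b} \<Longrightarrow> dp x / \<tau> - \<delta> \<le> dp x * flux l x + p x * flux' l x - l * arch x"
    using small_profile by blast
  show thesis
    by (rule that[OF w E l(1) solution_ge_arch[OF w E l] solution_le_upper[OF w E]])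
qed

end

section \<open>Weak solutions\<close>

lemma test_function_H10:
  assumes ab: "a < b" and \<phi>: "\<phi> \<in> test_functions a b"
  shows "\<phi> \<in> H10 a b" "has_weak_deriv a b \<phi> (deriv \<phi>)"
proof -
  have d: "(\<phi> has_real_derivative deriv \<phi> x) (at x within {a..b})" for x
    by (rule has_field_derivative_at_within[OF smooth_has_deriv[OF test_function_smooth[OF \<phi>]]])
  have "\<phi> a = 0" "\<phi> b = 0" using test_functionE[OF \<phi> ab] by (metis less_imp_le)+
  then show "\<phi> \<in> H10 a b" by (rule C1_zero_H10[OF ab d deriv_test_function_continuous[OF \<phi>]])
  show "has_weak_deriv a b \<phi> (deriv \<phi>)"
    by (rule C1_has_weak_deriv[OF ab d deriv_test_function_continuous[OF \<phi>]])
qed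

lemma LINT_deriv_test_function:
  assumes ab: "a < b" and \<phi>: "\<phi> \<in> test_functions a b"
  shows "(LINT x|leb_ivl a b. deriv \<phi> x) = 0"
proof -
  have d: "(\<phi> has_real_derivative deriv \<phi> x) (at x within {a..b})" for x
    by (rule has_field_derivative_at_within[OF smooth_has_deriv[OF test_function_smooth[OF \<phi>]]])
  have "\<phi> a = 0" "\<phi> b = 0" using test_functionE[OF \<phi> ab] by (metis less_imp_le)+
  then show ?thesis
    using integral_leb_ivl_deriv[OF less_imp_le[OF ab] d deriv_test_function_continuous[OF \<phi>]] by simp
qed

context flow
begin

text \<open>The notion of interior subsonic solution with abstract coefficients \<open>p\<close> and
  \<open>q\<close>, so that both dimensions are treated at once.\<close>

definition weak_solution :: "(real \<Rightarrow> real) \<Rightarrow> bool" where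
  "weak_solution m \<longleftrightarrow> m a = J \<and> m b = J \<and> (\<forall>r\<in>{a<..<b}. m r > J) \<and>
     continuous_on {a..b} (\<lambda>r. (m r - J)\<^sup>2) \<and> (\<lambda>r. (m r - J)\<^sup>2) \<in> H10 a b \<and>
     (\<exists>g. has_weak_deriv a b (\<lambda>r. (m r - J)\<^sup>2) g \<and>
       (\<forall>\<phi>\<in>H10 a b. \<forall>\<psi>. has_weak_deriv a b \<phi> \<psi> \<longrightarrow>
         (LINT r|leb_ivl a b. (p r * ((m r + J) / (2 * (m r) ^ 3)) * g r + p r * J / (\<tau> * m r)) * \<psi> r)
         + (LINT r|leb_ivl a b. (m r - q r) * \<phi> r) = 0))"

lemma source_AE_bounded:
  assumes w: "continuous_on {a..b} w"
  obtains D where "AE x in leb_ivl a b. \<bar>momentum J W (w x) - q x\<bar> \<le> D"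
proof -
  have "continuous_on {a..b} (\<lambda>x. momentum J W (w x))"
    by (rule continuous_on_compose2[OF continuous_momentum w]) auto
  then obtain D where "AE x in leb_ivl a b. \<bar>momentum J W (w x)\<bar> \<le> D"
    using continuous_on_AE_bounded by metis
  with q_bound have "AE x in leb_ivl a b. \<bar>momentum J W (w x) - q x\<bar> \<le> D + C"
    by eventually_elim linarith
  then show thesis by (rule that)
qed

lemma source_by_parts:
  assumes w: "continuous_on {a..b} w" and \<phi>: "\<phi> \<in> test_functions a b"
  shows "(LINT x|leb_ivl a b. (momentum J W (w x) - q x) * \<phi> x) =
    - (LINT x|leb_ivl a b. integral {a..x} (\<lambda>x. momentum J W (w x) - q x) * deriv \<phi> x)"
proof (rule source_AE_bounded[OF w])
  fix D assume "AE x in leb_ivl a b. \<bar>momentum J W (w x) - q x\<bar> \<le> D"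
  then show ?thesis
    using source_integrable[OF w] by (intro integral_by_parts_test_function[OF ab _ _ \<phi>]) auto
qed

lemma source_antiderivative_continuous:
  assumes w: "continuous_on {a..b} w"
  shows "continuous_on {a..b} (\<lambda>x. integral {a..x} (\<lambda>x. momentum J W (w x) - q x))"
  by (rule indefinite_integral_continuous_1[OF integral_leb_ivl_eq(1)[OF source_integrable[OF w]]])

lemma flux_continuous:
  assumes w: "continuous_on {a..b} w"
    and E: "\<And>x. x \<in> {a..b} \<Longrightarrow> E x = c + integral {a..x} (\<lambda>x. momentum J W (w x) - q x)"
  shows "continuous_on {a..b} E"
proof -
  have "continuous_on {a..b} (\<lambda>x. c + integral {a..x} (\<lambda>x. momentum J W (w x) - q x))"
    by (intro continuous_on_add continuous_on_const source_antiderivative_continuous[OF w])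
  then show ?thesis by (rule continuous_on_eq) (simp add: E)
qed

lemma continuous_slope:
  assumes w: "continuous_on {a..b} w" and E: "continuous_on {a..b} E"
  shows "continuous_on {a..b} (slope W w E)"
proof -
  have mc: "continuous_on {a..b} (\<lambda>x. momentum J W (w x))"
    by (rule continuous_on_compose2[OF continuous_momentum w]) auto
  have kc: "continuous_on {a..b} (\<lambda>x. flux_coeff J W (w x))"
    by (rule continuous_on_compose2[OF continuous_flux_coeff[OF J] w]) auto
  have "momentum J W u > 0" "flux_coeff J W u > 0" for u
    using momentum_ge[of J W u] flux_coeff_pos[OF J, of W u] J by auto
  then show ?thesis unfolding slope_def using \<tau> p_pos
    by (intro continuous_intros mc kc E p_cont) (force simp: less_le)+
qed

text \<open>As \<open>w\<close> is continuously differentiable, \<open>slope\<close> is its weak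
  derivative and the flux in the weak form equals \<open>E\<close>. Integration by parts gives the
  identity for test functions, and density extends it to \<open>H10\<close>.\<close>

lemma solves_weak_solution:
  assumes s: "solves W w E" "w a = 0" "w b = 0"
    and E: "\<And>x. x \<in> {a..b} \<Longrightarrow> E x = c + integral {a..x} (\<lambda>x. momentum J W (w x) - q x)"
    and w: "\<And>x. x \<in> {a..b} \<Longrightarrow> 0 \<le> w x" "\<And>x. x \<in> {a..b} \<Longrightarrow> w x \<le> W" "\<And>x. x \<in> {a<..<b} \<Longrightarrow> 0 < w x"
  shows "weak_solution (\<lambda>x. J + sqrt (w x))"
proof -
  let ?M = "leb_ivl a b" and ?m = "\<lambda>x. J + sqrt (w x)"
  have d: "(w has_real_derivative slope W w E x) (at x within {a..b})" if "x \<in> {a..b}" for x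
    using s(1) that by (simp add: solves_def)
  have wc: "continuous_on {a..b} w" by (rule DERIV_continuous_on[OF d])
  have Ec: "continuous_on {a..b} E"
    by (rule flux_continuous[OF wc E])
  have sc: "continuous_on {a..b} (slope W w E)" by (rule continuous_slope[OF wc Ec])
  have mom: "momentum J W (w x) = ?m x" if "x \<in> {a..b}" for x
    using w(1,2)[OF that] by (simp add: momentum_eq)
  have sq: "(?m x - J)\<^sup>2 = w x" if "x \<in> {a..b}" for x using w(1)[OF that] by simp
  have d2: "((\<lambda>x. (?m x - J)\<^sup>2) has_real_derivative slope W w E x) (at x within {a..b})" if x: "x \<in> {a..b}" for x
    by (rule has_field_derivative_transform_within[OF d[OF x], where d = 1]) (use sq x in auto)
  have H: "(\<lambda>x. (?m x - J)\<^sup>2) \<in> H10 a b"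
    by (rule C1_zero_H10[OF ab d2 sc]) (use s in auto)
  have D: "has_weak_deriv a b (\<lambda>x. (?m x - J)\<^sup>2) (slope W w E)"
    by (rule C1_has_weak_deriv[OF ab d2 sc])
  have weak: "(LINT r|?M. (p r * ((?m r + J) / (2 * (?m r) ^ 3)) * slope W w E r + p r * J / (\<tau> * ?m r)) * \<psi> r)
      + (LINT r|?M. (?m r - q r) * \<phi> r) = 0"
    if \<phi>: "\<phi> \<in> H10 a b" "has_weak_deriv a b \<phi> \<psi>" for \<phi> \<psi>
  proof -
    obtain D where D: "AE x in ?M. \<bar>momentum J W (w x) - q x\<bar> \<le> D"
      by (rule source_AE_bounded[OF wc])
    have "(LINT x|?M. E x * \<psi> x) + (LINT x|?M. (momentum J W (w x) - q x) * \<phi> x) = 0"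
    proof (rule weak_form_H10[OF ab Ec _ D _ \<phi>])
      show "(\<lambda>x. momentum J W (w x) - q x) \<in> borel_measurable ?M"
        using source_integrable[OF wc] by blast
      fix \<theta> assume \<theta>: "\<theta> \<in> test_functions a b"
      let ?N = "\<lambda>x. integral {a..x} (\<lambda>x. momentum J W (w x) - q x)"
      have Nc: "continuous_on {a..b} ?N" by (rule source_antiderivative_continuous[OF wc])
      \<comment> \<open>The integration constant \<open>c\<close> drops out because the derivative
        of a test function has integral zero.\<close>
      have "(LINT x|?M. E x * deriv \<theta> x) = (LINT x|?M. c * deriv \<theta> x + ?N x * deriv \<theta> x)"
        by (rule Bochner_Integration.integral_cong) (auto simp: E algebra_simps)
      also have "\<dots> = (LINT x|?M. c * deriv \<theta> x) + (LINT x|?M. ?N x * deriv \<theta> x)"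
        by (intro Bochner_Integration.integral_add continuous_on_integrable_leb_ivl continuous_intros Nc deriv_test_function_continuous[OF \<theta>])
      also have "(LINT x|?M. c * deriv \<theta> x) = 0" using LINT_deriv_test_function[OF ab \<theta>] by simp
      finally show "(LINT x|?M. E x * deriv \<theta> x) + (LINT x|?M. (momentum J W (w x) - q x) * \<theta> x) = 0"
        using source_by_parts[OF wc \<theta>, of W] by simp
    qed
    moreover have "(LINT x|?M. E x * \<psi> x) =
      (LINT r|?M. (p r * ((?m r + J) / (2 * (?m r) ^ 3)) * slope W w E r + p r * J / (\<tau> * ?m r)) * \<psi> r)"
    proof (rule Bochner_Integration.integral_cong)
      fix r assume "r \<in> space ?M"
      then have r: "r \<in> {a..b}" by auto
      have "slope W w E r = (E r / p r - J / (\<tau> * ?m r)) / flux_coeff J W (w r)"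
        by (simp add: slope_def mom[OF r])
      moreover have "(?m r + J) / (2 * (?m r) ^ 3) = flux_coeff J W (w r)"
        by (simp add: flux_coeff_def mom[OF r])
      ultimately have "p r * ((?m r + J) / (2 * (?m r) ^ 3)) * slope W w E r = p r * (E r / p r - J / (\<tau> * ?m r))"
        using flux_coeff_pos[OF J, of W "w r"] by simp
      also have "\<dots> = E r - p r * J / (\<tau> * ?m r)" using p_pos[OF r] by (simp add: right_diff_distrib)
      finally show "E r * \<psi> r = (p r * ((?m r + J) / (2 * (?m r) ^ 3)) * slope W w E r + p r * J / (\<tau> * ?m r)) * \<psi> r"
        by simp
    qed simp
    moreover have "(LINT x|?M. (momentum J W (w x) - q x) * \<phi> x) = (LINT r|?M. (?m r - q r) * \<phi> r)"
      by (rule Bochner_Integration.integral_cong) (auto simp: mom)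
    ultimately show ?thesis by simp
  qed
  have "continuous_on {a..b} (\<lambda>x. (?m x - J)\<^sup>2)" by (rule DERIV_continuous_on[OF d2])
  then show ?thesis unfolding weak_solution_def using s w H D weak by auto
qed

text \<open>Regularity of weak solutions. The flux \<open>E0\<close> is a priori only integrable,
  but by du Bois-Reymond it equals a constant plus the primitive of the source almost everywhere.
  Hence \<open>g\<close> agrees with the continuous \<open>slope\<close>, and \<open>w\<close> is
  classically differentiable. The level \<open>W\<close> bounds \<open>w\<close>, so the truncation
  changes nothing.\<close>

lemma weak_solution_solves:
  assumes m: "weak_solution m" and W: "\<And>x. x \<in> {a..b} \<Longrightarrow> (m x - J)\<^sup>2 \<le> W"
  obtains E c where "solves W (\<lambda>x. (m x - J)\<^sup>2) E"
    "\<And>x. x \<in> {a..b} \<Longrightarrow> E x = c + integral {a..x} (\<lambda>x. momentum J W ((m x - J)\<^sup>2) - q x)"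
proof -
  let ?M = "leb_ivl a b" and ?w = "\<lambda>x. (m x - J)\<^sup>2"
  let ?N = "\<lambda>x. integral {a..x} (\<lambda>x. momentum J W (?w x) - q x)"
  obtain g where wc: "continuous_on {a..b} ?w" and g: "has_weak_deriv a b ?w g"
    and weak: "\<And>\<phi> \<psi>. \<phi> \<in> H10 a b \<Longrightarrow> has_weak_deriv a b \<phi> \<psi> \<Longrightarrow>
      (LINT r|?M. (p r * ((m r + J) / (2 * (m r) ^ 3)) * g r + p r * J / (\<tau> * m r)) * \<psi> r)
         + (LINT r|?M. (m r - q r) * \<phi> r) = 0"
    using m unfolding weak_solution_def by blast
  have mJ: "J \<le> m x" if "x \<in> {a..b}" for x
  proof -
    have "x = a \<or> x = b \<or> x \<in> {a<..<b}" using that by auto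
    then show ?thesis using m unfolding weak_solution_def by (auto intro: less_imp_le)
  qed
  have mom: "momentum J W (?w x) = m x" if "x \<in> {a..b}" for x
    using W[OF that] mJ[OF that] by (simp add: momentum_eq)
  have Nc: "continuous_on {a..b} ?N" by (rule source_antiderivative_continuous[OF wc])
  have mc: "continuous_on {a..b} (\<lambda>x. momentum J W (?w x))"
    by (rule continuous_on_compose2[OF continuous_momentum wc]) auto
  have kc: "continuous_on {a..b} (\<lambda>x. flux_coeff J W (?w x))"
    by (rule continuous_on_compose2[OF continuous_flux_coeff[OF J] wc]) auto
  have pos: "momentum J W u > 0" "flux_coeff J W u > 0" for u
    using momentum_ge[of J W u] flux_coeff_pos[OF J, of W u] J by auto
  have gI: "integrable ?M g" using g by (auto simp: has_weak_deriv_def L2_integrable)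
  define E0 where "E0 x = g x * (p x * flux_coeff J W (?w x)) + p x * J / (\<tau> * momentum J W (?w x))" for x
  have E0I: "integrable ?M E0" unfolding E0_def
  proof (rule Bochner_Integration.integrable_add)
    show "integrable ?M (\<lambda>x. g x * (p x * flux_coeff J W (?w x)))"
      by (intro integrable_mult_continuous[OF gI] continuous_intros p_cont kc)
    show "integrable ?M (\<lambda>x. p x * J / (\<tau> * momentum J W (?w x)))"
      using pos(1) \<tau> by (intro continuous_on_integrable_leb_ivl continuous_intros p_cont mc) (force simp: less_le)+
  qed
  have NI: "integrable ?M ?N" by (rule continuous_on_integrable_leb_ivl[OF Nc])
  obtain c where c: "AE x in ?M. E0 x - ?N x = c"
  proof (rule du_Bois_Reymond[OF ab Bochner_Integration.integrable_diff[OF E0I NI]])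
    fix \<phi> assume \<phi>: "\<phi> \<in> test_functions a b"
    have "(LINT r|?M. (p r * ((m r + J) / (2 * (m r) ^ 3)) * g r + p r * J / (\<tau> * m r)) * deriv \<phi> r) = (LINT x|?M. E0 x * deriv \<phi> x)"
      by (rule Bochner_Integration.integral_cong) (auto simp: E0_def flux_coeff_def mom mult_ac)
    moreover have "(LINT r|?M. (m r - q r) * \<phi> r) = (LINT x|?M. (momentum J W (?w x) - q x) * \<phi> x)"
      by (rule Bochner_Integration.integral_cong) (auto simp: mom)
    ultimately have "(LINT x|?M. E0 x * deriv \<phi> x) - (LINT x|?M. ?N x * deriv \<phi> x) = 0"
      using weak[OF test_function_H10[OF ab \<phi>]] source_by_parts[OF wc \<phi>, of W] by simp
    then show "(LINT x|?M. (E0 x - ?N x) * deriv \<phi> x) = 0"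
      using integrable_mult_continuous[OF E0I deriv_test_function_continuous[OF \<phi>]]
        integrable_mult_continuous[OF NI deriv_test_function_continuous[OF \<phi>]]
      by (simp add: left_diff_distrib)
  qed
  define E where "E x = c + ?N x" for x
  have Ec: "continuous_on {a..b} E" unfolding E_def by (intro continuous_intros Nc)
  have "AE x in ?M. g x = slope W ?w E x"
    using c AE_leb_ivl_interior
  proof eventually_elim
    case (elim x)
    then have x: "x \<in> {a..b}" by auto
    have "E x = g x * (p x * flux_coeff J W (?w x)) + p x * J / (\<tau> * momentum J W (?w x))"
      using elim by (simp add: E_def E0_def)
    then have "E x / p x = g x * flux_coeff J W (?w x) + J / (\<tau> * momentum J W (?w x))"
      using p_pos[OF x] by (simp add: add_divide_distrib)
    then show ?case using pos(2)[of "?w x"] by (simp add: slope_def)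
  qed
  then have "solves W ?w E"
    unfolding solves_def using weak_deriv_continuous[OF ab wc g continuous_slope[OF wc Ec]] by blast
  then show thesis by (rule that) (simp add: E_def)
qed

lemma weak_solution_unique:
  assumes m: "weak_solution m1" "weak_solution m2" and x: "x \<in> {a..b}"
  shows "m1 x = m2 x"
proof -
  have c: "continuous_on {a..b} (\<lambda>x. (m1 x - J)\<^sup>2)" "continuous_on {a..b} (\<lambda>x. (m2 x - J)\<^sup>2)"
    using m by (auto simp: weak_solution_def)
  \<comment> \<open>The larger of the two bounds is a common truncation level, so that both
    functions solve the same system.\<close>
  obtain W1 W2 where "\<And>x. x \<in> {a..b} \<Longrightarrow> \<bar>(m1 x - J)\<^sup>2\<bar> \<le> W1" "\<And>x. x \<in> {a..b} \<Longrightarrow> \<bar>(m2 x - J)\<^sup>2\<bar> \<le> W2"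
    using continuous_on_bounded_ivl[OF c(1)] continuous_on_bounded_ivl[OF c(2)] by metis
  then have W: "x \<in> {a..b} \<Longrightarrow> (m1 x - J)\<^sup>2 \<le> max W1 W2" "x \<in> {a..b} \<Longrightarrow> (m2 x - J)\<^sup>2 \<le> max W1 W2" for x
    by (force simp: le_max_iff_disj)+
  have "(m1 x - J)\<^sup>2 = (m2 x - J)\<^sup>2"
  proof (rule weak_solution_solves[OF m(1) W(1)], assumption)
    fix E1 c1 assume 1: "solves (max W1 W2) (\<lambda>x. (m1 x - J)\<^sup>2) E1"
      "\<And>x. x \<in> {a..b} \<Longrightarrow> E1 x = c1 + integral {a..x} (\<lambda>x. momentum J (max W1 W2) ((m1 x - J)\<^sup>2) - q x)"
    show ?thesis
    proof (rule weak_solution_solves[OF m(2) W(2)], assumption)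
      fix E2 c2 assume 2: "solves (max W1 W2) (\<lambda>x. (m2 x - J)\<^sup>2) E2"
        "\<And>x. x \<in> {a..b} \<Longrightarrow> E2 x = c2 + integral {a..x} (\<lambda>x. momentum J (max W1 W2) ((m2 x - J)\<^sup>2) - q x)"
      have "(m1 a - J)\<^sup>2 = (m2 a - J)\<^sup>2" "(m1 b - J)\<^sup>2 = (m2 b - J)\<^sup>2" using m by (auto simp: weak_solution_def)
      then show ?thesis
        by (intro antisym solves_unique[OF 1(1) 2(1) 1(2) 2(2) _ _ x] solves_unique[OF 2(1) 1(1) 2(2) 1(2) _ _ x]) auto
    qed
  qed
  \<comment> \<open>This selects the nonnegative root when passing from equal squares to equal
    functions.\<close>
  moreover have "J \<le> m1 x" "J \<le> m2 x"
  proof -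
    have "x = a \<or> x = b \<or> x \<in> {a<..<b}" using x by auto
    then show "J \<le> m1 x" "J \<le> m2 x" using m unfolding weak_solution_def by (auto intro: less_imp_le)
  qed
  ultimately show ?thesis unfolding power2_eq_iff by linarith
qed

lemma interior_subsonic_solution_iff:
  assumes "p = (\<lambda>r. r ^ (n - 1))" "q = (\<lambda>r. B r - r powi (int n - 3) * (real n - 1) * (real n - 2))"
  shows "interior_subsonic_solution n a b \<tau> J B m \<longleftrightarrow> weak_solution m"
proof -
  have diff: "x - (y - z) = x - y + z" for x y z :: real by simp
  show ?thesis
    unfolding interior_subsonic_solution_def weak_solution_def unfolding assms diff by (rule refl)
qed

end

lemma sqrt_diff_le: "0 \<le> u \<Longrightarrow> 0 \<le> v \<Longrightarrow> \<bar>sqrt u - sqrt v\<bar> \<le> sqrt \<bar>u - v\<bar>"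
proof (induction u v rule: linorder_wlog)
  case (le u v)
  have "sqrt (u + (v - u)) \<le> sqrt u + sqrt (v - u)"
    by (rule sqrt_add_le_add_sqrt) (use le in auto)
  then show ?case using le by simp
next
  case (sym u v)
  then show ?case by (simp add: abs_minus_commute)
qed

context flow_barriers
begin

theorem weak_solution_exists_unique:
  "\<exists>m. weak_solution m \<and> (\<forall>m'. weak_solution m' \<longrightarrow> (\<forall>r\<in>{a..b}. m' r = m r)) \<and>
    holder_on (1 / 2) a b m \<and> (\<exists>l>0. \<forall>r\<in>{a..b}. m r \<ge> J + l * sin (pi * ((r - a) / (b - a))))"
proof (rule subsonic_solution_exists)
  fix w E c l
  assume s: "solves ((M - J)\<^sup>2) w E" "w a = 0" "w b = 0"
    and E: "\<And>x. x \<in> {a..b} \<Longrightarrow> E x = c + integral {a..x} (\<lambda>x. momentum J ((M - J)\<^sup>2) (w x) - q x)"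
    and l: "0 < l" and low: "\<And>x. x \<in> {a..b} \<Longrightarrow> (l * arch x)\<^sup>2 \<le> w x"
    and upp: "\<And>x. x \<in> {a..b} \<Longrightarrow> w x \<le> (M - J)\<^sup>2"
  have w0: "0 \<le> w x" if "x \<in> {a..b}" for x using low[OF that] by (meson order_trans zero_le_power2)
  have wpos: "0 < w x" if x: "x \<in> {a<..<b}" for x
  proof -
    have "0 < pi * ((x - a) / (b - a))" "pi * ((x - a) / (b - a)) < pi * 1"
      using x by (auto intro!: mult_strict_left_mono simp: divide_less_eq)
    then have "0 < arch x" unfolding arch_def by (intro sin_gt_zero) auto
    then have "0 < (l * arch x)\<^sup>2" using l by simp
    also have "\<dots> \<le> w x" by (rule low) (use x in auto)
    finally show ?thesis .
  qed
  have sol: "weak_solution (\<lambda>x. J + sqrt (w x))"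
    by (rule solves_weak_solution[OF s E w0 upp wpos])
  have d: "(w has_real_derivative slope ((M - J)\<^sup>2) w E x) (at x within {a..b})" if "x \<in> {a..b}" for x
    using s(1) that by (simp add: solves_def)
  have wc: "continuous_on {a..b} w" by (rule DERIV_continuous_on[OF d])
  have Ec: "continuous_on {a..b} E"
    by (rule flux_continuous[OF wc E])
  obtain L where L: "\<And>x. x \<in> {a..b} \<Longrightarrow> \<bar>slope ((M - J)\<^sup>2) w E x\<bar> \<le> L" "L \<ge> 0"
    using continuous_on_bounded_ivl[OF continuous_slope[OF wc Ec]] by metis
  have "holder_on (1 / 2) a b (\<lambda>x. J + sqrt (w x))"
    unfolding holder_on_def
  proof (intro exI ballI)
    fix x y assume x: "x \<in> {a..b}" and y: "y \<in> {a..b}"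
    have "norm (w x - w y) \<le> L * norm (x - y)"
      by (rule field_differentiable_bound[OF _ d]) (use L x y in auto)
    then have "sqrt \<bar>w x - w y\<bar> \<le> sqrt (L * \<bar>x - y\<bar>)" by simp
    then have "\<bar>sqrt (w x) - sqrt (w y)\<bar> \<le> sqrt L * sqrt \<bar>x - y\<bar>"
      using sqrt_diff_le[OF w0[OF x] w0[OF y]] by (simp add: real_sqrt_mult)
    then show "\<bar>J + sqrt (w x) - (J + sqrt (w y))\<bar> \<le> sqrt L * \<bar>x - y\<bar> powr (1 / 2)"
      by (simp add: powr_half_sqrt)
  qed
  moreover have "J + l * sin (pi * ((r - a) / (b - a))) \<le> J + sqrt (w r)" if r: "r \<in> {a..b}" for r
  proof -
    have "l * arch r \<le> sqrt (w r)" by (rule real_le_rsqrt[OF low[OF r]])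
    then show ?thesis by (simp add: arch_def)
  qed
  ultimately show ?thesis
    using sol weak_solution_unique[OF _ sol] l by (intro exI[of _ "\<lambda>x. J + sqrt (w x)"]) blast
qed

end

section \<open>Essential bounds and the two dimensions\<close>

lemma ess_sup_real_bounds:
  assumes ab: "a < b" and f: "f \<in> borel_measurable (leb_ivl a b)" "AE x in leb_ivl a b. \<bar>f x\<bar> \<le> C"
  shows "AE x in leb_ivl a b. f x \<le> ess_sup_real (leb_ivl a b) f"
proof -
  define S where "S = esssup (leb_ivl a b) (\<lambda>x. ereal (f x))"
  have fS: "AE x in leb_ivl a b. ereal (f x) \<le> S" unfolding S_def by (rule esssup_AE)
  have "S \<le> ereal C" unfolding S_def
    by (rule esssup_I) (use f in \<open>auto elim: AE_mp\<close>)
  \<comment> \<open>\<open>real_of_ereal\<close> maps infinite values to 0, so finiteness must be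
    known; the value \<open>- \<infinity>\<close> is excluded because the interval has positive
    measure.\<close>
  moreover have "S \<noteq> - \<infinity>"
  proof
    assume "S = - \<infinity>"
    with fS show False using AE_leb_ivl_False[OF ab] by simp
  qed
  ultimately obtain s where s: "S = ereal s" by (cases S) auto
  then have "ess_sup_real (leb_ivl a b) f = s" by (simp add: ess_sup_real_def S_def)
  then show ?thesis using fS s by simp
qed

lemma ess_inf_real_bounds:
  assumes ab: "a < b" and f: "f \<in> borel_measurable (leb_ivl a b)" "AE x in leb_ivl a b. \<bar>f x\<bar> \<le> C"
  shows "AE x in leb_ivl a b. ess_inf_real (leb_ivl a b) f \<le> f x"
proof -
  have "ess_inf_real (leb_ivl a b) f = - ess_sup_real (leb_ivl a b) (\<lambda>x. - f x)"
    by (simp add: ess_inf_real_def essinf_def ess_sup_real_def real_of_ereal_minus')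
  moreover have "AE x in leb_ivl a b. - f x \<le> ess_sup_real (leb_ivl a b) (\<lambda>x. - f x)"
    by (rule ess_sup_real_bounds[OF ab]) (use f in auto)
  ultimately show ?thesis by (simp add: minus_le_iff)
qed

lemma Linf_AE_bounded:
  assumes "f \<in> Linf M" obtains C where "AE x in M. \<bar>f x\<bar> \<le> C"
proof -
  define S where "S = esssup M (\<lambda>x. ereal \<bar>f x\<bar>)"
  have fS: "AE x in M. ereal \<bar>f x\<bar> \<le> S" unfolding S_def by (rule esssup_AE)
  have "S < \<infinity>" using assms by (simp add: Linf_def S_def)
  then have "AE x in M. \<bar>f x\<bar> \<le> real_of_ereal S"
    using fS by (cases S) auto
  then show thesis by (rule that)
qed

lemma subsonic_solution_unique_existence:
  fixes B :: "real \<Rightarrow> real"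
  assumes ab: "0 < a" "a < b" and \<tau>: "\<tau> > 0" and J: "J > 0" and n: "n \<ge> 1"
    and q: "q = (\<lambda>r. B r - r powi (int n - 3) * (real n - 1) * (real n - 2))"
    and meas: "q \<in> borel_measurable (leb_ivl a b)" "AE r in leb_ivl a b. \<bar>q r\<bar> \<le> C"
    and M: "M > J" and \<delta>: "\<delta> > 0"
    and upper: "AE r in leb_ivl a b. (real n - 1) * r ^ (n - 2) * J / (\<tau> * M) \<le> M - q r"
    and lower: "AE r in leb_ivl a b. J - q r + \<delta> \<le> (real n - 1) * r ^ (n - 2) / \<tau>"
  shows "\<exists>m. interior_subsonic_solution n a b \<tau> J B m \<and>
            (\<forall>m'. interior_subsonic_solution n a b \<tau> J B m' \<longrightarrow> (\<forall>r\<in>{a..b}. m' r = m r)) \<and>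
            holder_on (1 / 2) a b m \<and>
            (\<exists>l>0. \<forall>r\<in>{a..b}. m r \<ge> J + l * sin (pi * ((r - a) / (b - a))))"
proof -
  interpret flow_barriers a b \<tau> J "\<lambda>r. r ^ (n - 1)" q C "\<lambda>r. (real n - 1) * r ^ (n - 2)" M \<delta>
  proof
    \<comment> \<open>The exponent \<open>n - 2\<close> is truncated at \<open>n = 1\<close>, where
      the factor \<open>real n - 1\<close> is zero anyway.\<close>
    show "((\<lambda>r. r ^ (n - 1)) has_real_derivative (real n - 1) * x ^ (n - 2)) (at x within {a..b})" for x
      using n by (auto intro!: derivative_eq_intros simp: of_nat_diff numeral_2_eq_2)
  qed (use assms in \<open>auto intro!: continuous_intros\<close>)
  show ?thesis
    unfolding interior_subsonic_solution_iff[OF refl q] by (rule weak_solution_exists_unique)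
qed

theorem theorem1p4:
  fixes r0 r1 \<tau> J :: real and n :: nat and b B :: "real \<Rightarrow> real"
  assumes "0 < r0" and "r0 < r1" and "\<tau> > 0" and "J > 0" and "n \<in> {2, 3}"
    and "b \<in> Linf (leb_ivl r0 r1)" and "AE r in leb_ivl r0 r1. b r > 0"
    and "B = (\<lambda>r. r ^ (n - 1) * b r)"
  shows "(n = 2 \<longrightarrow>
      (let Bmin = ess_inf_real (leb_ivl r0 r1) B;
           Bmax = ess_sup_real (leb_ivl r0 r1) B
       in Bmax + 1 / \<tau> > J \<longrightarrow> Bmin + J / (\<tau> * (Bmax + 1 / \<tau>)) > J \<longrightarrow>
         (\<exists>m. interior_subsonic_solution n r0 r1 \<tau> J B m \<and>
            (\<forall>m'. interior_subsonic_solution n r0 r1 \<tau> J B m' \<longrightarrow> (\<forall>r\<in>{r0..r1}. m' r = m r)) \<and>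
            holder_on (1 / 2) r0 r1 m \<and>
            (\<exists>l>0. \<forall>r\<in>{r0..r1}. m r \<ge> J + l * sin (pi * ((r - r0) / (r1 - r0)))))))
    \<and> (n = 3 \<longrightarrow>
      (let Bsup = ess_sup_real (leb_ivl r0 r1) (\<lambda>r. B r + 2 * r / \<tau> - 2)
       in Bsup > J \<longrightarrow>
          ess_inf_real (leb_ivl r0 r1) (\<lambda>r. B r + 2 * r * J / (\<tau> * Bsup) - 2) > J \<longrightarrow>
         (\<exists>m. interior_subsonic_solution n r0 r1 \<tau> J B m \<and>
            (\<forall>m'. interior_subsonic_solution n r0 r1 \<tau> J B m' \<longrightarrow> (\<forall>r\<in>{r0..r1}. m' r = m r)) \<and>
            holder_on (1 / 2) r0 r1 m \<and>
            (\<exists>l>0. \<forall>r\<in>{r0..r1}. m r \<ge> J + l * sin (pi * ((r - r0) / (r1 - r0)))))))"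
proof -
  let ?M = "leb_ivl r0 r1"
  obtain C where C: "AE r in ?M. \<bar>b r\<bar> \<le> C" using Linf_AE_bounded[OF assms(6)] by blast
  have bM: "b \<in> borel_measurable ?M" using assms(6) by (simp add: Linf_def)
  have pM: "(\<lambda>r. r ^ (n - 1)) \<in> borel_measurable ?M" and aff: "(\<lambda>r. k * r + l) \<in> borel_measurable ?M" for k l :: real
    by (intro continuous_on_measurable_leb_ivl continuous_intros)+
  have BM: "B \<in> borel_measurable ?M" unfolding assms(8) using pM bM by (rule borel_measurable_times)
  define D where "D = r1 ^ (n - 1) * C"
  have BD: "AE r in ?M. \<bar>B r\<bar> \<le> D"
    using C AE_leb_ivl_interior
  proof eventually_elim
    case (elim r)
    then show ?case unfolding assms(8) D_def abs_mult using assms(1)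
      by (intro mult_mono) (auto intro!: power_mono)
  qed
  have bound: "\<bar>k * r + l\<bar> \<le> \<bar>k\<bar> * r1 + \<bar>l\<bar>" if "r0 < r" "r < r1" for k l r
  proof -
    have "\<bar>k * r\<bar> \<le> \<bar>k\<bar> * r1" using that assms(1) by (auto simp: abs_mult intro!: mult_left_mono)
    then show ?thesis by linarith
  qed
  have affM: "(\<lambda>r. B r + (k * r + l)) \<in> borel_measurable ?M"
    and affD: "AE r in ?M. \<bar>B r + (k * r + l)\<bar> \<le> D + (\<bar>k\<bar> * r1 + \<bar>l\<bar>)" for k l
  proof -
    show "(\<lambda>r. B r + (k * r + l)) \<in> borel_measurable ?M" using BM aff by (rule borel_measurable_add)
    show "AE r in ?M. \<bar>B r + (k * r + l)\<bar> \<le> D + (\<bar>k\<bar> * r1 + \<bar>l\<bar>)"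
      using BD AE_leb_ivl_interior
    proof eventually_elim
      case (elim r)
      then show ?case using bound[of r k l] by linarith
    qed
  qed
  show ?thesis
  proof (intro conjI impI; unfold Let_def; intro impI)
    assume n: "n = 2"
    define \<beta> where "\<beta> = ess_sup_real ?M B"
    define \<gamma> where "\<gamma> = ess_inf_real ?M B"
    assume "ess_sup_real ?M B + 1 / \<tau> > J" "ess_inf_real ?M B + J / (\<tau> * (ess_sup_real ?M B + 1 / \<tau>)) > J"
    then have h: "\<beta> + 1 / \<tau> > J" "\<gamma> + J / (\<tau> * (\<beta> + 1 / \<tau>)) > J" by (simp_all add: \<beta>_def \<gamma>_def)
    \<comment> \<open>This consequence of \<open>J < M\<close> connects both barrier conditions with
      the hypotheses on \<open>B\<close>, here with \<open>M = \<beta> + 1 / \<tau>\<close>.\<close>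
    have J\<tau>: "J / (\<tau> * (\<beta> + 1 / \<tau>)) \<le> 1 / \<tau>"
    proof -
      have "J / (\<tau> * (\<beta> + 1 / \<tau>)) = (1 / \<tau>) * (J / (\<beta> + 1 / \<tau>))" by simp
      also have "\<dots> \<le> (1 / \<tau>) * 1" using assms(3,4) h(1) by (intro mult_left_mono) auto
      finally show ?thesis by simp
    qed
    have q: "B = (\<lambda>r. B r - r powi (int n - 3) * (real n - 1) * (real n - 2))" by (simp add: n)
    show "\<exists>m. interior_subsonic_solution n r0 r1 \<tau> J B m \<and>
            (\<forall>m'. interior_subsonic_solution n r0 r1 \<tau> J B m' \<longrightarrow> (\<forall>r\<in>{r0..r1}. m' r = m r)) \<and>
            holder_on (1 / 2) r0 r1 m \<and>
            (\<exists>l>0. \<forall>r\<in>{r0..r1}. m r \<ge> J + l * sin (pi * ((r - r0) / (r1 - r0))))"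
    \<comment> \<open>The margin is the gap in the hypothesis on the essential infimum.\<close>
    proof (rule subsonic_solution_unique_existence[OF assms(1-4) _ q BM BD h(1), of "\<gamma> + J / (\<tau> * (\<beta> + 1 / \<tau>)) - J"])
      have "AE r in ?M. B r \<le> \<beta>" unfolding \<beta>_def by (rule ess_sup_real_bounds[OF assms(2) BM BD])
      then show "AE r in ?M. (real n - 1) * r ^ (n - 2) * J / (\<tau> * (\<beta> + 1 / \<tau>)) \<le> \<beta> + 1 / \<tau> - B r"
        by eventually_elim (use J\<tau> n in simp)
      have "AE r in ?M. \<gamma> \<le> B r" unfolding \<gamma>_def by (rule ess_inf_real_bounds[OF assms(2) BM BD])
      then show "AE r in ?M. J - B r + (\<gamma> + J / (\<tau> * (\<beta> + 1 / \<tau>)) - J) \<le> (real n - 1) * r ^ (n - 2) / \<tau>"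
        by eventually_elim (use J\<tau> n in simp)
    qed (use h n in auto)
  next
    assume n: "n = 3"
    define \<beta> where "\<beta> = ess_sup_real ?M (\<lambda>r. B r + 2 * r / \<tau> - 2)"
    define \<gamma> where "\<gamma> = ess_inf_real ?M (\<lambda>r. B r + 2 * r * J / (\<tau> * \<beta>) - 2)"
    assume "ess_sup_real ?M (\<lambda>r. B r + 2 * r / \<tau> - 2) > J"
      "ess_inf_real ?M (\<lambda>r. B r + 2 * r * J / (\<tau> * ess_sup_real ?M (\<lambda>r. B r + 2 * r / \<tau> - 2)) - 2) > J"
    then have h: "\<beta> > J" "\<gamma> > J" by (simp_all add: \<beta>_def \<gamma>_def)
    have J\<tau>: "2 * r * J / (\<tau> * \<beta>) \<le> 2 * r / \<tau>" if "r0 < r" for r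
    proof -
      have "2 * r * J / (\<tau> * \<beta>) = (2 * r / \<tau>) * (J / \<beta>)" by simp
      also have "\<dots> \<le> (2 * r / \<tau>) * 1" using that assms(1,3,4) h(1) by (intro mult_left_mono) auto
      finally show ?thesis by simp
    qed
    \<comment> \<open>The zeroth-order term is \<open>r powi 0 * 2 * 1 = 2\<close>, so
      \<open>q\<close> is \<open>B\<close> shifted by 2.\<close>
    have q: "(\<lambda>r. B r - 2) = (\<lambda>r. B r - r powi (int n - 3) * (real n - 1) * (real n - 2))" by (simp add: n)
    have sup: "AE r in ?M. B r + 2 * r / \<tau> - 2 \<le> \<beta>"
      unfolding \<beta>_def using affM[of "2 / \<tau>" "- 2"] affD[of "2 / \<tau>" "- 2"]
      by (intro ess_sup_real_bounds[OF assms(2)]) (simp_all add: add_diff_eq)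
    have inf: "AE r in ?M. \<gamma> \<le> B r + 2 * r * J / (\<tau> * \<beta>) - 2"
      unfolding \<gamma>_def using affM[of "2 * J / (\<tau> * \<beta>)" "- 2"] affD[of "2 * J / (\<tau> * \<beta>)" "- 2"]
      by (intro ess_inf_real_bounds[OF assms(2)]) (simp_all add: add_diff_eq mult_ac)
    show "\<exists>m. interior_subsonic_solution n r0 r1 \<tau> J B m \<and>
            (\<forall>m'. interior_subsonic_solution n r0 r1 \<tau> J B m' \<longrightarrow> (\<forall>r\<in>{r0..r1}. m' r = m r)) \<and>
            holder_on (1 / 2) r0 r1 m \<and>
            (\<exists>l>0. \<forall>r\<in>{r0..r1}. m r \<ge> J + l * sin (pi * ((r - r0) / (r1 - r0))))"
    proof (rule subsonic_solution_unique_existence[OF assms(1-4) _ q _ _ h(1), of _ "\<gamma> - J"])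
      show "(\<lambda>r. B r - 2) \<in> borel_measurable ?M" "AE r in ?M. \<bar>B r - 2\<bar> \<le> D + 2"
        using affM[of 0 "- 2"] affD[of 0 "- 2"] by simp_all
      show "AE r in ?M. (real n - 1) * r ^ (n - 2) * J / (\<tau> * \<beta>) \<le> \<beta> - (B r - 2)"
        using sup AE_leb_ivl_interior
      proof eventually_elim
        case (elim r)
        then show ?case using J\<tau>[of r] by (simp add: n)
      qed
      show "AE r in ?M. J - (B r - 2) + (\<gamma> - J) \<le> (real n - 1) * r ^ (n - 2) / \<tau>"
        using inf AE_leb_ivl_interior
      proof eventually_elim
        case (elim r)
        then show ?case using J\<tau>[of r] by (simp add: n)
      qed
    qed (use h n in auto)
  qed
qed

end
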